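(* Let $q=2^r$. Whenever $\pm$ signs appear below, either $+$ is chosen everywhere or $-$ is chosen everywhere. (a) With $+$ signs, for each even $n\ge 2$ and all $q$; and with $-$ signs, for each odd $n\ge 3$ and all $q$, or for $n=1$ and $q\ge 8$, the following recursive formula holds for $h=1,2,\dots$: $$MK^h=\sum_{l=0}^{h-1}(-1)^{h+l+1}\binom{h}{l}B_1^{\pm}(n,q)^{h-l}MK^{l}+qA_1^{\pm}(n,q)^{-h}\sum_{j=0}^{\min\{N_1^{\pm}(n,q),h\}}(-1)^{h+j}C_{1,j}^{\pm}(n,q)\sum_{t=j}^{h}t!\,S(h,t)\,2^{h-t}\binom{N_1^{\pm}(n,q)-j}{N_1^{\pm}(n,q)-t}.$$ Here $N_1^{\pm}(n,q)=|DC_1^{\pm}(n,q)|=A_1^{\pm}(n,q)B_1^{\pm}(n,q)$, and the weight distribution $\{C_{1,j}^{\pm}(n,q)\}_{j=0}^{N_1^{\pm}(n,q)}$ of $C(DC_1^{\pm}(n,q))$ is given by $$C_{1,j}^{\pm}(n,q)=\sum\binom{q^{-1}A_1^{\pm}(n,q)(B_1^{\pm}(n,q)+1)}{\nu_0}\prod_{tr(\beta^{-1})=0}\binom{q^{-1}A_1^{\pm}(n,q)(B_1^{\pm}(n,q)+q+1)}{\nu_\beta}\prod_{tr(\beta^{-1})=1}\binom{q^{-1}A_1^{\pm}(n,q)(B_1^{\pm}(n,q)-q+1)}{\nu_\beta}.$$ The sum is over all families of nonnegative integers $\{\nu_\beta\}_{\beta\in\mathbb{F}_q}$ with $\sum_{\beta\in\mathbb{F}_q}\nu_\beta=j$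 and $\sum_{\beta\in\mathbb{F}_q}\nu_\beta\beta=0$ in $\mathbb{F}_q$. The products are over $\beta\in\mathbb{F}_q^*$. (b) With $+$ signs, for each even $n\ge2$ and all $q\ge4$; and with $-$ signs, for each odd $n\ge3$ and $q\ge4$, the following hold for $h=1,2,\dots$: $$MK_2^h=\sum_{l=0}^{h-1}(-1)^{h+l+1}\binom{h}{l}(B_2^{\pm}(n,q)-q^2)^{h-l}MK_2^{l}+qA_2^{\pm}(n,q)^{-h}\sum_{j=0}^{\min\{N_2^{\pm}(n,q),h\}}(-1)^{h+j}C_{2,j}^{\pm}(n,q)\sum_{t=j}^{h}t!\,S(h,t)\,2^{h-t}\binom{N_2^{\pm}(n,q)-j}{N_2^{\pm}(n,q)-t},$$ and $$MK^{2h}=\sum_{l=0}^{h-1}(-1)^{h+l+1}\binom{h}{l}(B_2^{\pm}(n,q)-q^2+q)^{h-l}MK^{2l}+qA_2^{\pm}(n,q)^{-h}\sum_{j=0}^{\min\{N_2^{\pm}(n,q),h\}}(-1)^{h+j}C_{2,j}^{\pm}(n,q)\sum_{t=j}^{h}t!\,S(h,t)\,2^{h-t}\binom{N_2^{\pm}(n,q)-j}{N_2^{\pm}(n,q)-t}.$$ Here $N_2^{\pm}(n,q)=|DC_2^{\pm}(n,q)|=A_2^{\pm}(n,q)B_2^{\pm}(n,q)$, and the weight distribution $\{C_{2,j}^{\pm}(n,q)\}_{j=0}^{N_2^{\pm}(n,q)}$ of $C(DC_2^{\pm}(n,q))$ is given by $$C_{2,j}^{\pm}(n,q)=\sum\binom{q^{-1}A_2^{\pm}(n,q)(B_2^{\pm}(n,q)+q^3-q^2-1)}{\nu_0}\prod_{\substack{|\tau|<2\sqrt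 q\\ \tau\equiv-1\ (\mathrm{mod}\ 4)}}\ \prod_{\beta\in\mathbb{F}_q^*:\,K(\lambda;\beta^{-1})=\tau}\binom{q^{-1}A_2^{\pm}(n,q)(B_2^{\pm}(n,q)+q\tau-q^2-1)}{\nu_\beta}.$$ The sum is over all families of nonnegative integers $\{\nu_\beta\}_{\beta\in\mathbb{F}_q}$ with $\sum_\beta\nu_\beta=j$ and $\sum_\beta\nu_\beta\beta=0$.
   Context: Let $q=2^r$ ($r\ge1$ an integer) and let $\mathbb{F}_q$ be the field with $q$ elements. Let $tr:\mathbb{F}_q\to\mathbb{F}_2$, $tr(x)=x+x^2+\cdots+x^{2^{r-1}}$, and let $\lambda(x)=(-1)^{tr(x)}$ be the canonical additive character. For $a\in\mathbb{F}_q^*$, the Kloosterman sum is $K(\lambda;a)=\sum_{\alpha\in\mathbb{F}_q^*}\lambda(\alpha+a\alpha^{-1})$, and the 2-dimensional Kloosterman sum is $K_2(\lambda;a)=\sum_{\alpha_1,\alpha_2\in\mathbb{F}_q^*}\lambda(\alpha_1+\alpha_2+a\alpha_1^{-1}\alpha_2^{-1})$. For $h\ge0$, $MK^h=\sum_{a\in\mathbb{F}_q^*}K(\lambda;a)^h$ and $MK_2^h=\sum_{a\in\mathbb{F}_q^*}K_2(\lambda;a)^h$. $S(h,t)=\frac1{t!}\sum_{j=0}^t(-1)^{t-j}\binom tj j^h$ is the Stirling number of the second kind. Binomial coefficients satisfy $\binom ba=0$ if $a>b$ or $a<0$. $Tr\,w$ denotes the matrix trace. For $n\ge1$, $O^+(2n,q)$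 is the group of $g\in GL(2n,q)$ preserving the quadratic form $\theta^+(x)=\sum_{i=1}^n x_ix_{n+i}$ on $\mathbb{F}_q^{2n\times1}$. The subgroup $P^+(2n,q)$ consists of all products $\begin{bmatrix}A&0\\0&{}^tA^{-1}\end{bmatrix}\begin{bmatrix}1_n&B\\0&1_n\end{bmatrix}$ with $A\in GL(n,q)$ and $B$ an $n\times n$ alternating matrix, i.e. symmetric with zero diagonal. For $0\le s\le n$, let $\sigma_s^+$ be the $2n\times2n$ matrix which, in block form for the partition $2n=s+(n-s)+s+(n-s)$, is $\begin{bmatrix}0&0&1_s&0\\0&1_{n-s}&0&0\\1_s&0&0&0\\0&0&0&1_{n-s}\end{bmatrix}$. Write $P^+=P^+(2n,q)$. The double cosets are: - $DC_1^+(n,q)=P^+\sigma_{n-1}^+P^+$ and $DC_2^+(n,q)=P^+\sigma_{n-2}^+P^+$ for even $n\ge2$; - $DC_1^-(n,q)=P^+\sigma_{n-1}^+P^+$ for odd $n\ge1$; - $DC_2^-(n,q)=P^+\sigma_{n-2}^+P^+$ for odd $n\ge3$. With the Gaussian binomial $\left[\begin{smallmatrix}n\\k\end{smallmatrix}\right]_q=\prod_{j=0}^{k-1}\frac{q^{n-j}-1}{q^{k-j}-1}$ and empty products equal to $1$, define: - $A_1^+(n,q)=q^{(5n^2-6n)/4}\left[\begin{smallmatrix}n\\1\end{smallmatrix}\right]_q\prod_{j=1}^{n/2}(q^{2j-1}-1)$; - $B_1^+(n,q)=q^{(n-2)^2/4}\prod_{j=1}^{n/2}(q^{2j}-1)$;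 - $A_2^+(n,q)=q^{(5n^2-6n)/4}\left[\begin{smallmatrix}n\\2\end{smallmatrix}\right]_q\prod_{j=1}^{(n-2)/2}(q^{2j-1}-1)$; - $B_2^+(n,q)=q^{(n^2-8n+12)/4}(q^{n-1}-1)(q^n-1)\prod_{j=1}^{(n-2)/2}(q^{2j}-1)$; - $A_1^-(n,q)=q^{(5n^2-4n-1)/4}\left[\begin{smallmatrix}n\\1\end{smallmatrix}\right]_q\prod_{j=1}^{(n-1)/2}(q^{2j-1}-1)$; - $B_1^-(n,q)=q^{(n^2-6n+5)/4}(q^n-1)\prod_{j=1}^{(n-1)/2}(q^{2j}-1)$; - $A_2^-(n,q)=q^{(5n^2-8n+3)/4}\left[\begin{smallmatrix}n\\2\end{smallmatrix}\right]_q\prod_{j=1}^{(n-1)/2}(q^{2j-1}-1)$; - $B_2^-(n,q)=q^{(n-3)^2/4}(q^n-1)\prod_{j=1}^{(n-1)/2}(q^{2j}-1)$. Codes: for $i\in\{1,2\}$, let $N=N_i^\pm(n,q)=|DC_i^\pm(n,q)|$ and fix an ordering $g_1,\dots,g_N$ of $DC_i^\pm(n,q)$. The binary code is $C(DC_i^\pm(n,q))=\{u\in\mathbb{F}_2^N:\sum_{j=1}^N u_j\,Tr\,g_j=0\text{ in }\mathbb{F}_q\}$. Its weight distribution is given by $C_{i,j}^\pm(n,q)$, the number of its codewords of Hamming weight $j$. *)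

theory Defs
  imports
    Complex_Main
    "HOL-Library.Cardinality"
    "HOL-Library.Z2"
    "HOL-Combinatorics.Stirling"
    "HOL-Number_Theory.Cong"
    "Jordan_Normal_Form.Matrix"
begin

section \<open>Characters and Kloosterman sums\<close>

text \<open>
  The field with \<open>q = 2\<^sup>r\<close> elements is a type \<open>'a\<close> of class \<open>field\<close> and \<open>finite\<close> with
  \<open>CARD('a) = 2 ^ r\<close>; the exponent \<open>r\<close> is passed explicitly. The absolute trace is taken
  with values in \<open>'a\<close>, where it lies in the prime field \<open>{0, 1}\<close>.
\<close>

definition abs_tr :: "nat \<Rightarrow> 'a::field \<Rightarrow> 'a" where
  "abs_tr r x = (\<Sum>i<r. x ^ (2 ^ i))"

definition lam :: "nat \<Rightarrow> 'a::field \<Rightarrow> int" where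
  "lam r x = (if abs_tr r x = 0 then 1 else -1)"

definition Kl :: "nat \<Rightarrow> 'a::{field,finite} \<Rightarrow> int" where
  "Kl r a = (\<Sum>\<alpha>\<in>UNIV - {0}. lam r (\<alpha> + a * inverse \<alpha>))"

definition Kl2 :: "nat \<Rightarrow> 'a::{field,finite} \<Rightarrow> int" where
  "Kl2 r a = (\<Sum>\<alpha>1\<in>UNIV - {0}. \<Sum>\<alpha>2\<in>UNIV - {0}.
      lam r (\<alpha>1 + \<alpha>2 + a * inverse \<alpha>1 * inverse \<alpha>2))"

definition MK :: "'a::{field,finite} itself \<Rightarrow> nat \<Rightarrow> nat \<Rightarrow> int" where
  "MK _ r h = (\<Sum>a\<in>UNIV - {0 :: 'a}. Kl r a ^ h)"

definition MK2 :: "'a::{field,finite} itself \<Rightarrow> nat \<Rightarrow> nat \<Rightarrow> int" where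
  "MK2 _ r h = (\<Sum>a\<in>UNIV - {0 :: 'a}. Kl2 r a ^ h)"


section \<open>Combinatorial coefficients\<close>

text \<open>
  Binomial coefficients vanish outside \<open>0 \<le> a \<le> b\<close>. The upper argument is real because
  upper arguments such as \<open>A (B + 1) / q\<close> are integers only as a whole (\<open>B\<close> itself may be
  a proper fraction).
\<close>

definition binom :: "real \<Rightarrow> int \<Rightarrow> real" where
  "binom b a = (if 0 \<le> a \<and> of_int a \<le> b then b gchoose nat a else 0)"

definition gauss_binom :: "nat \<Rightarrow> nat \<Rightarrow> real \<Rightarrow> real" where
  "gauss_binom n k q = (\<Prod>j<k. (q ^ (n - j) - 1) / (q ^ (k - j) - 1))"

text \<open>The library's \<^const>\<open>Stirling\<close> is given by the usual alternating sum.\<close>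

lemma Stirling_closed_form:
  "real (Stirling h t) = 1 / fact t * (\<Sum>j\<le>t. (-1) ^ (t - j) * real (t choose j) * real j ^ h)"
proof -
  define F where
    "F h t = (\<Sum>j\<le>t. (-1) ^ (t - j) * real (t choose j) * real j ^ h)" for h t :: nat
  have rec: "F (Suc h) (Suc t) = real (Suc t) * (F h (Suc t) + F h t)" for h t
  proof -
    have absorb: "real (Suc t choose j) * real j = real (Suc t) * (real (Suc t choose j) - real (t choose j))"
      for j
    proof (cases j)
      case (Suc i)
      have "Suc i * (Suc t choose Suc i) = Suc t * (t choose i)"
        by (rule Suc_times_binomial)
      then have "real (Suc i) * real (Suc t choose Suc i) = real (Suc t) * real (t choose i)"
        by (metis of_nat_mult)
      moreover have "real (Suc t choose Suc i) - real (t choose Suc i) = real (t choose i)"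
        by simp
      ultimately show ?thesis
        by (simp only: Suc mult.commute)
    qed simp
    have "F (Suc h) (Suc t) =
        (\<Sum>j\<le>Suc t. (-1) ^ (Suc t - j) * (real (Suc t choose j) * real j) * real j ^ h)"
      unfolding F_def by (simp only: power_Suc mult_ac)
    also have "\<dots> = real (Suc t) *
        (F h (Suc t) - (\<Sum>j\<le>Suc t. (-1) ^ (Suc t - j) * real (t choose j) * real j ^ h))"
      unfolding absorb F_def right_diff_distrib sum_distrib_left sum_subtractf[symmetric]
      by (intro sum.cong refl) (simp only: algebra_simps)
    also have "(\<Sum>j\<le>Suc t. (-1) ^ (Suc t - j) * real (t choose j) * real j ^ h) = - F h t"
      unfolding F_def sum_negf[symmetric]
      by (simp add: Suc_diff_le)
    finally show ?thesis by simp
  qed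
  have "F h t = fact t * real (Stirling h t)"
  proof (induction h arbitrary: t)
    case 0
    show ?case
    proof (cases t)
      case (Suc s)
      have "F 0 t = (\<Sum>j\<le>t. real (t choose j) * 1 ^ j * (-1) ^ (t - j))"
        by (simp add: F_def mult_ac)
      also have "\<dots> = (1 + (-1)) ^ t"
        by (rule binomial_ring[symmetric])
      finally show ?thesis using Suc by simp
    qed (simp add: F_def)
  next
    case (Suc h)
    show ?case
    proof (cases t)
      case (Suc s)
      then show ?thesis by (simp add: rec Suc.IH algebra_simps)
    qed (simp add: F_def)
  qed
  then show ?thesis by (simp add: F_def)
qed


section \<open>Double cosets in the orthogonal group\<close>

definition mat_trace :: "'a::comm_monoid_add mat \<Rightarrow> 'a" where
  "mat_trace w = (\<Sum>i<dim_row w. w $$ (i, i))"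

definition alternating_mat :: "nat \<Rightarrow> 'a::field mat \<Rightarrow> bool" where
  "alternating_mat n B \<longleftrightarrow>
     B \<in> carrier_mat n n \<and> transpose_mat B = B \<and> (\<forall>i<n. B $$ (i, i) = 0)"

definition P_plus :: "nat \<Rightarrow> 'a::field mat set" where
  "P_plus n = {four_block_mat A (0\<^sub>m n n) (0\<^sub>m n n) (transpose_mat A')
                 * four_block_mat (1\<^sub>m n) B (0\<^sub>m n n) (1\<^sub>m n) | A A' B.
               A \<in> carrier_mat n n \<and> A' \<in> carrier_mat n n \<and>
               inverts_mat A A' \<and> inverts_mat A' A \<and> alternating_mat n B}"

definition sigma_plus :: "nat \<Rightarrow> nat \<Rightarrow> 'a::field mat" where
  "sigma_plus n s =
     (let E = four_block_mat (0\<^sub>m s s) (0\<^sub>m s (n - s)) (0\<^sub>m (n - s) s) (1\<^sub>m (n - s));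
          F = four_block_mat (1\<^sub>m s) (0\<^sub>m s (n - s)) (0\<^sub>m (n - s) s) (0\<^sub>m (n - s) (n - s))
      in four_block_mat E F F E)"

text \<open>
  \<open>DC i n\<close> is \<open>DC\<^sub>i\<^sup>+(n, q)\<close> for even \<open>n\<close> and \<open>DC\<^sub>i\<^sup>-(n, q)\<close> for odd \<open>n\<close>: both are the double coset
  of \<open>\<sigma>\<^sub>n\<^sub>-\<^sub>i\<close>. It is meaningful for \<open>i \<le> n\<close> only.
\<close>

definition DC :: "nat \<Rightarrow> nat \<Rightarrow> 'a::field mat set" where
  "DC i n = {p * sigma_plus n (n - i) * p' | p p'. p \<in> P_plus n \<and> p' \<in> P_plus n}"


section \<open>The constants \<open>A\<^sub>i\<^sup>\<plusminus>\<close> and \<open>B\<^sub>i\<^sup>\<plusminus>\<close>\<close>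

text \<open>
  For even \<open>n\<close> (sign \<open>+\<close>) and odd \<open>n\<close> (sign \<open>-\<close>) the divisions by \<open>4\<close> are exact. Some of the
  exponents are negative, e.g. for \<open>B2 Plus 4\<close> and \<open>B1 Minus 3\<close>.
\<close>

datatype sign = Plus | Minus

fun A1 :: "sign \<Rightarrow> nat \<Rightarrow> real \<Rightarrow> real" where
  "A1 Plus n q = q powi ((5 * int n ^ 2 - 6 * int n) div 4) * gauss_binom n 1 q
     * (\<Prod>j=1..n div 2. q ^ (2 * j - 1) - 1)"
| "A1 Minus n q = q powi ((5 * int n ^ 2 - 4 * int n - 1) div 4) * gauss_binom n 1 q
     * (\<Prod>j=1..(n - 1) div 2. q ^ (2 * j - 1) - 1)"

fun B1 :: "sign \<Rightarrow> nat \<Rightarrow> real \<Rightarrow> real" where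
  "B1 Plus n q = q powi ((int n - 2) ^ 2 div 4) * (\<Prod>j=1..n div 2. q ^ (2 * j) - 1)"
| "B1 Minus n q = q powi ((int n ^ 2 - 6 * int n + 5) div 4) * (q ^ n - 1)
     * (\<Prod>j=1..(n - 1) div 2. q ^ (2 * j) - 1)"

fun A2 :: "sign \<Rightarrow> nat \<Rightarrow> real \<Rightarrow> real" where
  "A2 Plus n q = q powi ((5 * int n ^ 2 - 6 * int n) div 4) * gauss_binom n 2 q
     * (\<Prod>j=1..(n - 2) div 2. q ^ (2 * j - 1) - 1)"
| "A2 Minus n q = q powi ((5 * int n ^ 2 - 8 * int n + 3) div 4) * gauss_binom n 2 q
     * (\<Prod>j=1..(n - 1) div 2. q ^ (2 * j - 1) - 1)"

fun B2 :: "sign \<Rightarrow> nat \<Rightarrow> real \<Rightarrow> real" where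
  "B2 Plus n q = q powi ((int n ^ 2 - 8 * int n + 12) div 4) * (q ^ (n - 1) - 1) * (q ^ n - 1)
     * (\<Prod>j=1..(n - 2) div 2. q ^ (2 * j) - 1)"
| "B2 Minus n q = q powi ((int n - 3) ^ 2 div 4) * (q ^ n - 1)
     * (\<Prod>j=1..(n - 1) div 2. q ^ (2 * j) - 1)"


section \<open>Codes\<close>

text \<open>
  The list \<open>gs\<close> is the chosen ordering of a set of matrices. The summand is \<open>u\<^sub>j Tr g\<^sub>j\<close> with
  \<open>u\<^sub>j \<in> \<bbbF>\<^sub>2\<close> embedded in \<open>'a\<close> by \<open>of_bool\<close>, which is the field embedding in characteristic \<open>2\<close>.
\<close>

definition trace_code :: "'a::field mat list \<Rightarrow> bit vec set" where
  "trace_code gs = {u \<in> carrier_vec (length gs).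
     (\<Sum>j<length gs. of_bool (u $ j = 1) * mat_trace (gs ! j)) = 0}"

definition hamming_weight :: "bit vec \<Rightarrow> nat" where
  "hamming_weight u = card {j. j < dim_vec u \<and> u $ j \<noteq> 0}"

definition weight_count :: "'a::field mat list \<Rightarrow> nat \<Rightarrow> nat" where
  "weight_count gs j = card {u \<in> trace_code gs. hamming_weight u = j}"

definition zero_sum_families :: "nat \<Rightarrow> ('a::{field,finite} \<Rightarrow> nat) set" where
  "zero_sum_families j =
     {\<nu>. (\<Sum>\<beta>\<in>UNIV. \<nu> \<beta>) = j \<and> (\<Sum>\<beta>\<in>UNIV. of_nat (\<nu> \<beta>) * \<beta>) = 0}"

end

theory Submission
  imports
    Defs
    "HOL-Computational_Algebra.Polynomial"
    "Jordan_Normal_Form.Determinant"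
begin

text \<open>
  A code given by elements \<open>x\<^sub>i\<close> of \<open>\<bbbF>\<^sub>q\<close> has its weight distribution determined by the fibres of \<open>x\<close>,
  and its power moments by the character sums \<open>\<Sum>i. \<lambda> (a x\<^sub>i)\<close> (Pless). For traces on a double coset
  \<open>P \<sigma> P\<close> such a sum is a multiple of the sum of \<open>\<lambda> (a Tr (\<sigma> p))\<close> over \<open>p \<in> P\<close>. Summing over the
  alternating part of \<open>p\<close> forces the \<open>GL(n, q)\<close> part to be block triangular with a symmetric corner of
  size \<open>s\<close>, which leaves the number of nonsingular symmetric \<open>s \<times> s\<close> matrices times a Kloosterman
  sum over \<open>GL(n - s, q)\<close>. For \<open>n - s = 1, 2\<close> the latter is elementary in terms of \<open>K\<close>, and
  \<open>K\<^sub>2 = K\<^sup>2 - q\<close> (Carlitz). The second weight formula also needs that every value of \<open>K\<close> is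
  \<open>-1\<close> modulo \<open>4\<close> and that \<open>\<bar>K\<bar> < 2 \<surd>q\<close>; the bound is proved by Manin's elementary argument on a
  quadratic twist over \<open>\<bbbF>\<^sub>q(t)\<close>.
\<close>

section \<open>Characters and Kloosterman sums\<close>

text \<open>The constants \<open>A\<close> and \<open>B\<close> are fixed by two requirements on the
  list of traces: its length is N = A B, and for nonzero a its character sum is A k(a), where k = K
  for the first double coset and k = K_2 + q^2 = K^2 - q + q^2 for the second. Hence N minus the
  character sum is A (B - k(a)). The Pless identity evaluates the sum over a of its h-th power, and
  solving the binomial expansion for the top power gives the recursions; the shifts B - q^2 and B -
  q^2 + q record the two ways of writing k. The same data, inverted by Fourier transform, give the
  fibre sizes in the weight formulas: the transform of K at b is \<lambda>(1/b) and that of K_2 is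
  K(1/b), up to a factor q and a constant. For the bound on K, let R be the point with x-coordinate
  t^q. The degrees of the x-coordinates of R + n P form the quadratic n^2 - K n + q. Its
  nonnegativity at the integers n alone falls just short of K^2 < 4 q; the residue of K modulo 4
  closes the gap.\<close>

lemma even_card_fixpoint_free_involution:
  assumes "finite S" "\<And>x. x \<in> S \<Longrightarrow> f x \<in> S" "\<And>x. x \<in> S \<Longrightarrow> f (f x) = x"
    "\<And>x. x \<in> S \<Longrightarrow> f x \<noteq> x"
  shows "even (card S)"
  using assms
proof (induction "card S" arbitrary: S rule: less_induct)
  case less
  show ?case
  proof (cases "S = {}")
    case False
    then obtain x where x: "x \<in> S" by blast
    let ?T = "S - {x, f x}"
    have sub: "{x, f x} \<subseteq> S" "card {x, f x} = 2"
      using x less.prems(2)[OF x] less.prems(4)[OF x] by auto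
    have card: "card ?T = card S - 2" "card S \<ge> 2"
      using sub less.prems(1) by (metis card_Diff_subset finite_subset, metis card_mono)
    have "even (card ?T)"
    proof (rule less.hyps)
      show "card ?T < card S" using card by linarith
      show "finite ?T" using less.prems(1) by simp
      show "f y \<in> ?T" if "y \<in> ?T" for y
        using that x less.prems(2,3) by (metis DiffD1 DiffD2 DiffI insertE insertI1 insertI2 singletonD)
    qed (use less.prems in auto)
    with card show ?thesis by simp
  qed simp
qed

text \<open>Multiplication by a nonzero \<open>x\<close> permutes the nonzero elements, so their
  product absorbs the power of \<open>x\<close> with exponent \<open>CARD('a) - 1\<close>.\<close>

lemma field_power_card: "(x::'a::{field,finite}) ^ CARD('a) = x"
proof (cases "x = 0")
  case False
  let ?U = "UNIV - {0::'a}"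
  have "(\<Prod>y\<in>?U. x * y) = (\<Prod>y\<in>?U. y)"
    by (rule prod.reindex_bij_witness[where i = "\<lambda>y. y / x" and j = "\<lambda>y. x * y"]) (use False in auto)
  then have "x ^ card ?U * (\<Prod>y\<in>?U. y) = (\<Prod>y\<in>?U. y)"
    by (simp only: prod.distrib prod_constant)
  moreover have "(\<Prod>y\<in>?U. y) \<noteq> 0"
    by (subst prod_zero_iff) auto
  ultimately have "x ^ card ?U = 1"
    by (metis mult_cancel_right1 mult.commute)
  moreover have "CARD('a) = Suc (card ?U)"
    by (rule card_Suc_Diff1[symmetric]) simp_all
  ultimately show ?thesis by (simp only: power_Suc mult_1_right)
qed (simp add: finite_UNIV_card_ge_0)

locale char2_field =
  fixes r :: nat and ty :: "'a::{field,finite} itself"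
  assumes r_pos: "r \<ge> 1" and card_field: "CARD('a) = 2 ^ r"
begin

abbreviation Q :: int where "Q \<equiv> 2 ^ r"

text \<open>Translation by 1 permutes the field and so preserves the sum of all elements; hence
  \<open>CARD('a)\<close>, a power of 2, is 0 in the field.\<close>

lemma two_eq_0: "(2::'a) = 0"
proof -
  have "(\<Sum>x\<in>(UNIV::'a set). x + 1) = (\<Sum>x\<in>UNIV. x)"
    by (rule sum.reindex_bij_witness[where i = "\<lambda>y. y - 1" and j = "\<lambda>y. y + 1"]) auto
  then have "of_nat (CARD('a)) = (0::'a)" by (simp add: sum.distrib)
  then have "(2::'a) ^ r = 0" by (simp add: card_field)
  then show ?thesis by simp
qed

lemma add_self [simp]: "(x::'a) + x = 0"
  using two_eq_0 by (metis mult_2 mult_zero_left)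

lemma add_self_left [simp]: "(x::'a) + (x + y) = y"
  by (simp add: add.assoc[symmetric])

lemma uminus_eq [simp]: "- (x::'a) = x"
  by (metis add_self minus_unique)

text \<open>As a simp rule this turns every difference into a sum, so that cancellation is left to
  \<open>add_self\<close> and \<open>add_eq_0\<close>.\<close>

lemma diff_eq [simp]: "(x::'a) - y = x + y"
  by (metis uminus_eq diff_conv_add_uminus)

lemma add_eq_0 [simp]: "(x::'a) + y = 0 \<longleftrightarrow> x = y"
  by (metis diff_eq right_minus_eq)

lemma square_add: "((x::'a) + y)\<^sup>2 = x\<^sup>2 + y\<^sup>2"
  by (simp add: power2_sum two_eq_0)

lemma frobenius_add: "((x::'a) + y) ^ 2 ^ i = x ^ 2 ^ i + y ^ 2 ^ i"
proof (induction i)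
  case (Suc i)
  have "(x + y) ^ 2 ^ Suc i = ((x + y) ^ 2 ^ i)\<^sup>2"
    by (simp add: power_mult [symmetric] mult.commute)
  then show ?case
    by (simp add: Suc square_add power_mult [symmetric] mult.commute)
qed simp

lemma frobenius_sum: "(\<Sum>x\<in>S. f x :: 'a) ^ 2 ^ i = (\<Sum>x\<in>S. f x ^ 2 ^ i)"
  by (induction S rule: infinite_finite_induct) (simp_all add: frobenius_add power_0_left)

lemma square_inj: "(x::'a)\<^sup>2 = y\<^sup>2 \<longleftrightarrow> x = y"
proof
  assume "x\<^sup>2 = y\<^sup>2"
  then have "(x + y)\<^sup>2 = 0" by (simp add: square_add)
  then show "x = y" by simp
qed simp

lemma square_image: "power2 ` (UNIV - {0::'a}) = UNIV - {0}"
  by (rule endo_inj_surj) (auto simp: inj_on_def square_inj)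

lemma power_card: "(x::'a) ^ 2 ^ r = x"
  using field_power_card[of x] by (simp add: card_field)

lemma abs_tr_0 [simp]: "abs_tr r (0::'a) = 0"
  by (simp add: abs_tr_def power_0_left)

lemma abs_tr_add: "abs_tr r ((x::'a) + y) = abs_tr r x + abs_tr r y"
  by (simp add: abs_tr_def frobenius_add sum.distrib)

text \<open>Squaring shifts the summands cyclically, because x^(2^r) = x.\<close>

lemma abs_tr_square: "abs_tr r ((x::'a)\<^sup>2) = abs_tr r x"
proof -
  have "abs_tr r (x\<^sup>2) = (\<Sum>i<r. x ^ 2 ^ Suc i)"
    by (simp add: abs_tr_def power_mult[symmetric])
  also have "\<dots> = (\<Sum>i<Suc r. x ^ 2 ^ i) + x"
    by (subst sum.lessThan_Suc_shift) (simp add: add.commute)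
  also have "\<dots> = abs_tr r x"
    by (simp add: abs_tr_def power_card add.assoc)
  finally show ?thesis .
qed

text \<open>The trace is fixed by squaring, and only 0 and 1 are.\<close>

lemma abs_tr_cases: "abs_tr r (x::'a) = 0 \<or> abs_tr r x = 1"
proof -
  have "(abs_tr r x)\<^sup>2 = abs_tr r (x\<^sup>2)"
    using frobenius_sum[of _ "{..<r}" 1]
    by (simp add: abs_tr_def power_mult[symmetric] mult.commute)
  then have "abs_tr r x * (abs_tr r x + 1) = 0"
    by (simp add: abs_tr_square distrib_left power2_eq_square[symmetric])
  then show ?thesis by auto
qed

text \<open>Otherwise the trace polynomial, which is nonzero of degree at most 2^(r - 1), would have
  2^r roots.\<close>

lemma abs_tr_surj: "\<exists>x::'a. abs_tr r x = 1"
proof (rule ccontr)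
  assume "\<not> ?thesis"
  then have tr0: "abs_tr r (x::'a) = 0" for x using abs_tr_cases by blast
  define p where "p = (\<Sum>i<r. monom (1::'a) (2 ^ i))"
  have "poly p x = 0" for x
    using tr0[of x] by (simp add: p_def poly_sum poly_monom abs_tr_def)
  moreover have "coeff p 1 = 1"
  proof -
    have "coeff p 1 = (\<Sum>i<r. if i = 0 then 1 else 0)"
      unfolding p_def coeff_sum by (intro sum.cong) (auto simp: coeff_monom)
    then show ?thesis using r_pos by simp
  qed
  then have "p \<noteq> 0" by auto
  moreover have "degree p \<le> 2 ^ (r - 1)"
    unfolding p_def by (rule degree_sum_le) (auto intro!: order.trans[OF degree_monom_le])
  ultimately have "CARD('a) \<le> 2 ^ (r - 1)"
    using card_poly_roots_bound[of p] by simp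
  then show False using r_pos by (simp add: card_field)
qed

lemma lam_0 [simp]: "lam r (0::'a) = 1"
  by (simp add: lam_def)

lemma lam_add: "lam r ((x::'a) + y) = lam r x * lam r y"
  using abs_tr_cases[of x] abs_tr_cases[of y] by (auto simp: lam_def abs_tr_add)

lemma lam_square: "lam r ((x::'a)\<^sup>2) = lam r x"
  by (simp add: lam_def abs_tr_square)

lemma lam_cases: "lam r (x::'a) = 1 \<or> lam r x = -1"
  by (simp add: lam_def)

lemma lam_sum: "lam r (\<Sum>x\<in>S. f x :: 'a) = (\<Prod>x\<in>S. lam r (f x))"
  by (induction S rule: infinite_finite_induct) (simp_all add: lam_add)

lemma sum_lam: "(\<Sum>x\<in>UNIV. lam r ((a::'a) * x)) = (if a = 0 then Q else 0)"
proof (cases "a = 0")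
  case False
  obtain z :: 'a where z: "abs_tr r z = 1" using abs_tr_surj by blast
  \<comment> \<open>The shift by \<open>z / a\<close> multiplies every term by \<lambda>(z) = -1, so
    the sum equals its own negative.\<close>
  have "(\<Sum>x\<in>UNIV. lam r (a * x)) = (\<Sum>x\<in>UNIV. lam r (a * (x + z / a)))"
    by (rule sum.reindex_bij_witness[where i = "\<lambda>x. x + z / a" and j = "\<lambda>x. x + z / a"])
      (auto simp: add.assoc)
  also have "\<dots> = - (\<Sum>x\<in>UNIV. lam r (a * x))"
    using False z by (simp add: distrib_left lam_add sum_negf[symmetric] lam_def[of r z])
  finally show ?thesis using False by simp
qed (simp add: card_field)

lemma sum_nonzero: "(\<Sum>x\<in>UNIV - {0::'a}. f x) = (\<Sum>x\<in>UNIV. f x) - (f 0 :: int)"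
  by (simp add: sum_diff1)

lemma sum_lam_nonzero: "(\<Sum>x\<in>UNIV - {0}. lam r ((a::'a) * x)) = (if a = 0 then Q else 0) - 1"
  by (simp add: sum_nonzero sum_lam)

lemma sum_lam_nonzero': "(\<Sum>x\<in>UNIV - {0::'a}. lam r x) = - 1"
  using sum_lam_nonzero[of 1] by simp

section \<open>Identities for Kloosterman sums\<close>

lemma sum_square_nonzero: "(\<Sum>x\<in>UNIV - {0::'a}. f (x\<^sup>2)) = (\<Sum>x\<in>UNIV - {0}. f x)"
  by (subst (2) square_image[symmetric], subst sum.reindex) (auto simp: inj_on_def square_inj)

lemma sum_scale_nonzero:
  assumes "(c::'a) \<noteq> 0"
  shows "(\<Sum>x\<in>UNIV - {0}. f (c * x)) = (\<Sum>x\<in>UNIV - {0}. f x)"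
  by (rule sum.reindex_bij_witness[where i = "\<lambda>x. x / c" and j = "\<lambda>x. c * x"])
    (use assms in auto)

text \<open>Squaring permutes the nonzero elements and preserves \<lambda>. The sums over GL(1) and
  GL(2) produce the argument a^2, and this brings it back to a.\<close>

lemma Kl_square: "Kl r ((a::'a)\<^sup>2) = Kl r a"
proof -
  have "x\<^sup>2 + a\<^sup>2 * inverse (x\<^sup>2) = (x + a * inverse x)\<^sup>2" for x
    by (simp add: square_add power_mult_distrib power_inverse)
  then have "lam r (x\<^sup>2 + a\<^sup>2 * inverse (x\<^sup>2)) = lam r (x + a * inverse x)" for x
    by (simp only: lam_square)
  then show ?thesis
    unfolding Kl_def by (subst sum_square_nonzero[symmetric]) simp
qed

lemma Kl2_square: "Kl2 r ((a::'a)\<^sup>2) = Kl2 r a"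
proof -
  have "x\<^sup>2 + y\<^sup>2 + a\<^sup>2 * inverse (x\<^sup>2) * inverse (y\<^sup>2) = (x + y + a * inverse x * inverse y)\<^sup>2" for x y
    by (simp add: square_add power_mult_distrib power_inverse)
  then have eq: "lam r (x\<^sup>2 + y\<^sup>2 + a\<^sup>2 * inverse (x\<^sup>2) * inverse (y\<^sup>2)) = lam r (x + y + a * inverse x * inverse y)" for x y
    by (simp only: lam_square)
  have "Kl2 r (a\<^sup>2) = (\<Sum>x\<in>UNIV - {0}. \<Sum>y\<in>UNIV - {0}.
      lam r (x\<^sup>2 + y\<^sup>2 + a\<^sup>2 * inverse (x\<^sup>2) * inverse (y\<^sup>2)))"
  proof -
    have "Kl2 r (a\<^sup>2) = (\<Sum>x\<in>UNIV - {0}. \<Sum>y\<in>UNIV - {0}.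
        lam r (x\<^sup>2 + y + a\<^sup>2 * inverse (x\<^sup>2) * inverse y))"
      unfolding Kl2_def by (rule sum_square_nonzero[symmetric])
    also have "\<dots> = (\<Sum>x\<in>UNIV - {0}. \<Sum>y\<in>UNIV - {0}.
        lam r (x\<^sup>2 + y\<^sup>2 + a\<^sup>2 * inverse (x\<^sup>2) * inverse (y\<^sup>2)))"
      by (rule sum.cong[OF refl], rule sum_square_nonzero[symmetric])
    finally show ?thesis .
  qed
  then show ?thesis by (simp only: eq Kl2_def)
qed

lemma Kl_eq_sum_scaled:
  assumes "(b::'a) \<noteq> 0"
  shows "Kl r (a * b) = (\<Sum>x\<in>UNIV - {0}. lam r (b * x + a * inverse x))"
proof -
  have "a * b * inverse (b * x) = a * inverse x" for x
    using assms by (cases "x = 0") (simp_all add: field_simps)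
  then show ?thesis
    using sum_scale_nonzero[OF assms, of "\<lambda>x. lam r (x + a * b * inverse x)"]
    by (simp only: Kl_def)
qed

text \<open>Carlitz. The square is summed over \<open>x\<close> and the ratio \<open>u\<close> of the two variables.\<close>

lemma Kl2_eq:
  assumes a: "(a::'a) \<noteq> 0"
  shows "Kl2 r a = (Kl r a)\<^sup>2 - Q"
proof -
  let ?U = "UNIV - {0::'a}"
  \<comment> \<open>For u different from 1 both sides are K(a (u + 1/u)). For u = 1 the left side is
    q - 1 while the sum on the right is -1; this defect is the source of \<open>- Q\<close> in the
    identity.\<close>
  have inner: "(\<Sum>x\<in>?U. lam r (x + a * inverse x) * lam r (u * x + a * inverse (u * x))) =
      (\<Sum>x\<in>?U. lam r (x + a * inverse x * (u + inverse u))) + (if u = 1 then Q else 0)"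
    if u: "u \<in> ?U" for u
  proof (cases "u = 1")
    case True
    have "lam r z * lam r z = 1" for z :: 'a using lam_cases[of z] by auto
    then have "(\<Sum>x\<in>?U. lam r (x + a * inverse x) * lam r (u * x + a * inverse (u * x))) = Q - 1"
      using True by (simp add: card_Diff_subset card_field of_nat_diff)
    then show ?thesis using True by (simp add: sum_lam_nonzero')
  next
    case False
    then have nz: "1 + u \<noteq> 0" by simp
    have "(1 + u) * x + (a * (1 + inverse u)) * inverse x = x + a * inverse x + (u * x + a * inverse (u * x))"
      for x by (simp add: ring_distribs ac_simps)
    then have "(\<Sum>x\<in>?U. lam r (x + a * inverse x) * lam r (u * x + a * inverse (u * x))) =
      (\<Sum>x\<in>?U. lam r ((1 + u) * x + (a * (1 + inverse u)) * inverse x))"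
      by (simp only: lam_add[symmetric])
    also have "\<dots> = Kl r ((a * (1 + inverse u)) * (1 + u))"
      by (rule Kl_eq_sum_scaled[OF nz, symmetric])
    also have "(a * (1 + inverse u)) * (1 + u) = a * (u + inverse u)"
    proof -
      have "(1 + inverse u) * (1 + u) = u + inverse u"
        using u by (simp add: ring_distribs ac_simps)
      then show ?thesis by (simp add: mult.assoc)
    qed
    finally show ?thesis using False by (simp add: Kl_def mult.assoc mult.commute[of "u + inverse u"])
  qed
  \<comment> \<open>The substitution v = (a / x) u, together with \<lambda>(x) = \<lambda>(x^2),
    makes the sum a function of x^2; summing over x then gives \<open>Kl2\<close> at a^2.\<close>
  have subst_v: "(\<Sum>u\<in>?U. lam r (x + a * inverse x * (u + inverse u))) =
      (\<Sum>v\<in>?U. lam r (x\<^sup>2 + v + a\<^sup>2 * inverse (x\<^sup>2) * inverse v))" if x: "x \<in> ?U" for x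
  proof -
    have "lam r (x + a * inverse x * (u + inverse u)) =
        lam r (x\<^sup>2 + (a * inverse x) * u + a\<^sup>2 * inverse (x\<^sup>2) * inverse ((a * inverse x) * u))" for u
    proof -
      have "a\<^sup>2 * inverse (x\<^sup>2) * inverse ((a * inverse x) * u) = a * inverse x * inverse u"
        using x a by (cases "u = 0") (simp_all add: field_simps power2_eq_square)
      then show ?thesis by (simp only: lam_add lam_square distrib_left mult.assoc)
    qed
    moreover have "a * inverse x \<noteq> 0" using x a by simp
    ultimately show ?thesis
      using sum_scale_nonzero[of "a * inverse x" "\<lambda>v. lam r (x\<^sup>2 + v + a\<^sup>2 * inverse (x\<^sup>2) * inverse v)"]
      by (simp only: not_False_eq_True simp_thms)
  qed
  have "(Kl r a)\<^sup>2 = (\<Sum>x\<in>?U. \<Sum>y\<in>?U. lam r (x + a * inverse x) * lam r (y + a * inverse y))"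
    by (simp add: Kl_def power2_eq_square sum_product)
  also have "\<dots> = (\<Sum>x\<in>?U. \<Sum>u\<in>?U. lam r (x + a * inverse x) * lam r (u * x + a * inverse (u * x)))"
  proof (rule sum.cong[OF refl])
    fix x assume "x \<in> ?U"
    then show "(\<Sum>y\<in>?U. lam r (x + a * inverse x) * lam r (y + a * inverse y)) =
        (\<Sum>u\<in>?U. lam r (x + a * inverse x) * lam r (u * x + a * inverse (u * x)))"
      using sum_scale_nonzero[of x "\<lambda>y. lam r (x + a * inverse x) * lam r (y + a * inverse y)"]
      by (simp add: mult.commute)
  qed
  also have "\<dots> = (\<Sum>u\<in>?U. \<Sum>x\<in>?U. lam r (x + a * inverse x) * lam r (u * x + a * inverse (u * x)))"
    by (rule sum.swap)
  also have "\<dots> = (\<Sum>u\<in>?U. (\<Sum>x\<in>?U. lam r (x + a * inverse x * (u + inverse u))) + (if u = 1 then Q else 0))"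
    by (rule sum.cong[OF refl], rule inner)
  also have "\<dots> = (\<Sum>x\<in>?U. \<Sum>u\<in>?U. lam r (x + a * inverse x * (u + inverse u))) + Q"
    unfolding sum.distrib by (subst sum.swap) simp
  also have "(\<Sum>x\<in>?U. \<Sum>u\<in>?U. lam r (x + a * inverse x * (u + inverse u))) =
      (\<Sum>x\<in>?U. \<Sum>v\<in>?U. lam r (x\<^sup>2 + v + a\<^sup>2 * inverse (x\<^sup>2) * inverse v))"
    by (rule sum.cong[OF refl], rule subst_v)
  also have "\<dots> = Kl2 r (a\<^sup>2)"
    unfolding Kl2_def by (rule sum_square_nonzero)
  finally show ?thesis by (simp add: Kl2_square)
qed

text \<open>The Fourier transform of K: with the sum over a taken first, orthogonality leaves only x
  = 1/b. It determines how often a trace takes a given value.\<close>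

lemma sum_lam_Kl:
  "(\<Sum>a\<in>UNIV - {0}. lam r (a * (b::'a)) * Kl r a) = (if b = 0 then 0 else Q * lam r (inverse b)) + 1"
proof -
  let ?U = "UNIV - {0::'a}"
  have "(\<Sum>a\<in>?U. lam r (a * b) * Kl r a) =
      (\<Sum>a\<in>?U. \<Sum>x\<in>?U. lam r x * lam r ((b + inverse x) * a))"
    unfolding Kl_def sum_distrib_left
  proof (rule sum.cong[OF refl], rule sum.cong[OF refl])
    fix a x
    have "a * b + (x + a * inverse x) = x + (b + inverse x) * a" by (simp add: algebra_simps)
    then show "lam r (a * b) * lam r (x + a * inverse x) = lam r x * lam r ((b + inverse x) * a)"
      by (simp only: lam_add[symmetric])
  qed
  also have "\<dots> = (\<Sum>x\<in>?U. lam r x * (\<Sum>a\<in>?U. lam r ((b + inverse x) * a)))"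
    unfolding sum_distrib_left by (rule sum.swap)
  \<comment> \<open>Since \<open>inverse 0 = 0\<close> lies outside the range of x, the delta term
    never fires for b = 0, and one formula serves both cases.\<close>
  also have "\<dots> = (\<Sum>x\<in>?U. (if x = inverse b then Q * lam r x else 0) - lam r x)"
  proof (rule sum.cong[OF refl])
    fix x assume "x \<in> ?U"
    have "b + inverse x = 0 \<longleftrightarrow> x = inverse b"
      unfolding add_eq_0 by (metis inverse_inverse_eq)
    then show "lam r x * (\<Sum>a\<in>?U. lam r ((b + inverse x) * a)) =
        (if x = inverse b then Q * lam r x else 0) - lam r x"
      unfolding sum_lam_nonzero by (cases "x = inverse b") (simp_all add: right_diff_distrib)
  qed
  also have "\<dots> = (if b = 0 then 0 else Q * lam r (inverse b)) + 1"
    by (simp add: sum_subtractf sum_lam_nonzero')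
  finally show ?thesis .
qed

text \<open>The Fourier transform of K_2: orthogonality in a forces y = 1/(b x), which leaves a
  one-dimensional Kloosterman sum.\<close>

lemma sum_lam_Kl2:
  "(\<Sum>a\<in>UNIV - {0}. lam r (a * (b::'a)) * Kl2 r a) = (if b = 0 then 0 else Q * Kl r (inverse b)) - 1"
proof -
  let ?U = "UNIV - {0::'a}"
  have "(\<Sum>a\<in>?U. lam r (a * b) * Kl2 r a) =
      (\<Sum>a\<in>?U. \<Sum>x\<in>?U. \<Sum>y\<in>?U. lam r (x + y) * lam r ((b + inverse x * inverse y) * a))"
    unfolding Kl2_def sum_distrib_left
  proof (rule sum.cong[OF refl], rule sum.cong[OF refl], rule sum.cong[OF refl])
    fix a x y
    have "a * b + (x + y + a * inverse x * inverse y) = x + y + (b + inverse x * inverse y) * a"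
      by (simp add: algebra_simps)
    then show "lam r (a * b) * lam r (x + y + a * inverse x * inverse y) =
        lam r (x + y) * lam r ((b + inverse x * inverse y) * a)"
      by (simp only: lam_add[symmetric])
  qed
  also have "\<dots> = (\<Sum>x\<in>?U. \<Sum>a\<in>?U. \<Sum>y\<in>?U. lam r (x + y) * lam r ((b + inverse x * inverse y) * a))"
    by (rule sum.swap)
  also have "\<dots> = (\<Sum>x\<in>?U. \<Sum>y\<in>?U. lam r (x + y) * (\<Sum>a\<in>?U. lam r ((b + inverse x * inverse y) * a)))"
    unfolding sum_distrib_left by (rule sum.cong[OF refl], rule sum.swap)
  also have "\<dots> = (\<Sum>x\<in>?U. \<Sum>y\<in>?U. (if y = inverse b * inverse x then Q * lam r (x + y) else 0) - lam r x * lam r y)"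
  proof (rule sum.cong[OF refl], rule sum.cong[OF refl])
    fix x y assume "x \<in> ?U" "y \<in> ?U"
    then have xy: "x \<noteq> 0" "y \<noteq> 0" by simp_all
    have "b = inverse x * inverse y \<longleftrightarrow> y = inverse b * inverse x"
    proof
      assume "b = inverse x * inverse y"
      then have "inverse b = x * y" by simp
      then show "y = inverse b * inverse x" using xy by simp
    next
      assume "y = inverse b * inverse x"
      then have "inverse y = b * x" by simp
      then show "b = inverse x * inverse y" using xy by simp
    qed
    then have "b + inverse x * inverse y = 0 \<longleftrightarrow> y = inverse b * inverse x"
      by (simp only: add_eq_0)
    then show "lam r (x + y) * (\<Sum>a\<in>?U. lam r ((b + inverse x * inverse y) * a)) =
        (if y = inverse b * inverse x then Q * lam r (x + y) else 0) - lam r x * lam r y"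
      unfolding sum_lam_nonzero lam_add
      by (cases "y = inverse b * inverse x") (simp_all add: right_diff_distrib)
  qed
  also have "\<dots> = (\<Sum>x\<in>?U. (if b = 0 then 0 else Q * lam r (x + inverse b * inverse x)) + lam r x)"
  proof (rule sum.cong[OF refl])
    fix x assume x: "x \<in> ?U"
    have "(\<Sum>y\<in>?U. if y = inverse b * inverse x then Q * lam r (x + y) else 0) =
        (if b = 0 then 0 else Q * lam r (x + inverse b * inverse x))"
      using x by (subst sum.delta) auto
    moreover have "(\<Sum>y\<in>?U. lam r x * lam r y) = - lam r x"
      unfolding sum_distrib_left[symmetric] sum_lam_nonzero' by simp
    ultimately show "(\<Sum>y\<in>?U. (if y = inverse b * inverse x then Q * lam r (x + y) else 0) - lam r x * lam r y) =
        (if b = 0 then 0 else Q * lam r (x + inverse b * inverse x)) + lam r x"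
      unfolding sum_subtractf by simp
  qed
  also have "\<dots> = (if b = 0 then 0 else Q * Kl r (inverse b)) - 1"
    unfolding sum.distrib sum_lam_nonzero' by (simp add: Kl_def sum_distrib_left)
  finally show ?thesis .
qed

section \<open>Kloosterman sums modulo 4\<close>

lemma Kl_eq_card: "Kl r (a::'a) = Q - 1 - 2 * int (card {x. x \<noteq> 0 \<and> lam r (x + a * inverse x) = -1})"
proof -
  let ?U = "UNIV - {0::'a}" and ?P = "\<lambda>x. lam r (x + a * inverse x) = -1"
  have "Kl r a = (\<Sum>x\<in>?U. 1 - 2 * of_bool (?P x))"
    unfolding Kl_def
  proof (rule sum.cong[OF refl])
    fix x
    show "lam r (x + a * inverse x) = 1 - 2 * of_bool (?P x)"
      using lam_cases[of "x + a * inverse x"] by (elim disjE) simp_all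
  qed
  also have "\<dots> = int (card ?U) - 2 * (\<Sum>x\<in>?U. of_bool (?P x))"
    unfolding sum_subtractf sum_distrib_left[symmetric] by simp
  also have "int (card ?U) = Q - 1"
    by (simp add: card_Diff_subset card_field of_nat_diff)
  also have "(\<Sum>x\<in>?U. of_bool (?P x)) = int (card (?U \<inter> Collect ?P))"
    by (subst sum_of_bool_eq) simp_all
  also have "?U \<inter> Collect ?P = {x. x \<noteq> 0 \<and> ?P x}"
    by auto
  finally show ?thesis .
qed

text \<open>The map x -> a / x is an involution on the x with \<lambda>(x + a / x) = -1. A fixed
  point would have x + a / x = 0 and hence \<lambda> = 1, so the number of negative terms is even;
  moreover 4 divides q.\<close>

lemma Kl_cong_4:
  assumes "r \<ge> 2" and a: "(a::'a) \<noteq> 0"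
  shows "[Kl r a = -1] (mod 4)"
proof -
  let ?S = "{x. x \<noteq> 0 \<and> lam r (x + a * inverse x) = -1}"
  have "even (card ?S)"
  proof (rule even_card_fixpoint_free_involution)
    fix x assume "x \<in> ?S"
    then have x: "x \<noteq> 0" "lam r (x + a * inverse x) = -1" by simp_all
    show inv: "a * inverse (a * inverse x) = x"
      using a x(1) by (simp add: field_simps)
    show "a * inverse x \<in> ?S"
      using a x inv by (simp only: mem_Collect_eq add.commute[of "a * inverse x"]) simp
    show "a * inverse x \<noteq> x"
    proof
      assume "a * inverse x = x"
      then show False using x(2) by simp
    qed
  qed simp
  then obtain k where k: "card ?S = 2 * k" by blast
  obtain m where "r = m + 2" using assms(1) le_Suc_ex by (metis add.commute)
  then have "Q = 4 * 2 ^ m" by (simp add: power_add)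
  moreover have "Kl r a = Q - 1 - 2 * int (2 * k)"
    by (simp only: Kl_eq_card k)
  ultimately have "Kl r a - (-1) = 4 * (2 ^ m - int k)" by simp
  then show ?thesis unfolding cong_iff_dvd_diff by (metis dvd_triv_left)
qed

end

section \<open>The Hasse bound\<close>

text \<open>Coprimality is carried by an explicit Bezout identity because such identities can be
  squared term by term in characteristic 2 and multiplied into other equations.\<close>

definition bezout_coprime :: "'a::comm_ring_1 \<Rightarrow> 'a \<Rightarrow> bool" where
  "bezout_coprime x y \<longleftrightarrow> (\<exists>u v. u * x + v * y = 1)"

lemma bezout_coprime_mult_left:
  assumes "bezout_coprime x z" "bezout_coprime y z"
  shows "bezout_coprime (x * y) z"
proof -
  obtain u v u' v' where "u * x + v * z = 1" "u' * y + v' * z = 1"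
    using assms by (auto simp: bezout_coprime_def)
  then have "(u * x + v * z) * (u' * y + v' * z) = 1" by simp
  then have "(u * u') * (x * y) + (u * x * v' + v * u' * y + v * z * v') * z = 1"
    by (simp add: algebra_simps)
  then show ?thesis unfolding bezout_coprime_def by blast
qed

lemma bezout_coprime_commute: "bezout_coprime x y \<longleftrightarrow> bezout_coprime y x"
  unfolding bezout_coprime_def by (metis add.commute)

lemma bezout_coprime_1_left: "bezout_coprime 1 x"
  unfolding bezout_coprime_def by (rule exI[of _ 1], rule exI[of _ 0]) simp

lemma bezout_coprime_prod_left:
  "(\<And>i. i \<in> S \<Longrightarrow> bezout_coprime (f i) z) \<Longrightarrow> bezout_coprime (\<Prod>i\<in>S. f i) z"
  by (induction S rule: infinite_finite_induct)
    (simp_all add: bezout_coprime_1_left bezout_coprime_mult_left)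

lemma bezout_coprime_dvd_mult:
  assumes "bezout_coprime x y" "x dvd y * z"
  shows "x dvd z"
proof -
  obtain u v where uv: "u * x + v * y = 1" using assms(1) by (auto simp: bezout_coprime_def)
  have "z = (u * x + v * y) * z" by (simp add: uv)
  also have "\<dots> = x * (u * z) + v * (y * z)" by (simp add: algebra_simps)
  finally show ?thesis using assms(2) by (metis dvd_add dvd_mult dvd_triv_left)
qed

text \<open>Modulo t - c the polynomial \<open>p\<close> is the nonzero constant
  \<open>poly p c\<close>.\<close>

lemma bezout_coprime_linear:
  fixes p :: "'a::field poly"
  assumes "poly p c \<noteq> 0"
  shows "bezout_coprime [:- c, 1:] p"
proof -
  have "[:- c, 1:] dvd p - [:poly p c:]"
    by (simp add: poly_eq_0_iff_dvd[symmetric])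
  then obtain k where "p - [:poly p c:] = [:- c, 1:] * k" by (rule dvdE)
  then have k: "[:poly p c:] = p - [:- c, 1:] * k" by (simp only: algebra_simps)
  define e where "e = [:inverse (poly p c):]"
  have "(- (e * k)) * [:- c, 1:] + e * p = e * (p - [:- c, 1:] * k)"
    by (simp only: right_diff_distrib mult_minus_left uminus_add_conv_diff mult.assoc mult.commute[of k])
  also have "\<dots> = 1" unfolding k[symmetric] using assms by (simp add: e_def one_pCons)
  finally show ?thesis unfolding bezout_coprime_def by blast
qed

context char2_field
begin

lemma poly_add_self [simp]: "(p::'a poly) + p = 0"
  by (rule poly_eqI) (simp only: coeff_add add_self coeff_0)

lemma poly_add_self_left [simp]: "(p::'a poly) + (p + s) = s"
  by (simp add: add.assoc[symmetric])

lemma poly_square_add: "((p::'a poly) + s)\<^sup>2 = p\<^sup>2 + s\<^sup>2"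
proof -
  have "(p + s)\<^sup>2 = p\<^sup>2 + s\<^sup>2 + (p * s + p * s)"
    by (simp only: power2_eq_square ring_distribs ac_simps)
  then show ?thesis by simp
qed

lemma poly_square_sum: "(\<Sum>i\<in>S. f i :: 'a poly)\<^sup>2 = (\<Sum>i\<in>S. (f i)\<^sup>2)"
  by (induction S rule: infinite_finite_induct) (simp_all add: poly_square_add)

text \<open>Squaring is additive on these polynomials, so the whole Bezout identity may be squared;
  the squares are what meets the squared terms in \<open>adj\<close>.\<close>

lemma bezout_coprime_square:
  assumes "bezout_coprime x (y :: 'a poly)"
  obtains u v where "u\<^sup>2 * x\<^sup>2 + v\<^sup>2 * y\<^sup>2 = 1"
proof -
  obtain u v where "u * x + v * y = 1" using assms by (auto simp: bezout_coprime_def)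
  then have "u\<^sup>2 * x\<^sup>2 + v\<^sup>2 * y\<^sup>2 = 1"
    by (metis poly_square_add power_mult_distrib one_power2)
  then show ?thesis using that by blast
qed

text \<open>
  A pair \<open>X, Z\<close> stands for the \<open>x\<close>-coordinate \<open>X / Z\<close> (in lowest terms) of a point on the curve
  \<open>Y\<^sup>2 + Y = x + a / x + (t + a / t)\<close> over \<open>\<bbbF>\<^sub>q(t)\<close>; the relation below says that the points with
  \<open>x\<close>-coordinates \<open>X / Z\<close> and \<open>U / V\<close> differ by \<open>\<plusminus> P\<close>, where \<open>P = (t, 0)\<close>.
\<close>

abbreviation tt :: "'a poly" where "tt \<equiv> [:0, 1:]"

text \<open>\<open>Z = 0\<close> encodes the point at infinity. Otherwise the degree condition asks
  for a pole of X / Z at t = infinity, which makes the degree of \<open>X\<close> the height of the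
  x-coordinate.\<close>

definition reduced :: "'a poly \<Rightarrow> 'a poly \<Rightarrow> bool" where
  "reduced X Z \<longleftrightarrow> bezout_coprime X Z \<and> X \<noteq> 0 \<and> (Z = 0 \<or> degree Z < degree X)"

text \<open>By the addition law, if R has x-coordinate x = X / Z, then those of R + P and R - P have
  sum t x / (x + t)^2 and product (t x + a)^2 / (x + t)^2. The equation is the quadratic with these
  two roots, cleared of denominators; in this form it is symmetric in the two pairs.\<close>

definition adj :: "'a \<Rightarrow> 'a poly \<Rightarrow> 'a poly \<Rightarrow> 'a poly \<Rightarrow> 'a poly \<Rightarrow> bool" where
  "adj a X Z U V \<longleftrightarrow> reduced X Z \<and> reduced U V \<and>
     (X + tt * Z)\<^sup>2 * U\<^sup>2 + (tt * X * Z) * (U * V) + (tt * X + [:a:] * Z)\<^sup>2 * V\<^sup>2 = 0"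

lemma adj_sym: "adj a X Z U V \<longleftrightarrow> adj a U V X Z"
proof -
  have "(X + tt * Z)\<^sup>2 * U\<^sup>2 + (tt * X * Z) * (U * V) + (tt * X + [:a:] * Z)\<^sup>2 * V\<^sup>2 =
      (U + tt * V)\<^sup>2 * X\<^sup>2 + (tt * U * V) * (X * Z) + (tt * U + [:a:] * V)\<^sup>2 * Z\<^sup>2"
    unfolding poly_square_add power_mult_distrib ring_distribs by (simp only: ac_simps)
  then show ?thesis unfolding adj_def by metis
qed

text \<open>
  The quadratic equation for \<open>U / V\<close> has a second root \<open>U' / V'\<close>. It is found in lowest terms because
  the three coefficients are coprime, and then \<open>U U'\<close> is exactly \<open>(t X + a Z)\<^sup>2\<close>.
\<close>

lemma adj_step:
  assumes a: "a \<noteq> 0" and adj: "adj a X Z U V"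
  obtains U' V' where "adj a X Z U' V'" "degree U + degree U' = 2 * degree X + 2"
proof -
  define \<alpha> where "\<alpha> = (X + tt * Z)\<^sup>2"
  define \<beta> where "\<beta> = tt * X * Z"
  define \<gamma> where "\<gamma> = (tt * X + [:a:] * Z)\<^sup>2"
  have red: "reduced X Z" "reduced U V" and F: "\<alpha> * U\<^sup>2 + \<beta> * (U * V) + \<gamma> * V\<^sup>2 = 0"
    using adj by (simp_all add: adj_def \<alpha>_def \<beta>_def \<gamma>_def)
  obtain u v where uv: "u\<^sup>2 * U\<^sup>2 + v\<^sup>2 * V\<^sup>2 = 1"
    using bezout_coprime_square red(2) unfolding reduced_def by metis
  \<comment> \<open>By Vieta the second root has to satisfy \<alpha> = V V', \<gamma> = U U' and
    \<beta> = U V' + U' V. Multiplying \<gamma> and \<alpha> by the squared Bezout identity and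
    replacing terms through the quadratic equation gives these polynomials without any division, so
    \<open>V = 0\<close> is covered too.\<close>
  define U' where "U' = \<gamma> * u\<^sup>2 * U + v\<^sup>2 * (\<alpha> * U + \<beta> * V)"
  define V' where "V' = u\<^sup>2 * (\<beta> * U + \<gamma> * V) + \<alpha> * v\<^sup>2 * V"
  have F1: "\<alpha> * U\<^sup>2 = (\<beta> * U + \<gamma> * V) * V" and F2: "\<gamma> * V\<^sup>2 = (\<alpha> * U + \<beta> * V) * U"
  proof -
    have *: "x = y" if "x + y = 0" for x y :: "'a poly"
      using that poly_add_self_left[of x y] by simp
    show "\<alpha> * U\<^sup>2 = (\<beta> * U + \<gamma> * V) * V"
      by (rule *, rule trans[OF _ F]) (simp only: power2_eq_square ring_distribs ac_simps)
    show "\<gamma> * V\<^sup>2 = (\<alpha> * U + \<beta> * V) * U"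
      by (rule *, rule trans[OF _ F]) (simp only: power2_eq_square ring_distribs ac_simps)
  qed
  have \<alpha>: "\<alpha> = V * V'"
  proof -
    have "\<alpha> = \<alpha> * (u\<^sup>2 * U\<^sup>2 + v\<^sup>2 * V\<^sup>2)" by (simp add: uv)
    also have "\<dots> = u\<^sup>2 * (\<alpha> * U\<^sup>2) + \<alpha> * v\<^sup>2 * V * V"
      by (simp only: power2_eq_square ring_distribs ac_simps)
    also have "\<dots> = V * V'"
      unfolding F1 V'_def by (simp only: ring_distribs ac_simps)
    finally show ?thesis .
  qed
  have \<gamma>: "\<gamma> = U * U'"
  proof -
    have "\<gamma> = \<gamma> * (u\<^sup>2 * U\<^sup>2 + v\<^sup>2 * V\<^sup>2)" by (simp add: uv)
    also have "\<dots> = \<gamma> * u\<^sup>2 * U * U + v\<^sup>2 * (\<gamma> * V\<^sup>2)"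
      by (simp only: power2_eq_square ring_distribs ac_simps)
    also have "\<dots> = U * U'"
      unfolding F2 U'_def by (simp only: ring_distribs ac_simps)
    finally show ?thesis .
  qed
  have \<beta>: "\<beta> = U * V' + U' * V"
  proof -
    have "U * V' + U' * V = \<beta> * (u\<^sup>2 * U\<^sup>2 + v\<^sup>2 * V\<^sup>2) +
        (u\<^sup>2 * \<gamma> * U * V + u\<^sup>2 * \<gamma> * U * V) + (v\<^sup>2 * \<alpha> * U * V + v\<^sup>2 * \<alpha> * U * V)"
      unfolding U'_def V'_def by (simp only: power2_eq_square ring_distribs ac_simps)
    then show ?thesis by (simp add: uv)
  qed
  \<comment> \<open>A combination of \<alpha>, \<gamma> and \<beta>^2 equals 1: modulo \<beta> = t X
    Z, the products X (X + t Z) and Z (t X + a Z) / a are X^2 and Z^2, to which the Bezout identity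
    of X and Z applies. Squaring turns the linear factors into \<alpha> and \<gamma>.\<close>
  have coprime: "bezout_coprime U' V'"
  proof -
    obtain x z where xz: "x\<^sup>2 * X\<^sup>2 + z\<^sup>2 * Z\<^sup>2 = 1"
      using bezout_coprime_square red(1) unfolding reduced_def by metis
    define b where "b = [:inverse a:]"
    have b: "b * [:a:] = 1" using a by (simp add: b_def one_pCons)
    have "x\<^sup>2 * X * (X + tt * Z) + z\<^sup>2 * b * Z * (tt * X + [:a:] * Z) + (x\<^sup>2 + z\<^sup>2 * b) * \<beta> =
        x\<^sup>2 * X\<^sup>2 + z\<^sup>2 * (b * [:a:]) * Z\<^sup>2 + (x\<^sup>2 * \<beta> + x\<^sup>2 * \<beta>) + (z\<^sup>2 * b * \<beta> + z\<^sup>2 * b * \<beta>)"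
      unfolding \<beta>_def by (simp only: power2_eq_square ring_distribs ac_simps)
    also have "\<dots> = 1" by (simp only: b poly_add_self xz mult_1_right add_0_right)
    finally have "(x\<^sup>2 * X * (X + tt * Z) + z\<^sup>2 * b * Z * (tt * X + [:a:] * Z) + (x\<^sup>2 + z\<^sup>2 * b) * \<beta>)\<^sup>2 = 1"
      by simp
    then have "(x\<^sup>2 * X)\<^sup>2 * \<alpha> + (z\<^sup>2 * b * Z)\<^sup>2 * \<gamma> + (x\<^sup>2 + z\<^sup>2 * b)\<^sup>2 * \<beta> * \<beta> = 1"
      unfolding \<alpha>_def \<gamma>_def
      by (simp only: poly_square_add power_mult_distrib power2_eq_square[of \<beta>] mult.assoc)
    moreover define p s k where "p = (x\<^sup>2 * X)\<^sup>2" and "s = (z\<^sup>2 * b * Z)\<^sup>2"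
      and "k = (x\<^sup>2 + z\<^sup>2 * b)\<^sup>2 * \<beta>"
    ultimately have "p * (V * V') + s * (U * U') + k * (U * V' + U' * V) = 1"
      using \<alpha> \<beta> \<gamma> by (metis mult.assoc)
    then have "(s * U + k * V) * U' + (p * V + k * U) * V' = 1"
      by (simp only: ring_distribs ac_simps)
    then show ?thesis unfolding bezout_coprime_def by blast
  qed
  have X0: "X \<noteq> 0" and XZ: "Z = 0 \<or> degree Z < degree X" and U0: "U \<noteq> 0" and UV: "V = 0 \<or> degree V < degree U"
    using red by (auto simp: reduced_def)
  have "degree (tt * X) = Suc (degree X)" using X0 by (simp add: degree_mult_eq)
  moreover have "degree ([:a:] * Z) < Suc (degree X)"
    using XZ a by (auto simp: less_Suc_eq)
  ultimately have dw: "degree (tt * X + [:a:] * Z) = Suc (degree X)"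
    by (metis degree_add_eq_left)
  have d\<gamma>: "degree \<gamma> = 2 * degree X + 2"
    unfolding \<gamma>_def using dw by (subst degree_power_eq) auto
  have "\<gamma> \<noteq> 0" using d\<gamma> by auto
  then have U'0: "U' \<noteq> 0" using \<gamma> by auto
  have degs: "degree U + degree U' = 2 * degree X + 2"
    using \<gamma> d\<gamma> U0 U'0 by (metis degree_mult_eq)
  \<comment> \<open>If V' had at least the degree of U', then U V' would dominate \<beta> and give
    it degree at least 2 deg X + 2, but t X Z has degree at most 2 deg X.\<close>
  have "V' = 0 \<or> degree V' < degree U'"
  proof (rule ccontr)
    assume "\<not> ?thesis"
    then have V': "V' \<noteq> 0" "degree U' \<le> degree V'" by auto
    have dUV': "degree (U * V') = degree U + degree V'" using U0 V' by (simp add: degree_mult_eq)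
    have "degree \<beta> = degree U + degree V'"
    proof (cases "V = 0")
      case False
      then have "degree (U' * V) < degree (U * V')"
        using U'0 V' UV dUV' by (simp add: degree_mult_eq)
      then show ?thesis unfolding \<beta> using dUV' by (simp add: degree_add_eq_left)
    qed (use \<beta> dUV' in simp)
    then have big: "degree \<beta> \<ge> 2 * degree X + 2" using degs V'(2) by linarith
    then have "Z \<noteq> 0" unfolding \<beta>_def by auto
    then have "degree \<beta> = 1 + degree X + degree Z"
      unfolding \<beta>_def using X0 by (simp add: degree_mult_eq)
    with big XZ \<open>Z \<noteq> 0\<close> show False by auto
  qed
  then have "reduced U' V'" using coprime U'0 by (simp add: reduced_def)
  moreover have "\<alpha> * U'\<^sup>2 + \<beta> * (U' * V') + \<gamma> * V'\<^sup>2 = 0"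
  proof -
    have "\<alpha> * U'\<^sup>2 + \<beta> * (U' * V') + \<gamma> * V'\<^sup>2 =
       (V * V') * U'\<^sup>2 + (U * V' + U' * V) * (U' * V') + (U * U') * V'\<^sup>2"
      by (metis \<alpha> \<beta> \<gamma>)
    also have "\<dots> = (V * V' * U' * U' + V * V' * U' * U') + (U * U' * V' * V' + U * U' * V' * V')"
      by (simp only: power2_eq_square ring_distribs ac_simps)
    finally show ?thesis by simp
  qed
  ultimately have "adj a X Z U' V'"
    using red(1) by (simp add: adj_def \<alpha>_def \<beta>_def \<gamma>_def)
  then show ?thesis using that degs by blast
qed

text \<open>\<open>adj_step\<close> says that the second difference of the degrees along the
  progression is 2, so they form a monic quadratic in \<open>n\<close>, fixed by its first two
  values.\<close>

lemma adj_chain: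
  assumes a: "a \<noteq> 0" and adj: "adj a X Z U V"
  shows "\<exists>X' Z' U' V'. adj a X' Z' U' V' \<and>
    int (degree X') = (int n)\<^sup>2 + (int (degree U) - int (degree X) - 1) * int n + int (degree X) \<and>
    int (degree U') = (int (Suc n))\<^sup>2 + (int (degree U) - int (degree X) - 1) * int (Suc n) + int (degree X)"
proof (induction n)
  case 0
  show ?case using adj by (intro exI[of _ X] exI[of _ Z] exI[of _ U] exI[of _ V]) simp
next
  case (Suc n)
  then obtain X' Z' U' V' where *: "adj a X' Z' U' V'"
    "int (degree X') = (int n)\<^sup>2 + (int (degree U) - int (degree X) - 1) * int n + int (degree X)"
    "int (degree U') = (int (Suc n))\<^sup>2 + (int (degree U) - int (degree X) - 1) * int (Suc n) + int (degree X)"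
    by blast
  obtain X'' Z'' where **: "adj a U' V' X'' Z''" "degree X' + degree X'' = 2 * degree U' + 2"
    using adj_step[OF a] *(1) adj_sym by metis
  have "int (degree X'') = 2 * int (degree U') + 2 - int (degree X')"
    using **(2) by linarith
  also have "\<dots> = (int (Suc (Suc n)))\<^sup>2 + (int (degree U) - int (degree X) - 1) * int (Suc (Suc n)) + int (degree X)"
    unfolding *(2,3) by (simp add: power2_eq_square algebra_simps)
  finally show ?case using **(1) *(3) by blast
qed

text \<open>A degree cannot be negative. Negative \<open>m\<close> are reached by running the chain
  backwards from \<open>U\<close>, which sits at index 1; hence the substitution 1 - m.\<close>

lemma adj_quadratic_nonneg:
  assumes "a \<noteq> 0" "adj a X Z U V"
  shows "m\<^sup>2 + (int (degree U) - int (degree X) - 1) * m + int (degree X) \<ge> 0"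
proof (cases "m \<ge> 0")
  case True
  then obtain n where "m = int n" by (metis nonneg_int_cases)
  then show ?thesis using adj_chain[OF assms, of n] by (metis of_nat_0_le_iff)
next
  case False
  then obtain n where n: "1 - m = int n" by (metis nonneg_int_cases diff_ge_0_iff_ge linear order.trans zero_le_one)
  have "adj a U V X Z" using assms(2) adj_sym by blast
  from adj_chain[OF assms(1) this, of n]
  have "(int n)\<^sup>2 + (int (degree X) - int (degree U) - 1) * int n + int (degree U) \<ge> 0"
    by (metis of_nat_0_le_iff)
  then show ?thesis unfolding n[symmetric] by (simp add: power2_eq_square algebra_simps)
qed


section \<open>The factorization of t^q + t and the start of the progression\<close>

lemma degree_prod_linear: "degree (\<Prod>c\<in>S. [:c::'a, 1:]) = card S"
  by (subst degree_prod_eq_sum_degree) simp_all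

lemma prod_linear_monic: "lead_coeff (\<Prod>c\<in>S. [:c::'a, 1:]) = 1"
  by (simp add: lead_coeff_prod)

lemma degree_tt_power: "degree (tt ^ k) = k"
  by (simp add: degree_power_eq)

lemma coeff_tt_power: "coeff (tt ^ k) n = (if n = k then 1 else 0)"
proof -
  have "tt ^ k = monom 1 k" by (simp add: monom_altdef)
  then show ?thesis by auto
qed

text \<open>Both sides are monic of degree q and vanish at all q elements of the field.\<close>

lemma tt_power_card_eq_prod: "tt ^ 2 ^ r + tt = (\<Prod>c\<in>UNIV. [:c::'a, 1:])"
proof (rule poly_eqI_degree_lead_coeff[where n = "2 ^ r" and A = UNIV])
  have r: "(1::nat) < 2 ^ r" using r_pos by (intro one_less_power) auto
  have "coeff (tt ^ 2 ^ r + tt) (2 ^ r) = 1"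
    using coeff_eq_0[of tt "2 ^ r"] r by (simp only: coeff_add coeff_tt_power) simp
  moreover have "coeff (\<Prod>c\<in>UNIV. [:c::'a, 1:]) (2 ^ r) = 1"
    using prod_linear_monic[of UNIV] by (simp add: degree_prod_linear card_field)
  ultimately show "coeff (tt ^ 2 ^ r + tt) (2 ^ r) = coeff (\<Prod>c\<in>UNIV. [:c::'a, 1:]) (2 ^ r)" by simp
  show "degree (tt ^ 2 ^ r + tt) \<le> 2 ^ r"
    by (rule degree_add_le) (simp_all add: degree_tt_power)
  show "degree (\<Prod>c\<in>UNIV. [:c::'a, 1:]) \<le> 2 ^ r" by (simp add: degree_prod_linear card_field)
  show "poly (tt ^ 2 ^ r + tt) z = poly (\<Prod>c\<in>UNIV. [:c::'a, 1:]) z" for z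
  proof -
    have "(\<Prod>c\<in>UNIV. c + z) = 0" by (subst prod_zero_iff) auto
    then show ?thesis by (simp add: poly_prod power_card)
  qed
qed (simp add: card_field)

text \<open>
  \<open>W / (t\<^sup>q + t)\<^sup>2\<close> is the \<open>x\<close>-coordinate of \<open>(t\<^sup>q, Y) + P\<close>, where
  \<open>Y = \<Sum>i<r. (t + a / t) ^ 2 ^ i\<close> is a solution of \<open>Y\<^sup>2 + Y = (t + a / t)\<^sup>q + (t + a / t)\<close>;
  \<open>T\<close> is \<open>t ^ q * Y\<close> and \<open>W1\<close> is \<open>W / t\<close>. The cancellation in the quotient counts the \<open>c\<close> with
  \<open>lam r (c + a / c) = 1\<close>, which brings in the Kloosterman sum.
\<close>

lemma adj_start:
  assumes a: "(a::'a) \<noteq> 0"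
  obtains U V where "adj a (tt ^ 2 ^ r) 1 U V" "int (degree U) = Q + 1 - Kl r a"
proof -
  define N :: nat where "N = 2 ^ r"
  have N: "N \<ge> 2" "even N" using r_pos unfolding N_def by (simp_all add: self_le_power)
  have iN: "2 * 2 ^ i \<le> N" if "i < r" for i
    unfolding N_def using that power_increasing[of "Suc i" r "2::nat"] by simp
  define T where "T = (\<Sum>i<r. tt ^ (N + 2 ^ i) + [:a ^ 2 ^ i:] * tt ^ (N - 2 ^ i))"
  define W1 where "W1 = (tt ^ (N - 1) + 1) * ([:a:] + tt ^ (N + 1)) + T"
  define W where "W = tt * W1"
  have tN: "tt * tt ^ (N - 1) = tt ^ N" using N by (simp flip: power_Suc)
  have W_eq: "W = (tt ^ N + tt) * ([:a:] + tt ^ (N + 1)) + tt * T"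
  proof -
    have "W = (tt * tt ^ (N - 1) + tt) * ([:a:] + tt ^ (N + 1)) + tt * T"
      unfolding W_def W1_def by (simp only: ring_distribs ac_simps mult_1_right mult_1_left)
    then show ?thesis by (simp only: tN)
  qed
  \<comment> \<open>This is the equation of Y^2 + Y multiplied by t^(2 N + 2). Squaring the sum for
    t T shifts the index of \<open>g\<close> by one, so the two sums telescope to the terms at 0 and
    r.\<close>
  have T_quad: "(tt * T)\<^sup>2 + tt ^ (N + 1) * (tt * T) = tt ^ (N + 1) * ((tt ^ N + tt) * ([:a:] + tt ^ (N + 1)))"
  proof -
    define g where "g i = tt ^ (2 * N + 2 + 2 ^ i) + [:a ^ 2 ^ i:] * tt ^ (2 * N + 2 - 2 ^ i)" for i
    have tT: "tt * T = (\<Sum>i<r. tt ^ (N + 1 + 2 ^ i) + [:a ^ 2 ^ i:] * tt ^ (N + 1 - 2 ^ i))"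
      unfolding T_def sum_distrib_left
    proof (rule sum.cong[OF refl])
      fix i assume "i \<in> {..<r}"
      then have "N + 1 - 2 ^ i = Suc (N - 2 ^ i)" using iN[of i] by simp
      then show "tt * (tt ^ (N + 2 ^ i) + [:a ^ 2 ^ i:] * tt ^ (N - 2 ^ i)) =
          tt ^ (N + 1 + 2 ^ i) + [:a ^ 2 ^ i:] * tt ^ (N + 1 - 2 ^ i)"
        by (simp only: distrib_left power_Suc add_Suc_right Suc_eq_plus1[symmetric] add_Suc plus_1_eq_Suc mult.left_commute)
    qed
    have "(tt * T)\<^sup>2 = (\<Sum>i<r. g (Suc i))"
      unfolding tT poly_square_sum
    proof (rule sum.cong[OF refl])
      fix i assume "i \<in> {..<r}"
      then have *: "(N + 1 - 2 ^ i) * 2 = 2 * N + 2 - 2 ^ Suc i" "(N + 1 + 2 ^ i) * 2 = 2 * N + 2 + 2 ^ Suc i"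
        "2 ^ i * 2 = (2::nat) ^ Suc i"
        by (simp_all add: diff_mult_distrib)
      have "([:a ^ 2 ^ i:])\<^sup>2 = [:a ^ 2 ^ Suc i:]"
        by (simp add: power2_eq_square power_add[symmetric] mult_2)
      then show "(tt ^ (N + 1 + 2 ^ i) + [:a ^ 2 ^ i:] * tt ^ (N + 1 - 2 ^ i))\<^sup>2 = g (Suc i)"
        unfolding g_def poly_square_add power_mult_distrib power_mult[symmetric] * by simp
    qed
    moreover have "tt ^ (N + 1) * (tt * T) = (\<Sum>i<r. g i)"
      unfolding tT sum_distrib_left
    proof (rule sum.cong[OF refl])
      fix i assume "i \<in> {..<r}"
      then have "2 * N + 2 - 2 ^ i = N + 1 + (N + 1 - 2 ^ i)" "2 * N + 2 + 2 ^ i = N + 1 + (N + 1 + 2 ^ i)"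
        using iN[of i] by simp_all
      then show "tt ^ (N + 1) * (tt ^ (N + 1 + 2 ^ i) + [:a ^ 2 ^ i:] * tt ^ (N + 1 - 2 ^ i)) = g i"
        unfolding g_def by (simp only: distrib_left power_add[of _ "N + 1"] mult.left_commute)
    qed
    ultimately have "(tt * T)\<^sup>2 + tt ^ (N + 1) * (tt * T) = (\<Sum>i<r. g (Suc i)) + (\<Sum>i<r. g i)" by simp
    also have "\<dots> = g r + g 0"
    proof -
      have "(\<Sum>i<Suc r. g i) = (\<Sum>i<r. g (Suc i)) + g 0"
        by (simp only: sum.lessThan_Suc_shift add.commute)
      then have "(\<Sum>i<r. g (Suc i)) + g 0 = (\<Sum>i<r. g i) + g r"
        by (simp only: sum.lessThan_Suc)
      moreover have "x + y = w + z" if "x + z = y + w" for x y z w :: "'a poly"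
      proof -
        have "(x + z) + (y + z) = x + y + (z + z)" by (simp only: ac_simps)
        then have "x + y = (y + w) + (y + z)" by (simp add: that)
        also have "\<dots> = w + z + (y + y)" by (simp only: ac_simps)
        also have "\<dots> = w + z" by simp
        finally show ?thesis .
      qed
      ultimately show ?thesis by blast
    qed
    also have "g r = tt ^ (N + 1) * (tt ^ N * tt ^ (N + 1)) + tt ^ (N + 1) * (tt * [:a:])"
    proof -
      have "g r = tt ^ (2 * N + 2 + N) + [:a:] * tt ^ (2 * N + 2 - N)"
        by (simp add: g_def N_def power_card)
      also have "2 * N + 2 + N = N + 1 + (N + (N + 1))" by simp
      also have "2 * N + 2 - N = N + 1 + 1" by simp
      finally show ?thesis by (simp only: power_add power_one_right ac_simps)
    qed
    also have "g 0 = tt ^ (N + 1) * (tt * tt ^ (N + 1)) + tt ^ (N + 1) * (tt ^ N * [:a:])"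
    proof -
      have "g 0 = tt ^ (2 * N + 2 + 1) + [:a:] * tt ^ (2 * N + 2 - 1)"
        by (simp add: g_def)
      also have "2 * N + 2 + 1 = N + 1 + (1 + (N + 1))" by simp
      also have "2 * N + 2 - 1 = N + 1 + N" by simp
      finally show ?thesis by (simp only: power_add power_one_right ac_simps)
    qed
    finally show ?thesis by (simp only: ring_distribs ac_simps)
  qed
  \<comment> \<open>\<open>W + tt ^ (N + 1)\<close> is the numerator of the x-coordinate of (t^q, Y)
    - P, since the two numerators add up to t^(N + 1). The identity is the product formula for the
    two x-coordinates.\<close>
  have W_quad: "W * (W + tt ^ (N + 1)) = (tt ^ (N + 1) + [:a:])\<^sup>2 * (tt ^ N + tt)\<^sup>2"
  proof -
    define M where "M = (tt ^ N + tt) * ([:a:] + tt ^ (N + 1))"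
    have "W * (W + tt ^ (N + 1)) = W\<^sup>2 + tt ^ (N + 1) * W"
      by (simp only: power2_eq_square distrib_left mult.commute)
    also have "\<dots> = M\<^sup>2 + (tt ^ (N + 1) * M + ((tt * T)\<^sup>2 + tt ^ (N + 1) * (tt * T)))"
      unfolding W_eq M_def[symmetric] poly_square_add by (simp only: distrib_left distrib_right ac_simps)
    also have "\<dots> = M\<^sup>2" unfolding T_quad M_def[symmetric] by simp
    finally show ?thesis unfolding M_def by (simp only: power_mult_distrib ac_simps)
  qed
  define S0 where "S0 = {c. c \<noteq> 0 \<and> abs_tr r (c + a * inverse c) = 0}"
  define S1 where "S1 = {c. c \<noteq> 0 \<and> abs_tr r (c + a * inverse c) = 1}"
  define P0 where "P0 = (\<Prod>c\<in>S0. [:c, 1:])"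
  define P1 where "P1 = (\<Prod>c\<in>S1. [:c, 1:])"
  have S: "UNIV = insert 0 (S0 \<union> S1)" "S0 \<inter> S1 = {}" "0 \<notin> S0 \<union> S1" "finite S0" "finite S1"
    using abs_tr_cases by (auto simp: S0_def S1_def)
  have prod_eq: "tt ^ N + tt = tt * (P0 * P1)"
  proof -
    have "tt ^ N + tt = (\<Prod>c\<in>insert 0 (S0 \<union> S1). [:c, 1:])"
      unfolding N_def tt_power_card_eq_prod S(1)[symmetric] ..
    then show ?thesis
      unfolding P0_def P1_def using S(2-5) by (simp add: prod.union_disjoint)
  qed
  have poly_tN: "poly (tt ^ N + tt) c = 0" for c
    by (simp add: N_def power_card)
  \<comment> \<open>At c the factor t^N + t vanishes, so W(c) = c T(c); and T(c) is c^N = c times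
    the absolute trace of c + a / c.\<close>
  have W_eval: "poly W c = c\<^sup>2 * abs_tr r (c + a * inverse c)" if c: "c \<noteq> 0" for c
  proof -
    have cN: "c ^ N = c" by (simp add: N_def power_card)
    have "poly (tt * T) c = (\<Sum>i<r. c * c ^ (N + 2 ^ i) + c * (a ^ 2 ^ i * c ^ (N - 2 ^ i)))"
      by (simp add: T_def poly_sum sum_distrib_left distrib_left)
    also have "\<dots> = (\<Sum>i<r. c\<^sup>2 * (c + a * inverse c) ^ 2 ^ i)"
    proof (rule sum.cong[OF refl])
      fix i assume "i \<in> {..<r}"
      then have "c ^ (N - 2 ^ i) * c ^ 2 ^ i = c ^ N"
        using iN[of i] by (simp add: power_add[symmetric])
      then have "c ^ (N - 2 ^ i) = c * inverse c ^ 2 ^ i"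
        using c cN by (simp add: power_inverse field_simps)
      then show "c * c ^ (N + 2 ^ i) + c * (a ^ 2 ^ i * c ^ (N - 2 ^ i)) = c\<^sup>2 * (c + a * inverse c) ^ 2 ^ i"
        unfolding frobenius_add power_mult_distrib power_add cN
        by (simp only: power2_eq_square distrib_left ac_simps)
    qed
    also have "\<dots> = c\<^sup>2 * abs_tr r (c + a * inverse c)"
      by (simp add: abs_tr_def sum_distrib_left)
    finally show ?thesis using poly_tN[of c] unfolding W_eq poly_add poly_mult by simp
  qed
  have cop_P0: "bezout_coprime (P0\<^sup>2) p" if "\<And>c. c \<in> S0 \<Longrightarrow> poly p c \<noteq> 0" for p
  proof -
    have "bezout_coprime P0 p"
      unfolding P0_def
    proof (rule bezout_coprime_prod_left)
      fix c assume "c \<in> S0"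
      then show "bezout_coprime [:c, 1:] p" using bezout_coprime_linear[of p c] that by simp
    qed
    then show ?thesis unfolding power2_eq_square by (intro bezout_coprime_mult_left)
  qed
  \<comment> \<open>On \<open>S0\<close> the polynomial W vanishes but its companion W + t^(N + 1)
    does not, so the square of P0, which divides their product, divides W.\<close>
  have "P0\<^sup>2 dvd (W + tt ^ (N + 1)) * W"
  proof -
    have "(W + tt ^ (N + 1)) * W = P0\<^sup>2 * ((tt ^ (N + 1) + [:a:])\<^sup>2 * (tt * P1)\<^sup>2)"
      using W_quad unfolding prod_eq by (simp only: power_mult_distrib ac_simps)
    then show ?thesis by (rule dvdI)
  qed
  moreover have "bezout_coprime (P0\<^sup>2) (W + tt ^ (N + 1))"
  proof (rule cop_P0)
    fix c assume "c \<in> S0"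
    then have "c \<noteq> 0" "abs_tr r (c + a * inverse c) = 0" by (auto simp: S0_def)
    then show "poly (W + tt ^ (N + 1)) c \<noteq> 0" using W_eval by simp
  qed
  ultimately have "P0\<^sup>2 dvd tt * W1" unfolding W_def[symmetric] by (metis bezout_coprime_dvd_mult)
  moreover have "bezout_coprime (P0\<^sup>2) tt"
    by (rule cop_P0) (auto simp: S0_def)
  ultimately have "P0\<^sup>2 dvd W1" by (metis bezout_coprime_dvd_mult)
  then obtain U where U: "W1 = P0\<^sup>2 * U" by (rule dvdE)
  \<comment> \<open>\<open>G\<close> is the whole common factor of W and (t^N + t)^2. It contains t
    only once, because \<open>W1\<close> has the nonzero constant term a.\<close>
  define V where "V = tt * P1\<^sup>2"
  define G where "G = tt * P0\<^sup>2"
  have WGU: "W = G * U" unfolding W_def U G_def by (simp only: ac_simps)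
  have GV: "(tt ^ N + tt)\<^sup>2 = G * V"
    unfolding prod_eq G_def V_def by (simp only: power2_eq_square ac_simps)
  have P0_0: "P0 \<noteq> 0" and P1_0: "P1 \<noteq> 0" using S(4,5) by (simp_all add: P0_def P1_def)
  have G0: "G \<noteq> 0" using P0_0 by (simp add: G_def)
  have degW1: "degree W1 = 2 * N"
  proof -
    have "degree (tt ^ (N - 1) + 1) = N - 1"
      using N by (subst degree_add_eq_left) (simp_all add: degree_tt_power)
    moreover have "degree ([:a:] + tt ^ (N + 1)) = N + 1"
      by (subst degree_add_eq_right) (simp_all add: degree_tt_power del: power_Suc)
    ultimately have d: "degree ((tt ^ (N - 1) + 1) * ([:a:] + tt ^ (N + 1))) = 2 * N"
      using N by (subst degree_mult_eq) auto
    have "degree T \<le> N + N div 2"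
      unfolding T_def
    proof (rule degree_sum_le)
      fix i assume "i \<in> {..<r}"
      then have i: "2 * 2 ^ i \<le> N" using iN by simp
      show "degree (tt ^ (N + 2 ^ i) + [:a ^ 2 ^ i:] * tt ^ (N - 2 ^ i)) \<le> N + N div 2"
      proof (rule degree_add_le)
        show "degree (tt ^ (N + 2 ^ i)) \<le> N + N div 2" using i by (simp add: degree_tt_power)
        show "degree ([:a ^ 2 ^ i:] * tt ^ (N - 2 ^ i)) \<le> N + N div 2"
          by (rule order.trans[OF degree_mult_le]) (simp add: degree_tt_power)
      qed
    qed simp
    also have "\<dots> < 2 * N" using N by linarith
    finally show ?thesis unfolding W1_def using d by (simp add: degree_add_eq_left)
  qed
  have U0: "U \<noteq> 0" using degW1 N U by auto
  have "CARD('a) = card (insert 0 (S0 \<union> S1))" unfolding S(1)[symmetric] ..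
  also have "\<dots> = Suc (card S0 + card S1)"
    using S(2-5) by (simp add: card_Un_disjoint)
  finally have cardS: "N = Suc (card S0 + card S1)" by (simp add: card_field N_def)
  have degU: "degree U = 2 + 2 * card S1"
  proof -
    have "2 * N = 2 * card S0 + degree U"
      using degW1 P0_0 U0 unfolding U P0_def
      by (simp add: degree_mult_eq degree_power_eq degree_prod_linear)
    then show ?thesis using cardS by linarith
  qed
  have degV: "degree V = 1 + 2 * card S1"
    using P1_0 unfolding V_def P1_def
    by (simp add: degree_mult_eq degree_power_eq degree_prod_linear)
  have "bezout_coprime V U"
  proof -
    have "poly W1 0 = a"
    proof -
      have "poly T 0 = 0"
        unfolding T_def poly_sum
      proof (rule sum.neutral, rule ballI)
        fix i assume "i \<in> {..<r}"
        then have "2 * 2 ^ i \<le> N" using iN by simp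
        moreover have "(0::nat) < 2 ^ i" by simp
        ultimately have "N - 2 ^ i \<noteq> 0" by linarith
        then show "poly (tt ^ (N + 2 ^ i) + [:a ^ 2 ^ i:] * tt ^ (N - 2 ^ i)) 0 = 0"
          by (simp add: power_0_left)
      qed
      then show ?thesis using N by (simp add: W1_def power_0_left)
    qed
    then have "poly U 0 \<noteq> 0" using a unfolding U by auto
    then have "bezout_coprime tt U" using bezout_coprime_linear[of U 0] by simp
    moreover have "bezout_coprime P1 U"
      unfolding P1_def
    proof (rule bezout_coprime_prod_left)
      fix c assume "c \<in> S1"
      then have "c \<noteq> 0" "abs_tr r (c + a * inverse c) = 1" by (auto simp: S1_def)
      then have "poly W c \<noteq> 0" using W_eval by simp
      then have "poly U c \<noteq> 0" unfolding WGU by auto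
      then show "bezout_coprime [:c, 1:] U" using bezout_coprime_linear[of U c] by simp
    qed
    ultimately show ?thesis
      unfolding V_def power2_eq_square by (intro bezout_coprime_mult_left)
  qed
  then have "reduced U V" using U0 degU degV by (simp add: reduced_def bezout_coprime_commute)
  moreover have "reduced (tt ^ N) 1"
    unfolding reduced_def using N bezout_coprime_1_left bezout_coprime_commute
    by (auto simp: degree_tt_power)
  \<comment> \<open>Multiplied by G^2, the left side becomes \<alpha> times the two sides of
    \<open>W_quad\<close> added together, which is 0 in characteristic 2.\<close>
  moreover have "(tt ^ N + tt * 1)\<^sup>2 * U\<^sup>2 + (tt * tt ^ N * 1) * (U * V) + (tt * tt ^ N + [:a:] * 1)\<^sup>2 * V\<^sup>2 = 0"
  proof -
    define \<alpha> where "\<alpha> = (tt ^ N + tt)\<^sup>2"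
    define \<gamma> where "\<gamma> = (tt ^ (N + 1) + [:a:])\<^sup>2"
    have \<alpha>: "\<alpha> = G * V" using GV by (simp add: \<alpha>_def)
    have "G\<^sup>2 * (\<alpha> * U\<^sup>2 + tt ^ (N + 1) * (U * V) + \<gamma> * V\<^sup>2) =
        \<alpha> * (G * U)\<^sup>2 + tt ^ (N + 1) * (G * U) * (G * V) + \<gamma> * (G * V)\<^sup>2"
      by (simp only: power2_eq_square distrib_left ac_simps)
    also have "\<dots> = \<alpha> * (W * (W + tt ^ (N + 1)) + \<gamma> * \<alpha>)"
      unfolding WGU[symmetric] \<alpha>[symmetric] by (simp only: power2_eq_square distrib_left ac_simps)
    also have "\<dots> = 0" unfolding W_quad \<alpha>_def \<gamma>_def by simp
    finally have "\<alpha> * U\<^sup>2 + tt ^ (N + 1) * (U * V) + \<gamma> * V\<^sup>2 = 0" using G0 by simp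
    then show ?thesis
      unfolding \<alpha>_def \<gamma>_def Suc_eq_plus1[symmetric] power_Suc mult_1_right .
  qed
  ultimately have "adj a (tt ^ 2 ^ r) 1 U V" unfolding adj_def N_def by blast
  moreover have "int (degree U) = Q + 1 - Kl r a"
  proof -
    have "{x. x \<noteq> 0 \<and> lam r (x + a * inverse x) = -1} = S1"
      using abs_tr_cases by (auto simp: S1_def lam_def split: if_splits)
    then show ?thesis using Kl_eq_card[of a] degU by simp
  qed
  ultimately show ?thesis using that by blast
qed

text \<open>The quadratic m^2 - K m + q is nonnegative at every integer m, which bounds K^2 by 4 q +
  1 when K is odd. Writing K = 4 j - 1 turns the extremal case into an impossible factorization of
  q.\<close>

theorem Kl_bound:
  assumes "r \<ge> 2" and a: "(a::'a) \<noteq> 0"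
  shows "(Kl r a)\<^sup>2 < 4 * Q"
proof -
  obtain U V where UV: "adj a (tt ^ 2 ^ r) 1 U V" "int (degree U) = Q + 1 - Kl r a"
    using adj_start[OF a] by blast
  have nonneg: "m\<^sup>2 - Kl r a * m + Q \<ge> 0" for m
    using adj_quadratic_nonneg[OF a UV(1), of m] UV(2) by (simp add: degree_tt_power)
  have "4 dvd Kl r a - (-1)" using Kl_cong_4[OF assms] by (simp only: cong_iff_dvd_diff)
  then obtain j where "Kl r a - (-1) = 4 * j" by (rule dvdE)
  then have j: "Kl r a = 4 * j - 1" by simp
  \<comment> \<open>The integer 2 j is nearest to the minimum K / 2 = 2 j - 1/2 of the
    quadratic.\<close>
  have "(2 * j)\<^sup>2 - (4 * j - 1) * (2 * j) + Q \<ge> 0" using nonneg[of "2 * j"] by (simp add: j)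
  then have le: "2 * j * (2 * j - 1) \<le> Q" by (simp add: power2_eq_square algebra_simps)
  \<comment> \<open>Equality would make the odd number 2 j - 1 a divisor of a power of 2, hence 1 or
    -1, and then q would be 2 or 0.\<close>
  have "2 * j * (2 * j - 1) \<noteq> Q"
  proof
    assume eq: "2 * j * (2 * j - 1) = Q"
    then have "(2 * j - 1) dvd 2 ^ r" by (metis dvd_triv_right)
    moreover have "coprime (2 * j - 1) (2 ^ r)" by (simp add: coprime_right_2_iff_odd)
    ultimately have "is_unit (2 * j - 1)" by (metis coprime_absorb_left)
    then have "2 * j - 1 = 1 \<or> 2 * j - 1 = -1" by auto
    then have "j = 1 \<or> j = 0" by auto
    then have "Q = 2 \<or> Q = 0" using eq by auto
    moreover have "Q \<ge> 2\<^sup>2" using assms(1) by (intro power_increasing) auto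
    ultimately show False by auto
  qed
  with le have "2 * j * (2 * j - 1) < Q" by simp
  then show ?thesis unfolding j by (simp add: power2_eq_square algebra_simps)
qed

end

section \<open>Zero-sum subsets and power moments\<close>

text \<open>A binary vector is its support, so counting codewords becomes counting index sets with
  vanishing trace sum, the form in which both the fibre count and the power moments are
  treated.\<close>

lemma weight_count_eq:
  "weight_count gs j =
    card {S. S \<subseteq> {..<length gs} \<and> card S = j \<and> (\<Sum>i\<in>S. mat_trace (gs ! i)) = 0}"
proof -
  define supp where "supp u = {i. i < dim_vec u \<and> u $ i \<noteq> (0::bit)}" for u
  define vecof where "vecof S = vec (length gs) (\<lambda>i. of_bool (i \<in> S) :: bit)" for S
  let ?A = "{u \<in> trace_code gs. hamming_weight u = j}"
  let ?B = "{S. S \<subseteq> {..<length gs} \<and> card S = j \<and> (\<Sum>i\<in>S. mat_trace (gs ! i)) = 0}"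
  have sum_eq: "(\<Sum>i<length gs. of_bool (u $ i = 1) * mat_trace (gs ! i)) = (\<Sum>i\<in>supp u. mat_trace (gs ! i))"
    if "u \<in> carrier_vec (length gs)" for u
  proof -
    have "supp u = {i \<in> {..<length gs}. u $ i = 1}"
      using that by (auto simp: supp_def)
    then have "(\<Sum>i\<in>supp u. mat_trace (gs ! i)) = (\<Sum>i<length gs. if u $ i = 1 then mat_trace (gs ! i) else 0)"
      by (simp only: sum.inter_filter finite_lessThan)
    also have "\<dots> = (\<Sum>i<length gs. of_bool (u $ i = 1) * mat_trace (gs ! i))"
      by (intro sum.cong) auto
    finally show ?thesis by simp
  qed
  have supp_vecof: "supp (vecof S) = S" if "S \<subseteq> {..<length gs}" for S
    using that by (auto simp: supp_def vecof_def)
  have vecof_supp: "vecof (supp u) = u" if "u \<in> carrier_vec (length gs)" for u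
    using that by (intro eq_vecI) (auto simp: supp_def vecof_def)
  have "bij_betw supp ?A ?B"
  proof (rule bij_betw_byWitness[where f' = vecof])
    show "\<forall>u\<in>?A. vecof (supp u) = u" using vecof_supp by (auto simp: trace_code_def)
    show "\<forall>S\<in>?B. supp (vecof S) = S" using supp_vecof by auto
    show "supp ` ?A \<subseteq> ?B"
    proof (rule image_subsetI)
      fix u assume "u \<in> ?A"
      then have u: "u \<in> carrier_vec (length gs)" "hamming_weight u = j"
        "(\<Sum>i<length gs. of_bool (u $ i = 1) * mat_trace (gs ! i)) = 0"
        by (auto simp: trace_code_def)
      have "supp u \<subseteq> {..<length gs}" using u(1) by (auto simp: supp_def)
      moreover have "card (supp u) = j" using u(2) by (simp add: hamming_weight_def supp_def)
      ultimately show "supp u \<in> ?B" using u(3) sum_eq[OF u(1)] by simp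
    qed
    show "vecof ` ?B \<subseteq> ?A"
    proof (rule image_subsetI)
      fix S assume S: "S \<in> ?B"
      have car: "vecof S \<in> carrier_vec (length gs)" by (simp add: vecof_def)
      moreover have "supp (vecof S) = S" using S supp_vecof by auto
      moreover have "hamming_weight (vecof S) = card (supp (vecof S))"
        by (simp add: hamming_weight_def supp_def)
      ultimately show "vecof S \<in> ?A" using S sum_eq[OF car] by (simp add: trace_code_def)
    qed
  qed
  then show ?thesis unfolding weight_count_def by (rule bij_betw_same_card)
qed

lemma finite_families_bounded: "finite {\<nu> :: 'a::finite \<Rightarrow> nat. \<forall>b. \<nu> b \<le> j}"
proof -
  have "{\<nu> :: 'a \<Rightarrow> nat. \<forall>b. \<nu> b \<le> j} = (\<Pi>\<^sub>E b\<in>UNIV. {..j})" by (auto simp: PiE_def Pi_def)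
  then show ?thesis by (simp add: finite_PiE)
qed

lemma finite_zero_sum_families: "finite (zero_sum_families j :: ('a::{field,finite} \<Rightarrow> nat) set)"
proof (rule finite_subset[OF _ finite_families_bounded[of j]])
  show "(zero_sum_families j :: ('a \<Rightarrow> nat) set) \<subseteq> {\<nu>. \<forall>b. \<nu> b \<le> j}"
  proof (rule subsetI)
    fix \<nu> :: "'a \<Rightarrow> nat" assume "\<nu> \<in> zero_sum_families j"
    then have "sum \<nu> UNIV = j" by (simp add: zero_sum_families_def)
    then have "\<nu> b \<le> j" for b using member_le_sum[of b UNIV \<nu>] by simp
    then show "\<nu> \<in> {\<nu>. \<forall>b. \<nu> b \<le> j}" by simp
  qed
qed

text \<open>A subset of \<open>I\<close> amounts to an independent choice of a subset in each fibre
  of \<open>x\<close>.\<close>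

lemma card_subsets_with_fibre_cards:
  fixes x :: "'i \<Rightarrow> 'b::finite"
  assumes "finite I"
  shows "card {S. S \<subseteq> I \<and> (\<forall>b. card {i\<in>S. x i = b} = \<nu> b)} =
    (\<Prod>b\<in>UNIV. card {i\<in>I. x i = b} choose \<nu> b)"
proof -
  let ?A = "{S. S \<subseteq> I \<and> (\<forall>b. card {i\<in>S. x i = b} = \<nu> b)}"
  let ?F = "\<lambda>b. {T. T \<subseteq> {i\<in>I. x i = b} \<and> card T = \<nu> b}"
  have "bij_betw (\<lambda>S b. {i\<in>S. x i = b}) ?A (\<Pi>\<^sub>E b\<in>UNIV. ?F b)"
  proof (rule bij_betw_byWitness[where f' = "\<lambda>f. \<Union>b. f b"])
    show "\<forall>S\<in>?A. (\<Union>b. {i\<in>S. x i = b}) = S" by auto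
    show "\<forall>f\<in>(\<Pi>\<^sub>E b\<in>UNIV. ?F b). (\<lambda>b. {i \<in> \<Union>b. f b. x i = b}) = f"
    proof (intro ballI ext)
      fix f b assume "f \<in> (\<Pi>\<^sub>E b\<in>UNIV. ?F b)"
      then have "f c \<subseteq> {i\<in>I. x i = c}" for c by (auto simp: PiE_def Pi_def)
      then show "{i \<in> \<Union>b. f b. x i = b} = f b" by blast
    qed
    show "(\<lambda>S b. {i\<in>S. x i = b}) ` ?A \<subseteq> (\<Pi>\<^sub>E b\<in>UNIV. ?F b)"
      by (auto simp: PiE_def Pi_def)
    show "(\<lambda>f. \<Union>b. f b) ` (\<Pi>\<^sub>E b\<in>UNIV. ?F b) \<subseteq> ?A"
    proof (rule image_subsetI)
      fix f assume "f \<in> (\<Pi>\<^sub>E b\<in>UNIV. ?F b)"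
      then have f: "f c \<subseteq> {i\<in>I. x i = c}" "card (f c) = \<nu> c" for c by (auto simp: PiE_def Pi_def)
      have "{i \<in> \<Union>b. f b. x i = c} = f c" for c using f(1) by blast
      moreover have "(\<Union>b. f b) \<subseteq> I" using f(1) by blast
      ultimately show "(\<Union>b. f b) \<in> ?A" using f(2) by simp
    qed
  qed
  then have "card ?A = card (\<Pi>\<^sub>E b\<in>UNIV. ?F b)" by (rule bij_betw_same_card)
  also have "\<dots> = (\<Prod>b\<in>UNIV. card {i\<in>I. x i = b} choose \<nu> b)"
    using assms by (subst card_PiE) (simp_all add: n_subsets)
  finally show ?thesis .
qed

text \<open>The size and the sum of \<open>S\<close> depend only on how many of its elements lie in
  each fibre, so the zero-sum sets can be grouped by these counts.\<close>

lemma card_zero_sum_subsets: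
  fixes x :: "'i \<Rightarrow> 'a::{field,finite}"
  assumes "finite I"
  shows "card {S. S \<subseteq> I \<and> card S = j \<and> (\<Sum>i\<in>S. x i) = 0} =
    (\<Sum>\<nu>\<in>zero_sum_families j. \<Prod>b\<in>UNIV. card {i\<in>I. x i = b} choose \<nu> b)"
proof -
  let ?C = "\<lambda>\<nu>. {S. S \<subseteq> I \<and> (\<forall>b. card {i\<in>S. x i = b} = \<nu> b)}"
  have fam: "(\<Sum>b\<in>UNIV. card {i\<in>S. x i = b}) = card S"
    "(\<Sum>b\<in>UNIV. of_nat (card {i\<in>S. x i = b}) * b) = (\<Sum>i\<in>S. x i)" if "S \<subseteq> I" for S
  proof -
    have fin: "finite S" using that assms finite_subset by blast
    show "(\<Sum>b\<in>UNIV. card {i\<in>S. x i = b}) = card S"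
      using sum.group[of S UNIV x "\<lambda>_. 1::nat"] fin by simp
    have "(\<Sum>i\<in>{i\<in>S. x i = b}. x i) = of_nat (card {i\<in>S. x i = b}) * b" for b
      by simp
    then show "(\<Sum>b\<in>UNIV. of_nat (card {i\<in>S. x i = b}) * b) = (\<Sum>i\<in>S. x i)"
      using sum.group[of S UNIV x x] fin by (simp only: finite subset_UNIV)
  qed
  have "{S. S \<subseteq> I \<and> card S = j \<and> (\<Sum>i\<in>S. x i) = 0} = (\<Union>\<nu>\<in>zero_sum_families j. ?C \<nu>)"
  proof (intro equalityI subsetI)
    fix S assume S: "S \<in> {S. S \<subseteq> I \<and> card S = j \<and> (\<Sum>i\<in>S. x i) = 0}"
    then have "(\<lambda>b. card {i\<in>S. x i = b}) \<in> zero_sum_families j"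
      using fam[of S] by (simp add: zero_sum_families_def)
    then show "S \<in> (\<Union>\<nu>\<in>zero_sum_families j. ?C \<nu>)" using S by blast
  next
    fix S assume "S \<in> (\<Union>\<nu>\<in>zero_sum_families j. ?C \<nu>)"
    then obtain \<nu> where "\<nu> \<in> zero_sum_families j" "S \<subseteq> I" "\<nu> = (\<lambda>b. card {i\<in>S. x i = b})" by fastforce
    then show "S \<in> {S. S \<subseteq> I \<and> card S = j \<and> (\<Sum>i\<in>S. x i) = 0}"
      using fam[of S] by (simp add: zero_sum_families_def)
  qed
  also have "card \<dots> = (\<Sum>\<nu>\<in>zero_sum_families j. card (?C \<nu>))"
  proof (rule card_UN_disjoint)
    show "finite (zero_sum_families j :: ('a \<Rightarrow> nat) set)" by (rule finite_zero_sum_families)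
    show "\<forall>\<nu>\<in>zero_sum_families j. finite (?C \<nu>)" using assms by simp
    show "\<forall>\<nu>\<in>zero_sum_families j. \<forall>\<nu>'\<in>zero_sum_families j. \<nu> \<noteq> \<nu>' \<longrightarrow> ?C \<nu> \<inter> ?C \<nu>' = {}"
    proof (intro ballI impI)
      fix \<nu> \<nu>' :: "'a \<Rightarrow> nat" assume "\<nu> \<noteq> \<nu>'"
      then obtain b where "\<nu> b \<noteq> \<nu>' b" by auto
      then show "?C \<nu> \<inter> ?C \<nu>' = {}" by auto
    qed
  qed
  finally show ?thesis by (simp add: card_subsets_with_fibre_cards[OF assms])
qed

section \<open>Stirling numbers and the power moment identity\<close>

lemma binom_of_nat: "binom (real n) (int k) = real (n choose k)"
  by (simp add: binom_def binomial_gbinomial binomial_eq_0 flip: binomial_gbinomial)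

text \<open>\<open>fact t * (w choose t)\<close> is the falling factorial of \<open>w\<close>, and
  the Stirling numbers are the coordinates of powers in this basis. \<open>absorb\<close> is
  multiplication by \<open>w\<close> in the basis.\<close>

lemma power_eq_sum_Stirling:
  "(w::nat) ^ h = (\<Sum>t\<le>h. Stirling h t * fact t * (w choose t))"
proof (induction h)
  case (Suc h)
  have absorb: "fact t * (w choose t) * w = fact (Suc t) * (w choose Suc t) + t * (fact t * (w choose t))" for t
  proof (cases "t \<le> w")
    case True
    have "Suc t * (w choose Suc t) = (w choose t) * (w - t)"
      using binomial_absorption[of t w] binomial_absorb_comp[of w t] by (simp only: mult.commute)
    moreover have "fact (Suc t) * (w choose Suc t) = fact t * (Suc t * (w choose Suc t))"
      by (simp only: fact_Suc of_nat_id mult_ac)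
    ultimately have "fact (Suc t) * (w choose Suc t) = fact t * (w choose t) * (w - t)"
      by (simp only: mult.assoc)
    moreover have "w = (w - t) + t" using True by simp
    ultimately show ?thesis by (metis add_mult_distrib2 mult.commute)
  qed (simp add: binomial_eq_0)
  have "w ^ Suc h = (\<Sum>t\<le>h. Stirling h t * (fact t * (w choose t) * w))"
    unfolding power_Suc Suc.IH sum_distrib_left by (intro sum.cong refl) (simp only: ac_simps)
  also have "\<dots> = (\<Sum>t\<le>h. Stirling h t * (fact (Suc t) * (w choose Suc t))) +
      (\<Sum>t\<le>h. t * Stirling h t * (fact t * (w choose t)))"
    unfolding absorb distrib_left sum.distrib by (simp only: ac_simps)
  \<comment> \<open>The range is raised to \<open>Suc h\<close>, where
    \<open>Stirling h (Suc h) = 0\<close>, and then shifted past t = 0, where the factor t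
    vanishes.\<close>
  also have "(\<Sum>t\<le>h. t * Stirling h t * (fact t * (w choose t))) =
      (\<Sum>t\<le>Suc h. t * Stirling h t * (fact t * (w choose t)))"
    by simp
  also have "\<dots> = (\<Sum>t\<le>h. Suc t * Stirling h (Suc t) * (fact (Suc t) * (w choose Suc t)))"
    by (subst sum.atMost_Suc_shift) simp
  also have "(\<Sum>t\<le>h. Stirling h t * (fact (Suc t) * (w choose Suc t))) + \<dots> =
      (\<Sum>t\<le>h. Stirling (Suc h) (Suc t) * (fact (Suc t) * (w choose Suc t)))"
    unfolding sum.distrib[symmetric] by (intro sum.cong refl) (simp add: algebra_simps)
  also have "\<dots> = (\<Sum>t\<le>Suc h. Stirling (Suc h) t * fact t * (w choose t))"
    by (subst sum.atMost_Suc_shift) (simp add: algebra_simps)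
  finally show ?case .
qed simp

lemma card_supersets:
  assumes "finite I" "S \<subseteq> I" "card S \<le> t"
  shows "card {T. S \<subseteq> T \<and> T \<subseteq> I \<and> card T = t} = (card I - card S) choose (t - card S)"
proof -
  have finS: "finite S" using assms finite_subset by blast
  have "bij_betw (\<lambda>T. T - S) {T. S \<subseteq> T \<and> T \<subseteq> I \<and> card T = t} {U. U \<subseteq> I - S \<and> card U = t - card S}"
  proof (rule bij_betw_byWitness[where f' = "\<lambda>U. U \<union> S"])
    show "(\<lambda>T. T - S) ` {T. S \<subseteq> T \<and> T \<subseteq> I \<and> card T = t} \<subseteq> {U. U \<subseteq> I - S \<and> card U = t - card S}"
      using finS by (auto simp: card_Diff_subset)
    show "(\<lambda>U. U \<union> S) ` {U. U \<subseteq> I - S \<and> card U = t - card S} \<subseteq> {T. S \<subseteq> T \<and> T \<subseteq> I \<and> card T = t}"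
    proof (rule image_subsetI)
      fix U assume U: "U \<in> {U. U \<subseteq> I - S \<and> card U = t - card S}"
      then have "finite U" "U \<inter> S = {}" using assms(1) finite_subset by auto
      then have "card (U \<union> S) = t" using U finS assms(3) by (simp add: card_Un_disjoint)
      then show "U \<union> S \<in> {T. S \<subseteq> T \<and> T \<subseteq> I \<and> card T = t}" using U assms(2) by auto
    qed
  qed auto
  then have "card {T. S \<subseteq> T \<and> T \<subseteq> I \<and> card T = t} = card {U. U \<subseteq> I - S \<and> card U = t - card S}"
    by (rule bij_betw_same_card)
  then show ?thesis using assms finS by (simp add: n_subsets card_Diff_subset)
qed

context char2_field
begin

text \<open>Orthogonality of characters; the term \<open>card I\<close> is the contribution of a =
  0.\<close>

lemma card_fibre_eq:
  fixes x :: "'i \<Rightarrow> 'a"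
  assumes "finite I"
  shows "Q * int (card {i\<in>I. x i = b}) =
    int (card I) + (\<Sum>a\<in>UNIV - {0}. lam r (a * b) * (\<Sum>i\<in>I. lam r (a * x i)))"
proof -
  have "(\<Sum>a\<in>UNIV. lam r (a * b) * (\<Sum>i\<in>I. lam r (a * x i))) =
      (\<Sum>a\<in>UNIV. \<Sum>i\<in>I. lam r ((b + x i) * a))"
    unfolding sum_distrib_left
  proof (rule sum.cong[OF refl], rule sum.cong[OF refl])
    fix a i show "lam r (a * b) * lam r (a * x i) = lam r ((b + x i) * a)"
      by (simp only: lam_add[symmetric] distrib_left[symmetric] mult.commute)
  qed
  also have "\<dots> = (\<Sum>i\<in>I. \<Sum>a\<in>UNIV. lam r ((b + x i) * a))" by (rule sum.swap)
  also have "\<dots> = (\<Sum>i\<in>I. if x i = b then Q else 0)"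
    unfolding sum_lam by (intro sum.cong refl) auto
  also have "\<dots> = Q * int (card {i\<in>I. x i = b})"
    using assms by (simp add: sum.If_cases Int_def)
  finally show ?thesis by (simp add: sum_nonzero)
qed

text \<open>For a set T of size t the product of 1 - \<lambda>(a x_i) over i in T is 2^t if
  \<lambda> is -1 throughout T, and 0 otherwise. Expanding it over the subsets S of T and summing
  over a keeps the zero-sum S, each counted once for every superset of size t.\<close>

lemma sum_choose_neg:
  fixes x :: "'i \<Rightarrow> 'a"
  assumes "finite I"
  shows "(\<Sum>a\<in>UNIV. 2 ^ t * int (card {i\<in>I. lam r (a * x i) = -1} choose t)) =
    Q * (\<Sum>j\<le>t. (-1) ^ j * int (card {S. S \<subseteq> I \<and> card S = j \<and> (\<Sum>i\<in>S. x i) = 0}) *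
      int ((card I - j) choose (t - j)))"
proof -
  let ?W = "\<lambda>a. {i\<in>I. lam r (a * x i) = -1}" and ?T = "{T. T \<subseteq> I \<and> card T = t}"
  let ?Z = "{S. S \<subseteq> I \<and> (\<Sum>i\<in>S. x i) = 0}"
  have finT: "finite ?T" "finite (Pow I)" "finite ?Z" using assms by simp_all
  have fin: "finite S" if "S \<subseteq> I" for S using that assms finite_subset by blast
  have "2 ^ t * int (card (?W a) choose t) = (\<Sum>T\<in>?T. \<Sum>S\<in>Pow T. (-1) ^ card S * lam r (a * (\<Sum>i\<in>S. x i)))" for a
  proof -
    have T: "(if T \<subseteq> ?W a then 2 ^ t else 0) = (\<Sum>S\<in>Pow T. (-1) ^ card S * lam r (a * (\<Sum>i\<in>S. x i)))"
      if "T \<in> ?T" for T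
    proof -
      have finT: "finite T" using that fin by auto
      have "(\<Sum>S\<in>Pow T. (-1) ^ card S * lam r (a * (\<Sum>i\<in>S. x i))) =
          (\<Sum>S\<in>Pow T. (\<Prod>i\<in>S. - lam r (a * x i)) * (\<Prod>i\<in>T - S. 1))"
        by (simp add: sum_distrib_left lam_sum prod_uminus)
      also have "\<dots> = (\<Prod>i\<in>T. - lam r (a * x i) + 1)" by (rule prod_add[OF finT, symmetric])
      also have "\<dots> = (if T \<subseteq> ?W a then 2 ^ t else 0)"
      proof (cases "T \<subseteq> ?W a")
        case True
        then have "(\<Prod>i\<in>T. - lam r (a * x i) + 1) = (\<Prod>i\<in>T. 2)" by (intro prod.cong) auto
        then show ?thesis using True that by simp
      next
        case False
        moreover have "T \<subseteq> I" using that by simp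
        ultimately obtain i where "i \<in> T" "lam r (a * x i) \<noteq> -1" by blast
        then have "- lam r (a * x i) + 1 = 0" using lam_cases[of "a * x i"] by simp
        then show ?thesis using False \<open>i \<in> T\<close> finT by (auto simp: prod_zero_iff)
      qed
      finally show ?thesis by simp
    qed
    have "(\<Sum>T\<in>?T. if T \<subseteq> ?W a then 2 ^ t else 0) = 2 ^ t * int (card {T \<in> ?T. T \<subseteq> ?W a})"
      using finT(1) by (simp add: sum.If_cases Int_def)
    also have "{T \<in> ?T. T \<subseteq> ?W a} = {T. T \<subseteq> ?W a \<and> card T = t}" by auto
    also have "card \<dots> = card (?W a) choose t" using assms by (simp add: n_subsets)
    finally show ?thesis using T by simp
  qed
  then have "(\<Sum>a\<in>UNIV. 2 ^ t * int (card (?W a) choose t)) =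
      (\<Sum>a\<in>UNIV. \<Sum>T\<in>?T. \<Sum>S\<in>Pow T. (-1) ^ card S * lam r (a * (\<Sum>i\<in>S. x i)))"
    by simp
  also have "\<dots> = (\<Sum>T\<in>?T. \<Sum>S\<in>Pow T. (-1) ^ card S * (\<Sum>a\<in>UNIV. lam r ((\<Sum>i\<in>S. x i) * a)))"
    by (subst sum.swap, rule sum.cong[OF refl], subst sum.swap) (simp add: sum_distrib_left mult.commute)
  also have "\<dots> = (\<Sum>T\<in>?T. \<Sum>S\<in>Pow T. if (\<Sum>i\<in>S. x i) = 0 then Q * (-1) ^ card S else 0)"
    unfolding sum_lam by (intro sum.cong refl) simp
  also have "\<dots> = (\<Sum>T\<in>?T. \<Sum>S\<in>{S \<in> ?Z. S \<subseteq> T}. Q * (-1) ^ card S)"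
  proof (rule sum.cong[OF refl])
    fix T assume "T \<in> ?T"
    then have "{S \<in> ?Z. S \<subseteq> T} = {S \<in> Pow T. (\<Sum>i\<in>S. x i) = 0}" "finite (Pow T)" using fin by auto
    then show "(\<Sum>S\<in>Pow T. if (\<Sum>i\<in>S. x i) = 0 then Q * (-1) ^ card S else 0) =
      (\<Sum>S\<in>{S \<in> ?Z. S \<subseteq> T}. Q * (-1) ^ card S)"
      by (simp only: sum.inter_filter)
  qed
  also have "\<dots> = (\<Sum>S\<in>?Z. \<Sum>T\<in>{T \<in> ?T. S \<subseteq> T}. Q * (-1) ^ card S)"
    using finT by (intro sum.swap_restrict)
  also have "\<dots> = (\<Sum>S\<in>?Z. if card S \<le> t then Q * ((-1) ^ card S * int ((card I - card S) choose (t - card S))) else 0)"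
  proof (rule sum.cong[OF refl])
    fix S assume "S \<in> ?Z"
    then have S: "S \<subseteq> I" by simp
    have set: "{T \<in> ?T. S \<subseteq> T} = {T. S \<subseteq> T \<and> T \<subseteq> I \<and> card T = t}" by auto
    show "(\<Sum>T\<in>{T \<in> ?T. S \<subseteq> T}. Q * (-1) ^ card S) =
      (if card S \<le> t then Q * ((-1) ^ card S * int ((card I - card S) choose (t - card S))) else 0)"
    proof (cases "card S \<le> t")
      case True
      then show ?thesis unfolding set using card_supersets[OF assms S True] by simp
    next
      case False
      have "\<not> S \<subseteq> T" if "T \<in> ?T" for T
        using that False card_mono[of T S] fin[of T] by auto
      then have empty: "{T \<in> ?T. S \<subseteq> T} = {}" by blast
      show ?thesis unfolding empty using False by simp
    qed
  qed
  also have "\<dots> = (\<Sum>S\<in>{S \<in> ?Z. card S \<le> t}. Q * ((-1) ^ card S * int ((card I - card S) choose (t - card S))))"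
    by (rule sum.inter_filter[OF finT(3), symmetric])
  also have "\<dots> = (\<Sum>j\<le>t. \<Sum>S\<in>{S \<in> {S \<in> ?Z. card S \<le> t}. card S = j}. Q * ((-1) ^ card S * int ((card I - card S) choose (t - card S))))"
  proof (rule sum.group[symmetric])
    show "finite {S \<in> ?Z. card S \<le> t}" using finT(3) by (rule rev_finite_subset) auto
  qed auto
  also have "\<dots> = (\<Sum>j\<le>t. Q * ((-1) ^ j * int (card {S. S \<subseteq> I \<and> card S = j \<and> (\<Sum>i\<in>S. x i) = 0}) * int ((card I - j) choose (t - j))))"
  proof (rule sum.cong[OF refl])
    fix j assume "j \<in> {..t}"
    then have set: "{S \<in> {S \<in> ?Z. card S \<le> t}. card S = j} = {S. S \<subseteq> I \<and> card S = j \<and> (\<Sum>i\<in>S. x i) = 0}"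
      by auto
    have "(\<Sum>S\<in>{S. S \<subseteq> I \<and> card S = j \<and> (\<Sum>i\<in>S. x i) = 0}. Q * ((-1) ^ card S * int ((card I - card S) choose (t - card S)))) =
       (\<Sum>S\<in>{S. S \<subseteq> I \<and> card S = j \<and> (\<Sum>i\<in>S. x i) = 0}. Q * ((-1) ^ j * int ((card I - j) choose (t - j))))"
      by (intro sum.cong) auto
    then show "(\<Sum>S\<in>{S \<in> {S \<in> ?Z. card S \<le> t}. card S = j}. Q * ((-1) ^ card S * int ((card I - card S) choose (t - card S)))) =
      Q * ((-1) ^ j * int (card {S. S \<subseteq> I \<and> card S = j \<and> (\<Sum>i\<in>S. x i) = 0}) * int ((card I - j) choose (t - j)))"
      unfolding set by simp
  qed
  finally show ?thesis by (simp only: sum_distrib_left)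
qed

text \<open>
  The Pless power moment identity. Summing over all \<open>a\<close>, rather than over the codewords
  of the dual code, avoids any injectivity assumption.
\<close>

lemma power_moment:
  fixes x :: "'i \<Rightarrow> 'a"
  assumes "finite I"
  defines "C \<equiv> \<lambda>j. card {S. S \<subseteq> I \<and> card S = j \<and> (\<Sum>i\<in>S. x i) = 0}"
  shows "(\<Sum>a\<in>UNIV. (real (card I) - real_of_int (\<Sum>i\<in>I. lam r (a * x i))) ^ h) =
    2 ^ r * (\<Sum>j=0..min (card I) h. (-1) ^ j * real (C j) *
      (\<Sum>t=j..h. fact t * real (Stirling h t) * 2 ^ (h - t)
         * binom (real (card I) - real j) (int (card I) - int t)))"
proof -
  let ?N = "card I" and ?w = "\<lambda>a. card {i\<in>I. lam r (a * x i) = -1}"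
  \<comment> \<open>Each term with \<lambda> = -1 lowers the sum by 2; \<open>?w a\<close> is the
    Hamming weight of the dual codeword with entries tr(a x_i).\<close>
  have w: "real ?N - real_of_int (\<Sum>i\<in>I. lam r (a * x i)) = 2 * real (?w a)" for a
  proof -
    have "(\<Sum>i\<in>I. lam r (a * x i)) = (\<Sum>i\<in>I. 1 - 2 * (if lam r (a * x i) = -1 then 1 else 0))"
    proof (rule sum.cong[OF refl])
      fix i show "lam r (a * x i) = 1 - 2 * (if lam r (a * x i) = -1 then 1 else 0)"
        using lam_cases[of "a * x i"] by (elim disjE) simp_all
    qed
    also have "\<dots> = int ?N - 2 * (\<Sum>i\<in>I. if lam r (a * x i) = -1 then 1 else 0)"
      unfolding sum_subtractf sum_distrib_left[symmetric] by simp
    also have "(\<Sum>i\<in>I. if lam r (a * x i) = -1 then 1 else 0) = int (?w a)"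
      using assms(1) by (simp add: sum.If_cases Int_def)
    finally show ?thesis by simp
  qed
  \<comment> \<open>Extended by 0 for j > t, so that the triangular double sum fills a rectangle and
    can be interchanged.\<close>
  define c where "c j t = (if j \<le> t then fact t * real (Stirling h t) * 2 ^ (h - t) * real ((?N - j) choose (t - j)) else 0)" for j t
  have C0: "C j = 0" if "j > ?N" for j
  proof -
    have "{S. S \<subseteq> I \<and> card S = j \<and> (\<Sum>i\<in>S. x i) = 0} = {}"
      using that card_mono[OF assms(1)] by (auto simp: not_less[symmetric])
    then show ?thesis by (simp only: C_def card.empty)
  qed
  have "(\<Sum>a\<in>UNIV. (real ?N - real_of_int (\<Sum>i\<in>I. lam r (a * x i))) ^ h) =
      (\<Sum>a\<in>UNIV. 2 ^ h * real (?w a ^ h))"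
    unfolding w by (simp add: power_mult_distrib)
  also have "\<dots> = (\<Sum>a\<in>UNIV. \<Sum>t\<le>h. fact t * real (Stirling h t) * 2 ^ (h - t) * real_of_int (2 ^ t * int (?w a choose t)))"
  proof (rule sum.cong[OF refl])
    fix a
    have "2 ^ h = (2 ^ (h - t) * 2 ^ t :: real)" if "t \<le> h" for t
      using that by (simp add: power_add[symmetric])
    then show "2 ^ h * real (?w a ^ h) = (\<Sum>t\<le>h. fact t * real (Stirling h t) * 2 ^ (h - t) * real_of_int (2 ^ t * int (?w a choose t)))"
      unfolding power_eq_sum_Stirling[of "?w a"] of_nat_sum sum_distrib_left
      by (intro sum.cong refl) (simp add: mult_ac)
  qed
  also have "\<dots> = (\<Sum>t\<le>h. fact t * real (Stirling h t) * 2 ^ (h - t) * real_of_int (\<Sum>a\<in>UNIV. 2 ^ t * int (?w a choose t)))"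
    by (subst sum.swap) (simp only: sum_distrib_left of_int_sum)
  also have "\<dots> = (\<Sum>t\<le>h. 2 ^ r * (\<Sum>j\<le>t. (-1) ^ j * real (C j) * c j t))"
  proof (rule sum.cong[OF refl])
    fix t
    have "(\<Sum>j\<le>t. (-1) ^ j * real (C j) * c j t) = (\<Sum>j\<le>t. fact t * real (Stirling h t) * 2 ^ (h - t) *
        ((-1) ^ j * real (C j) * real ((?N - j) choose (t - j))))"
      by (intro sum.cong refl) (simp add: c_def)
    then show "fact t * real (Stirling h t) * 2 ^ (h - t) * real_of_int (\<Sum>a\<in>UNIV. 2 ^ t * int (?w a choose t)) =
      2 ^ r * (\<Sum>j\<le>t. (-1) ^ j * real (C j) * c j t)"
      unfolding sum_choose_neg[OF assms(1)] C_def by (simp add: sum_distrib_left mult_ac)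
  qed
  also have "\<dots> = 2 ^ r * (\<Sum>t\<le>h. \<Sum>j\<le>h. (-1) ^ j * real (C j) * c j t)"
    unfolding sum_distrib_left[symmetric]
  proof (rule arg_cong[where f = "(*) (2 ^ r)"], rule sum.cong[OF refl])
    fix t assume "t \<in> {..h}"
    then show "(\<Sum>j\<le>t. (-1) ^ j * real (C j) * c j t) = (\<Sum>j\<le>h. (-1) ^ j * real (C j) * c j t)"
      by (intro sum.mono_neutral_left) (auto simp: c_def)
  qed
  also have "(\<Sum>t\<le>h. \<Sum>j\<le>h. (-1) ^ j * real (C j) * c j t) = (\<Sum>j\<le>h. (-1) ^ j * real (C j) * (\<Sum>t\<le>h. c j t))"
    by (subst sum.swap) (simp only: sum_distrib_left)
  also have "\<dots> = (\<Sum>j=0..min ?N h. (-1) ^ j * real (C j) * (\<Sum>t\<le>h. c j t))"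
    by (rule sum.mono_neutral_right) (auto simp: C0)
  also have "\<dots> = (\<Sum>j=0..min ?N h. (-1) ^ j * real (C j) * (\<Sum>t=j..h. fact t * real (Stirling h t) * 2 ^ (h - t)
         * binom (real ?N - real j) (int ?N - int t)))"
  proof (rule sum.cong[OF refl])
    fix j assume j: "j \<in> {0..min ?N h}"
    have "(\<Sum>t\<le>h. c j t) = (\<Sum>t=j..h. c j t)"
      by (rule sum.mono_neutral_right) (auto simp: c_def)
    also have "\<dots> = (\<Sum>t=j..h. fact t * real (Stirling h t) * 2 ^ (h - t) * binom (real ?N - real j) (int ?N - int t))"
    proof (rule sum.cong[OF refl])
      fix t assume t: "t \<in> {j..h}"
      \<comment> \<open>This is the symmetry of binomial coefficients. For t > N the lower index N -
        t is negative and \<open>binom\<close> is 0 by convention, as is the coefficient on the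
        right.\<close>
      have "binom (real ?N - real j) (int ?N - int t) = real ((?N - j) choose (t - j))"
      proof (cases "t \<le> ?N")
        case True
        have "binom (real ?N - real j) (int ?N - int t) = binom (real (?N - j)) (int (?N - t))"
          using True j t by (simp add: of_nat_diff)
        also have "\<dots> = real ((?N - j) choose (?N - t))" by (rule binom_of_nat)
        also have "(?N - j) choose (?N - t) = (?N - j) choose (t - j)"
          using True j t binomial_symmetric[of "t - j" "?N - j"] by simp
        finally show ?thesis .
      next
        case False
        have "?N - j < t - j" using False j by (intro diff_less_mono) auto
        then show ?thesis using False by (simp add: binom_def binomial_eq_0)
      qed
      then show "c j t = fact t * real (Stirling h t) * 2 ^ (h - t) * binom (real ?N - real j) (int ?N - int t)"
        using t by (simp add: c_def)
    qed
    finally show "(-1) ^ j * real (C j) * (\<Sum>t\<le>h. c j t) = (-1) ^ j * real (C j) * (\<Sum>t=j..h. fact t * real (Stirling h t) * 2 ^ (h - t)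
         * binom (real ?N - real j) (int ?N - int t))" by simp
  qed
  finally show ?thesis .
qed

text \<open>With \<open>k\<close> the power moments are those of A (B - k a). Expanding (k a - B)^h
  binomially and solving for the term l = h gives the recursion.\<close>

lemma power_moment_recursion:
  fixes x :: "'i \<Rightarrow> 'a" and k :: "'a \<Rightarrow> real"
  assumes "finite I" and "h \<ge> 1" and A: "A \<noteq> 0"
    and k: "\<And>a. a \<noteq> 0 \<Longrightarrow> real (card I) - real_of_int (\<Sum>i\<in>I. lam r (a * x i)) = A * (B - k a)"
  defines "C \<equiv> \<lambda>j. card {S. S \<subseteq> I \<and> card S = j \<and> (\<Sum>i\<in>S. x i) = 0}"
  shows "(\<Sum>a\<in>UNIV - {0}. k a ^ h) =
      (\<Sum>l<h. (-1) ^ (h + l + 1) * real (h choose l) * B ^ (h - l) * (\<Sum>a\<in>UNIV - {0}. k a ^ l))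
    + 2 ^ r * A powi (- int h) * (\<Sum>j=0..min (card I) h. (-1) ^ (h + j) * real (C j) *
      (\<Sum>t=j..h. fact t * real (Stirling h t) * 2 ^ (h - t)
         * binom (real (card I) - real j) (int (card I) - int t)))"
proof -
  let ?U = "UNIV - {0::'a}"
  define R where "R = (\<Sum>j=0..min (card I) h. (-1) ^ j * real (C j) *
      (\<Sum>t=j..h. fact t * real (Stirling h t) * 2 ^ (h - t)
         * binom (real (card I) - real j) (int (card I) - int t)))"
  have "2 ^ r * R = (\<Sum>a\<in>UNIV. (real (card I) - real_of_int (\<Sum>i\<in>I. lam r (a * x i))) ^ h)"
    unfolding R_def C_def by (rule power_moment[OF assms(1), symmetric])
  \<comment> \<open>At a = 0 every \<lambda> is 1, so the base is 0, and h >= 1 removes the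
    term.\<close>
  also have "\<dots> = (\<Sum>a\<in>?U. (real (card I) - real_of_int (\<Sum>i\<in>I. lam r (a * x i))) ^ h)"
  proof (rule sum.mono_neutral_right)
    show "\<forall>a\<in>UNIV - ?U. (real (card I) - real_of_int (\<Sum>i\<in>I. lam r (a * x i))) ^ h = 0"
      using assms(2) by simp
  qed auto
  also have "\<dots> = (\<Sum>a\<in>?U. A ^ h * (-1) ^ h * (k a - B) ^ h)"
  proof (rule sum.cong[OF refl])
    fix a assume "a \<in> ?U"
    then have "real (card I) - real_of_int (\<Sum>i\<in>I. lam r (a * x i)) = A * ((-1) * (k a - B))"
      using k[of a] by (simp add: algebra_simps)
    then show "(real (card I) - real_of_int (\<Sum>i\<in>I. lam r (a * x i))) ^ h = A ^ h * (-1) ^ h * (k a - B) ^ h"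
      by (simp only: power_mult_distrib mult.assoc)
  qed
  finally have R: "2 ^ r * R = A ^ h * ((-1) ^ h * (\<Sum>a\<in>?U. (k a - B) ^ h))"
    by (simp add: sum_distrib_left mult.assoc)
  have "(-1) ^ h * ((-1) ^ h * s) = s" for s :: real
    by (simp add: mult.assoc[symmetric] power_mult_distrib[symmetric])
  moreover have "2 ^ r * inverse (A ^ h) * ((-1) ^ h * R) =
      inverse (A ^ h) * A ^ h * ((-1) ^ h * ((-1) ^ h * (\<Sum>a\<in>?U. (k a - B) ^ h)))"
  proof -
    have "2 ^ r * inverse (A ^ h) * ((-1) ^ h * R) = inverse (A ^ h) * ((-1) ^ h * (2 ^ r * R))"
      by (simp only: mult_ac)
    then show ?thesis unfolding R by (simp only: mult_ac)
  qed
  ultimately have "(\<Sum>a\<in>?U. (k a - B) ^ h) = 2 ^ r * inverse (A ^ h) * ((-1) ^ h * R)"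
    using A by simp
  moreover have "(\<Sum>a\<in>?U. (k a - B) ^ h) = (\<Sum>l\<le>h. (-1) ^ (h + l) * real (h choose l) * B ^ (h - l) * (\<Sum>a\<in>?U. k a ^ l))"
  proof -
    have "(k a - B) ^ h = (\<Sum>l\<le>h. (-1) ^ (h + l) * real (h choose l) * B ^ (h - l) * k a ^ l)" for a
    proof -
      have "(k a - B) ^ h = (k a + (- B)) ^ h" by simp
      also have "\<dots> = (\<Sum>l\<le>h. real (h choose l) * k a ^ l * (- B) ^ (h - l))" by (rule binomial_ring)
      also have "\<dots> = (\<Sum>l\<le>h. (-1) ^ (h + l) * real (h choose l) * B ^ (h - l) * k a ^ l)"
      proof (rule sum.cong[OF refl])
        fix l assume "l \<in> {..h}"
        then have "(-1 :: real) ^ (h - l) = (-1) ^ (h + l)" by (simp add: minus_one_power_iff)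
        then show "real (h choose l) * k a ^ l * (- B) ^ (h - l) = (-1) ^ (h + l) * real (h choose l) * B ^ (h - l) * k a ^ l"
          unfolding power_minus[of B] by simp
      qed
      finally show ?thesis .
    qed
    then show ?thesis by (simp add: sum_distrib_left sum.swap[of _ "{..h}"])
  qed
  moreover have "(\<Sum>l\<le>h. (-1) ^ (h + l) * real (h choose l) * B ^ (h - l) * (\<Sum>a\<in>?U. k a ^ l)) =
      (\<Sum>l<h. (-1) ^ (h + l) * real (h choose l) * B ^ (h - l) * (\<Sum>a\<in>?U. k a ^ l)) + (\<Sum>a\<in>?U. k a ^ h)"
    by (simp add: lessThan_Suc_atMost[symmetric] mult_2[symmetric])
  moreover have "(\<Sum>l<h. (-1) ^ (h + l + 1) * real (h choose l) * B ^ (h - l) * (\<Sum>a\<in>?U. k a ^ l)) =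
     - (\<Sum>l<h. (-1) ^ (h + l) * real (h choose l) * B ^ (h - l) * (\<Sum>a\<in>?U. k a ^ l))"
    by (simp add: sum_negf[symmetric])
  moreover have "(-1) ^ h * R = (\<Sum>j=0..min (card I) h. (-1) ^ (h + j) * real (C j) *
      (\<Sum>t=j..h. fact t * real (Stirling h t) * 2 ^ (h - t)
         * binom (real (card I) - real j) (int (card I) - int t)))"
    unfolding R_def sum_distrib_left[of "(-1) ^ h"] power_add by (simp only: mult.assoc)
  moreover have "A powi (- int h) = inverse (A ^ h)"
    by (simp add: power_int_minus)
  ultimately show ?thesis by simp
qed

end

section \<open>Counting invertible matrices\<close>

lemma card_eq_sum_fibres:
  assumes "finite S" "finite T" "f ` S \<subseteq> T"
  shows "card S = (\<Sum>c\<in>T. card {x \<in> S. f x = c})"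
  using sum.group[OF assms, of "\<lambda>_. 1::nat"] by simp

lemma index_mult_mat_sum:
  assumes "A \<in> carrier_mat l n" "B \<in> carrier_mat n m" "i < l" "j < m"
  shows "(A * B) $$ (i, j) = (\<Sum>k<n. A $$ (i, k) * B $$ (k, j))"
  using assms by (simp add: scalar_prod_def atLeast0LessThan)

lemma det_neq_0_obtain_inverse:
  assumes "(A :: 'a::field mat) \<in> carrier_mat n n" "det A \<noteq> 0"
  obtains A' where "A' \<in> carrier_mat n n" "A * A' = 1\<^sub>m n" "A' * A = 1\<^sub>m n"
  using det_non_zero_imp_unit[OF assms, of "()"] that
  by (auto simp: Units_def ring_mat_def)

lemma right_inverse_det_neq_0:
  assumes "(A :: 'a::field mat) \<in> carrier_mat n n" "A' \<in> carrier_mat n n" "A * A' = 1\<^sub>m n"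
  shows "det A \<noteq> 0"
proof
  assume "det A = 0"
  then have "det (1\<^sub>m n :: 'a mat) = 0" using det_mult[OF assms(1,2)] assms(3) by simp
  then show False by simp
qed

lemma card_carrier_vec:
  "finite (carrier_vec n :: 'a::finite vec set)" "card (carrier_vec n :: 'a vec set) = CARD('a) ^ n"
proof -
  have bij: "bij_betw (\<lambda>v. restrict (\<lambda>i. v $ i) {..<n}) (carrier_vec n :: 'a vec set) (\<Pi>\<^sub>E i\<in>{..<n}. UNIV)"
  proof (rule bij_betw_byWitness[where f' = "vec n"])
    show "\<forall>v\<in>carrier_vec n. vec n (restrict (\<lambda>i. v $ i) {..<n}) = (v :: 'a vec)"
      by (intro ballI eq_vecI) auto
    show "\<forall>f\<in>\<Pi>\<^sub>E i\<in>{..<n}. (UNIV :: 'a set). restrict (\<lambda>i. vec n f $ i) {..<n} = f"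
      by (auto simp: PiE_def extensional_def restrict_def fun_eq_iff)
    show "(\<lambda>v. restrict (\<lambda>i. v $ i) {..<n}) ` (carrier_vec n :: 'a vec set) \<subseteq> (\<Pi>\<^sub>E i\<in>{..<n}. UNIV)"
      by (intro image_subsetI) (simp add: restrict_PiE_iff)
    show "vec n ` (\<Pi>\<^sub>E i\<in>{..<n}. (UNIV :: 'a set)) \<subseteq> carrier_vec n"
      by (intro image_subsetI) simp
  qed
  show "finite (carrier_vec n :: 'a vec set)" using bij_betw_finite[OF bij] by (simp add: finite_PiE)
  show "card (carrier_vec n :: 'a vec set) = CARD('a) ^ n"
    using bij_betw_same_card[OF bij] by (simp add: card_PiE)
qed

lemma card_carrier_mat:
  "finite (carrier_mat n m :: 'a::finite mat set)" "card (carrier_mat n m :: 'a mat set) = CARD('a) ^ (n * m)"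
proof -
  have bij: "bij_betw (\<lambda>A. restrict (\<lambda>ij. A $$ ij) ({..<n} \<times> {..<m})) (carrier_mat n m :: 'a mat set)
      (\<Pi>\<^sub>E i\<in>{..<n} \<times> {..<m}. UNIV)"
  proof (rule bij_betw_byWitness[where f' = "mat n m"])
    show "\<forall>A\<in>carrier_mat n m. mat n m (restrict (\<lambda>ij. A $$ ij) ({..<n} \<times> {..<m})) = (A :: 'a mat)"
      by (intro ballI eq_matI) auto
    show "\<forall>f\<in>\<Pi>\<^sub>E i\<in>{..<n} \<times> {..<m}. (UNIV :: 'a set). restrict (\<lambda>ij. mat n m f $$ ij) ({..<n} \<times> {..<m}) = f"
      by (auto simp: PiE_def extensional_def restrict_def fun_eq_iff)
    show "(\<lambda>A. restrict (\<lambda>ij. A $$ ij) ({..<n} \<times> {..<m})) ` (carrier_mat n m :: 'a mat set) \<subseteq>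
        (\<Pi>\<^sub>E i\<in>{..<n} \<times> {..<m}. UNIV)"
      by (intro image_subsetI) (simp add: restrict_PiE_iff)
    show "mat n m ` (\<Pi>\<^sub>E i\<in>{..<n} \<times> {..<m}. (UNIV :: 'a set)) \<subseteq> carrier_mat n m"
      by (intro image_subsetI) simp
  qed
  show "finite (carrier_mat n m :: 'a mat set)" using bij_betw_finite[OF bij] by (simp add: finite_PiE)
  show "card (carrier_mat n m :: 'a mat set) = CARD('a) ^ (n * m)"
    using bij_betw_same_card[OF bij] by (simp add: card_PiE card_cartesian_product)
qed

lemma mult_mat_unit_vec:
  "(A :: 'a::semiring_1 mat) \<in> carrier_mat m n \<Longrightarrow> j < n \<Longrightarrow> A *\<^sub>v unit_vec n j = col A j"
  by (intro eq_vecI) auto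

definition nonsing :: "nat \<Rightarrow> 'a::field mat set" where
  "nonsing n = {A \<in> carrier_mat n n. det A \<noteq> 0}"

lemma finite_nonsing: "finite (nonsing n :: 'a::{field,finite} mat set)"
  by (rule finite_subset[OF _ card_carrier_mat(1)]) (auto simp: nonsing_def)

lemma exists_nonsing_with_first_col:
  assumes c: "(c :: 'a::field vec) \<in> carrier_vec n" "c \<noteq> 0\<^sub>v n"
  obtains g where "g \<in> nonsing n" "col g 0 = c"
proof -
  obtain k where k: "k < n" "c $ k \<noteq> 0" using c by (metis carrier_vecD eq_vecI index_zero_vec)
  then have n: "0 < n" by simp
  \<comment> \<open>Basis exchange: \<open>c\<close> can replace the unit vector e_k because its
    entry at k is nonzero. \<open>c\<close> occupies column 0, and e_0, pushed out of there, moves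
    to column k.\<close>
  define \<sigma> where "\<sigma> j = (if j = k then 0 else j)" for j :: nat
  define g where "g = mat n n (\<lambda>(i, j). if j = 0 then c $ i else of_bool (i = \<sigma> j))"
  have car: "g \<in> carrier_mat n n" by (simp add: g_def)
  have "det g \<noteq> 0"
  proof
    assume "det g = 0"
    then have "det (g\<^sup>T) = 0" using det_transpose[OF car] by simp
    then obtain v where v: "v \<in> carrier_vec n" "v \<noteq> 0\<^sub>v n" "g\<^sup>T *\<^sub>v v = 0\<^sub>v n"
      using det_0_iff_vec_prod_zero_field[of "g\<^sup>T" n] car by auto
    have eq: "(\<Sum>i<n. g $$ (i, j) * v $ i) = 0" if "j < n" for j
    proof -
      have "(g\<^sup>T *\<^sub>v v) $ j = (\<Sum>i<n. g $$ (i, j) * v $ i)"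
        using that v(1) car by (simp add: scalar_prod_def atLeast0LessThan)
      then show ?thesis using v(3) that by simp
    qed
    have v0: "v $ \<sigma> j = 0" if "0 < j" "j < n" for j
    proof -
      have "\<sigma> j < n" using that by (auto simp: \<sigma>_def)
      have "(\<Sum>i<n. g $$ (i, j) * v $ i) = (\<Sum>i<n. if i = \<sigma> j then v $ i else 0)"
        using that by (intro sum.cong) (auto simp: g_def)
      then show ?thesis using eq[OF that(2)] \<open>\<sigma> j < n\<close> by simp
    qed
    have v0': "v $ i = 0" if "i < n" "i \<noteq> k" for i
    proof (cases "i = 0")
      case True
      then show ?thesis using v0[of k] that k by (simp add: \<sigma>_def)
    next
      case False
      then show ?thesis using v0[of i] that by (simp add: \<sigma>_def)
    qed
    have "(\<Sum>i<n. g $$ (i, 0) * v $ i) = (\<Sum>i<n. if i = k then c $ k * v $ k else 0)"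
      using n v0' by (intro sum.cong) (auto simp: g_def)
    then have "c $ k * v $ k = 0" using eq[OF n] k(1) by simp
    then have "v $ i = 0" if "i < n" for i using that k(2) v0' by (cases "i = k") auto
    then have "v = 0\<^sub>v n" using v(1) by (intro eq_vecI) auto
    with v(2) show False by simp
  qed
  moreover have "col g 0 = c" using c(1) n by (intro eq_vecI) (auto simp: g_def)
  ultimately show ?thesis using that car by (simp add: nonsing_def)
qed

lemma col_nonsing_neq_0:
  assumes "A \<in> nonsing n" "0 < n"
  shows "col A 0 \<in> carrier_vec n" "col A 0 \<noteq> 0\<^sub>v n"
proof -
  have A: "A \<in> carrier_mat n n" "det A \<noteq> 0" using assms(1) by (auto simp: nonsing_def)
  show "col A 0 \<in> carrier_vec n" using A(1) by auto
  show "col A 0 \<noteq> 0\<^sub>v n"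
  proof
    assume "col A 0 = 0\<^sub>v n"
    then have "A $$ (i, 0) = 0" if "i < n" for i
      using that A(1) assms(2) by (metis carrier_matD index_col index_zero_vec(1))
    then have "det A = 0" using laplace_expansion_column[OF A(1) assms(2)] by simp
    with A(2) show False by simp
  qed
qed

text \<open>Left multiplication by an invertible matrix with first column \<open>c\<close> carries
  the first column e_0 to \<open>c\<close>, so all nonzero first columns are equally
  frequent.\<close>

lemma card_nonsing_with_first_col:
  assumes c: "(c :: 'a::{field,finite} vec) \<in> carrier_vec n" "c \<noteq> 0\<^sub>v n"
  shows "card {A \<in> nonsing n. col A 0 = c} = card {A \<in> nonsing n. col A 0 = (unit_vec n 0 :: 'a vec)}"
proof -
  have n: "0 < n"
  proof (rule ccontr)
    assume "\<not> 0 < n"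
    then have "c = 0\<^sub>v n" using c(1) by (intro eq_vecI) auto
    with c(2) show False by simp
  qed
  obtain g where g: "g \<in> nonsing n" "col g 0 = c" using exists_nonsing_with_first_col[OF c] .
  then have gc: "g \<in> carrier_mat n n" "det g \<noteq> 0" by (auto simp: nonsing_def)
  obtain g' where g': "g' \<in> carrier_mat n n" "g * g' = 1\<^sub>m n" "g' * g = 1\<^sub>m n"
    using det_neq_0_obtain_inverse[OF gc] .
  have dg': "det g' \<noteq> 0" using right_inverse_det_neq_0[OF g'(1) gc(1) g'(3)] .
  have gu: "g *\<^sub>v unit_vec n 0 = c"
    using g(2) mult_mat_unit_vec[OF gc(1) n] by simp
  have g'c: "g' *\<^sub>v c = unit_vec n 0"
  proof -
    have "g' *\<^sub>v c = (g' * g) *\<^sub>v unit_vec n 0"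
      unfolding gu[symmetric] by (rule assoc_mult_mat_vec[OF g'(1) gc(1), symmetric]) simp
    then show ?thesis using g'(3) by simp
  qed
  have "bij_betw ((*) g) {A \<in> nonsing n. col A 0 = unit_vec n 0} {A \<in> nonsing n. col A 0 = c}"
  proof (rule bij_betw_byWitness[where f' = "(*) g'"])
    show "\<forall>A\<in>{A \<in> nonsing n. col A 0 = unit_vec n 0}. g' * (g * A) = A"
      using gc(1) g' by (auto simp: nonsing_def assoc_mult_mat[symmetric])
    show "\<forall>A\<in>{A \<in> nonsing n. col A 0 = c}. g * (g' * A) = A"
      using gc(1) g' by (auto simp: nonsing_def assoc_mult_mat[symmetric])
    show "(*) g ` {A \<in> nonsing n. col A 0 = unit_vec n 0} \<subseteq> {A \<in> nonsing n. col A 0 = c}"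
      using gc gu n by (auto simp: nonsing_def det_mult col_mult2)
    show "(*) g' ` {A \<in> nonsing n. col A 0 = c} \<subseteq> {A \<in> nonsing n. col A 0 = unit_vec n 0}"
      using g' dg' g'c n by (auto simp: nonsing_def det_mult col_mult2)
  qed
  then show ?thesis by (rule bij_betw_same_card[symmetric])
qed

lemma det_first_col:
  assumes A: "(A :: 'a::comm_ring_1 mat) \<in> carrier_mat (Suc n) (Suc n)"
    and "\<And>i. 0 < i \<Longrightarrow> i \<le> n \<Longrightarrow> A $$ (i, 0) = 0"
  shows "det A = A $$ (0, 0) * det (mat_delete A 0 0)"
proof -
  have "det A = (\<Sum>i<Suc n. A $$ (i, 0) * cofactor A i 0)"
    using laplace_expansion_column[OF A, of 0] by simp
  also have "\<dots> = A $$ (0, 0) * cofactor A 0 0"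
    using assms(2) by (subst sum.lessThan_Suc_shift) simp
  finally show ?thesis by (simp add: cofactor_def)
qed

text \<open>All nonzero first columns occur equally often. With first column e_0 the rest of row 0
  is arbitrary and the complementary minor has to be invertible.\<close>

lemma card_nonsing_Suc:
  "card (nonsing (Suc n) :: 'a::{field,finite} mat set) =
    (CARD('a) ^ Suc n - 1) * (CARD('a) ^ n * card (nonsing n :: 'a mat set))"
proof -
  let ?N = "Suc n"
  let ?U = "{A \<in> nonsing ?N. col A 0 = (unit_vec ?N 0 :: 'a vec)}"
  define F where "F = (\<lambda>(w :: 'a vec, M). mat ?N ?N (\<lambda>(i, j).
    if j = 0 then of_bool (i = 0) else if i = 0 then w $ (j - 1) else M $$ (i - 1, j - 1)))"
  have F_car: "F x \<in> carrier_mat ?N ?N" for x by (simp add: F_def split: prod.splits)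
  have del: "mat_delete (F (w, M)) 0 0 = M" if "M \<in> carrier_mat n n" for w M
    using that by (intro eq_matI) (auto simp: mat_delete_def F_def)
  have det: "det (F (w, M)) = det M" if "M \<in> carrier_mat n n" for w :: "'a vec" and M
    using det_first_col[OF F_car[of "(w, M)"]] del[OF that] by (simp add: F_def)
  have "bij_betw F ((carrier_vec n :: 'a vec set) \<times> (nonsing n :: 'a mat set)) ?U"
  proof (rule bij_betw_byWitness[where f' = "\<lambda>A. (vec n (\<lambda>j. A $$ (0, Suc j)), mat_delete A 0 0)"])
    show "\<forall>x\<in>(carrier_vec n :: 'a vec set) \<times> (nonsing n :: 'a mat set). (vec n (\<lambda>j. F x $$ (0, Suc j)), mat_delete (F x) 0 0) = x"
      using del by (auto simp: nonsing_def F_def intro!: eq_vecI)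
    have inv: "F (vec n (\<lambda>j. A $$ (0, Suc j)), mat_delete A 0 0) = A" if "A \<in> ?U" for A
    proof (rule eq_matI)
      have A: "A \<in> carrier_mat ?N ?N" and c: "col A 0 = unit_vec ?N 0" using that by (auto simp: nonsing_def)
      fix i j assume ij: "i < dim_row A" "j < dim_col A"
      have "A $$ (i, 0) = col A 0 $ i" using ij A by simp
      then have "A $$ (i, 0) = of_bool (i = 0)" unfolding c using ij A by simp
      then show "F (vec n (\<lambda>j. A $$ (0, Suc j)), mat_delete A 0 0) $$ (i, j) = A $$ (i, j)"
        using ij A by (auto simp: F_def mat_delete_def)
    qed (use that in \<open>auto simp: nonsing_def F_def\<close>)
    then show "\<forall>A\<in>?U. F (vec n (\<lambda>j. A $$ (0, Suc j)), mat_delete A 0 0) = A" by blast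
    show "F ` ((carrier_vec n :: 'a vec set) \<times> (nonsing n :: 'a mat set)) \<subseteq> ?U"
    proof (rule image_subsetI)
      fix x assume "x \<in> (carrier_vec n :: 'a vec set) \<times> (nonsing n :: 'a mat set)"
      then obtain w M where x: "x = (w, M)" "M \<in> carrier_mat n n" "det M \<noteq> 0" by (auto simp: nonsing_def)
      have "col (F x) 0 = unit_vec ?N 0" unfolding x by (intro eq_vecI) (auto simp: F_def)
      then show "F x \<in> ?U" using F_car[of x] det[of M w] x by (simp add: nonsing_def)
    qed
    show "(\<lambda>A. (vec n (\<lambda>j. A $$ (0, Suc j)), mat_delete A 0 0)) ` ?U \<subseteq> (carrier_vec n :: 'a vec set) \<times> (nonsing n :: 'a mat set)"
    proof (rule image_subsetI)
      fix A assume A: "A \<in> ?U"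
      have M: "mat_delete A 0 0 \<in> carrier_mat n n"
        using A mat_delete_carrier[of A ?N ?N 0 0] by (auto simp: nonsing_def)
      then have "det (mat_delete A 0 0) = det A" using det[of "mat_delete A 0 0"] inv[OF A] by metis
      then show "(vec n (\<lambda>j. A $$ (0, Suc j)), mat_delete A 0 0) \<in> (carrier_vec n :: 'a vec set) \<times> (nonsing n :: 'a mat set)"
        using A M by (simp add: nonsing_def)
    qed
  qed
  then have "card ?U = card ((carrier_vec n :: 'a vec set) \<times> (nonsing n :: 'a mat set))" by (rule bij_betw_same_card[symmetric])
  also have "\<dots> = CARD('a) ^ n * card (nonsing n :: 'a mat set)"
    by (simp add: card_cartesian_product card_carrier_vec)
  finally have U: "card ?U = CARD('a) ^ n * card (nonsing n :: 'a mat set)" .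
  have "card (nonsing ?N :: 'a mat set) = (\<Sum>c\<in>carrier_vec ?N - {0\<^sub>v ?N}. card {A \<in> nonsing ?N. col A 0 = (c :: 'a vec)})"
    using col_nonsing_neq_0 by (intro card_eq_sum_fibres) (auto simp: finite_nonsing card_carrier_vec)
  also have "\<dots> = (\<Sum>c\<in>carrier_vec ?N - {0\<^sub>v ?N :: 'a vec}. card ?U)"
    by (rule sum.cong[OF refl], rule card_nonsing_with_first_col) auto
  also have "\<dots> = (CARD('a) ^ ?N - 1) * card ?U"
    by (simp add: card_Diff_subset card_carrier_vec)
  finally show ?thesis by (simp only: U)
qed

lemma nonsing_0: "nonsing 0 = {1\<^sub>m 0 :: 'a::field mat}"
  by (auto simp: nonsing_def)

section \<open>Counting invertible symmetric matrices\<close>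

definition sym_nonsing :: "nat \<Rightarrow> 'a::field mat set" where
  "sym_nonsing n = {A \<in> nonsing n. A\<^sup>T = A}"

lemma sym_nonsing_carrier: "A \<in> sym_nonsing n \<Longrightarrow> A \<in> carrier_mat n n"
  by (simp add: sym_nonsing_def nonsing_def)

lemma sym_nonsing_det: "A \<in> sym_nonsing n \<Longrightarrow> det A \<noteq> 0"
  by (simp add: sym_nonsing_def nonsing_def)

lemma sym_nonsing_index: "A \<in> sym_nonsing n \<Longrightarrow> i < n \<Longrightarrow> j < n \<Longrightarrow> A $$ (i, j) = A $$ (j, i)"
  unfolding sym_nonsing_def nonsing_def by (metis (mono_tags, lifting) carrier_matD index_transpose_mat(1) mem_Collect_eq)

lemma sym_nonsingI:
  assumes "A \<in> carrier_mat n n" "det A \<noteq> 0" "\<And>i j. i < n \<Longrightarrow> j < n \<Longrightarrow> A $$ (i, j) = A $$ (j, i)"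
  shows "A \<in> sym_nonsing n"
proof -
  have "A\<^sup>T = A" using assms(1,3) by (intro eq_matI) auto
  then show ?thesis using assms(1,2) by (simp add: sym_nonsing_def nonsing_def)
qed

lemma finite_sym_nonsing: "finite (sym_nonsing n :: 'a::{field,finite} mat set)"
  by (rule finite_subset[OF _ finite_nonsing]) (auto simp: sym_nonsing_def)

text \<open>A congruence by h acts on the first column as h itself does, provided that the transpose
  of h fixes e_0; the condition on row 0 secures this.\<close>

lemma congruence_sym_nonsing:
  assumes h: "h \<in> nonsing n" "row h 0 = unit_vec n 0" "0 < n" and A: "A \<in> sym_nonsing n" "col A 0 = c"
  shows "h * A * h\<^sup>T \<in> sym_nonsing n" "col (h * A * h\<^sup>T) 0 = h *\<^sub>v c"
proof -
  have hc: "h \<in> carrier_mat n n" "h\<^sup>T \<in> carrier_mat n n" "det h \<noteq> 0" using h(1) by (auto simp: nonsing_def)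
  have Ac: "A \<in> carrier_mat n n" "det A \<noteq> 0" "A\<^sup>T = A" using A(1) by (auto simp: sym_nonsing_def nonsing_def)
  have hA: "h * A \<in> carrier_mat n n" using hc Ac by simp
  have "(h * A * h\<^sup>T)\<^sup>T = h * (h * A)\<^sup>T"
    using transpose_mult[OF hA hc(2)] by simp
  also have "\<dots> = h * (A * h\<^sup>T)" using transpose_mult[OF hc(1) Ac(1)] Ac(3) by simp
  also have "\<dots> = h * A * h\<^sup>T" using assoc_mult_mat[OF hc(1) Ac(1) hc(2)] by simp
  finally have "(h * A * h\<^sup>T)\<^sup>T = h * A * h\<^sup>T" .
  moreover have "det (h * A * h\<^sup>T) = det h * det A * det h"
    using det_mult[OF hA hc(2)] det_mult[OF hc(1) Ac(1)] det_transpose[OF hc(1)] by simp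
  ultimately show "h * A * h\<^sup>T \<in> sym_nonsing n"
    using hA hc Ac by (simp add: sym_nonsing_def nonsing_def)
  have "col (h * A * h\<^sup>T) 0 = (h * A) *\<^sub>v col (h\<^sup>T) 0" using hA hc(2) h(3) by (rule col_mult2)
  also have "col (h\<^sup>T) 0 = unit_vec n 0" using hc(1) h(2,3) by simp
  also have "(h * A) *\<^sub>v unit_vec n 0 = col (h * A) 0" using hA h(3) by (rule mult_mat_unit_vec)
  also have "\<dots> = h *\<^sub>v c" using col_mult2[OF hc(1) Ac(1) h(3)] A(2) by simp
  finally show "col (h * A * h\<^sup>T) 0 = h *\<^sub>v c" .
qed

lemma card_sym_nonsing_congruence:
  assumes g: "(g :: 'a::{field,finite} mat) \<in> nonsing n" "row g 0 = unit_vec n 0" "0 < n"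
    and c: "c \<in> carrier_vec n"
  shows "card {A \<in> sym_nonsing n. col A 0 = g *\<^sub>v c} = card {A \<in> sym_nonsing n. col A 0 = c}"
proof -
  have gc: "g \<in> carrier_mat n n" "det g \<noteq> 0" using g(1) by (auto simp: nonsing_def)
  obtain g' where g': "g' \<in> carrier_mat n n" "g * g' = 1\<^sub>m n" "g' * g = 1\<^sub>m n"
    using det_neq_0_obtain_inverse[OF gc] .
  have ns': "g' \<in> nonsing n"
    using right_inverse_det_neq_0[OF g'(1) gc(1) g'(3)] g'(1) by (simp add: nonsing_def)
  have row': "row g' 0 = unit_vec n 0"
  proof (rule eq_vecI)
    fix j assume j: "j < dim_vec (unit_vec n 0 :: 'a vec)"
    have "(g * g') $$ (0, j) = row g 0 \<bullet> col g' j" using gc(1) g'(1) g(3) j by simp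
    also have "\<dots> = g' $$ (0, j)" using g(2,3) g'(1) j by simp
    finally have "g' $$ (0, j) = (1\<^sub>m n :: 'a mat) $$ (0, j)" by (simp only: g'(2))
    then show "row g' 0 $ j = unit_vec n 0 $ j" using g'(1) g(3) j by simp
  qed (use g'(1) in simp)
  have g'gc: "g' *\<^sub>v (g *\<^sub>v c) = c"
    using assoc_mult_mat_vec[OF g'(1) gc(1) c] g'(3) c by simp
  have conj: "x * (y * A * y\<^sup>T) * x\<^sup>T = A"
    if "x \<in> carrier_mat n n" "y \<in> carrier_mat n n" "A \<in> carrier_mat n n" "x * y = 1\<^sub>m n" for x y A :: "'a mat"
  proof -
    have "y\<^sup>T * x\<^sup>T = 1\<^sub>m n" using transpose_mult[OF that(1,2)] that(4) by simp
    moreover have "x * (y * A * y\<^sup>T) * x\<^sup>T = (x * y) * A * (y\<^sup>T * x\<^sup>T)"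
      using that(1-3) by (simp add: assoc_mult_mat[of _ n n _ n _ n])
    ultimately show ?thesis using that by simp
  qed
  have "bij_betw (\<lambda>A. g * A * g\<^sup>T) {A \<in> sym_nonsing n. col A 0 = c} {A \<in> sym_nonsing n. col A 0 = g *\<^sub>v c}"
  proof (rule bij_betw_byWitness[where f' = "\<lambda>A. g' * A * g'\<^sup>T"])
    show "\<forall>A\<in>{A \<in> sym_nonsing n. col A 0 = c}. g' * (g * A * g\<^sup>T) * g'\<^sup>T = A"
      using conj gc(1) g' sym_nonsing_carrier by blast
    show "\<forall>A\<in>{A \<in> sym_nonsing n. col A 0 = g *\<^sub>v c}. g * (g' * A * g'\<^sup>T) * g\<^sup>T = A"
      using conj gc(1) g' sym_nonsing_carrier by blast
    show "(\<lambda>A. g * A * g\<^sup>T) ` {A \<in> sym_nonsing n. col A 0 = c} \<subseteq> {A \<in> sym_nonsing n. col A 0 = g *\<^sub>v c}"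
      using congruence_sym_nonsing[OF g] by blast
    show "(\<lambda>A. g' * A * g'\<^sup>T) ` {A \<in> sym_nonsing n. col A 0 = g *\<^sub>v c} \<subseteq> {A \<in> sym_nonsing n. col A 0 = c}"
    proof (rule image_subsetI)
      fix A assume "A \<in> {A \<in> sym_nonsing n. col A 0 = g *\<^sub>v c}"
      then show "g' * A * g'\<^sup>T \<in> {A \<in> sym_nonsing n. col A 0 = c}"
        using congruence_sym_nonsing[OF ns' row' g(3), of A "g *\<^sub>v c"] g'gc by simp
    qed
  qed
  then show ?thesis by (rule bij_betw_same_card[symmetric])
qed

section \<open>Symmetric matrices with a prescribed first column\<close>

lemma card_sym_nonsing_diag:
  assumes "(\<alpha> :: 'a::{field,finite}) \<noteq> 0"
  shows "card {A \<in> sym_nonsing (Suc n). col A 0 = \<alpha> \<cdot>\<^sub>v unit_vec (Suc n) 0} = card (sym_nonsing n :: 'a mat set)"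
proof -
  let ?N = "Suc n"
  let ?S = "{A \<in> sym_nonsing ?N. col A 0 = \<alpha> \<cdot>\<^sub>v unit_vec ?N 0}"
  define F where "F = (\<lambda>M :: 'a mat. mat ?N ?N (\<lambda>(i, j).
    if i = 0 \<and> j = 0 then \<alpha> else if i = 0 \<or> j = 0 then 0 else M $$ (i - 1, j - 1)))"
  have F_car: "F M \<in> carrier_mat ?N ?N" for M by (simp add: F_def)
  have del: "mat_delete (F M) 0 0 = M" if "M \<in> carrier_mat n n" for M
    using that by (intro eq_matI) (auto simp: mat_delete_def F_def)
  have det: "det (F M) = \<alpha> * det M" if "M \<in> carrier_mat n n" for M
    using det_first_col[OF F_car[of M]] del[OF that] by (simp add: F_def)
  have inv: "F (mat_delete A 0 0) = A" if "A \<in> ?S" for A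
  proof (rule eq_matI)
    have A: "A \<in> sym_nonsing ?N" "A \<in> carrier_mat ?N ?N" and c: "col A 0 = \<alpha> \<cdot>\<^sub>v unit_vec ?N 0"
      using that sym_nonsing_carrier by auto
    have c': "A $$ (i, 0) = (if i = 0 then \<alpha> else 0)" if "i < ?N" for i
    proof -
      have "A $$ (i, 0) = col A 0 $ i" using A(2) that by simp
      then show ?thesis unfolding c using that by simp
    qed
    fix i j assume ij: "i < dim_row A" "j < dim_col A"
    then have "A $$ (0, j) = A $$ (j, 0)" using sym_nonsing_index[OF A(1)] A(2) by simp
    then show "F (mat_delete A 0 0) $$ (i, j) = A $$ (i, j)"
      using ij A(2) c'[of i] c'[of j] by (auto simp: F_def mat_delete_def)
  qed (use that sym_nonsing_carrier[of A ?N] in \<open>auto simp: F_def\<close>)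
  have "bij_betw F (sym_nonsing n) ?S"
  proof (rule bij_betw_byWitness[where f' = "\<lambda>A. mat_delete A 0 0"])
    show "\<forall>M\<in>sym_nonsing n. mat_delete (F M) 0 0 = M" using del sym_nonsing_carrier by blast
    show "\<forall>A\<in>?S. F (mat_delete A 0 0) = A" using inv by blast
    show "F ` sym_nonsing n \<subseteq> ?S"
    proof (rule image_subsetI)
      fix M assume M: "M \<in> (sym_nonsing n :: 'a mat set)"
      have "F M \<in> sym_nonsing ?N"
      proof (rule sym_nonsingI[OF F_car])
        show "det (F M) \<noteq> 0" using det[OF sym_nonsing_carrier[OF M]] sym_nonsing_det[OF M] assms by simp
        show "F M $$ (i, j) = F M $$ (j, i)" if "i < ?N" "j < ?N" for i j
          using that sym_nonsing_index[OF M, of "i - 1" "j - 1"] by (auto simp: F_def)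
      qed
      moreover have "col (F M) 0 = \<alpha> \<cdot>\<^sub>v unit_vec ?N 0" by (intro eq_vecI) (auto simp: F_def)
      ultimately show "F M \<in> ?S" by simp
    qed
    show "(\<lambda>A. mat_delete A 0 0) ` ?S \<subseteq> sym_nonsing n"
    proof (rule image_subsetI)
      fix A assume A: "A \<in> ?S"
      then have A': "A \<in> sym_nonsing ?N" "A \<in> carrier_mat ?N ?N" using sym_nonsing_carrier by auto
      have car: "mat_delete A 0 0 \<in> carrier_mat n n" using mat_delete_carrier[OF A'(2), of 0 0] by simp
      show "mat_delete A 0 0 \<in> sym_nonsing n"
      proof (rule sym_nonsingI[OF car])
        show "det (mat_delete A 0 0) \<noteq> 0" using det[OF car] inv[OF A] sym_nonsing_det[OF A'(1)] by auto
        show "mat_delete A 0 0 $$ (i, j) = mat_delete A 0 0 $$ (j, i)" if "i < n" "j < n" for i j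
          using that A'(2) sym_nonsing_index[OF A'(1), of "Suc i" "Suc j"] by (simp add: mat_delete_def)
      qed
    qed
  qed
  then show ?thesis by (rule bij_betw_same_card[symmetric])
qed

text \<open>Dividing \<open>c\<close> by its first entry gives a unipotent lower triangular matrix
  that maps c_0 e_0 to \<open>c\<close>; congruence by it reduces to a matrix from which the scalar
  c_0 splits off.\<close>

lemma card_sym_nonsing_first_col_nonzero:
  assumes c: "(c :: 'a::{field,finite} vec) \<in> carrier_vec (Suc n)" "c $ 0 \<noteq> 0"
  shows "card {A \<in> sym_nonsing (Suc n). col A 0 = c} = card (sym_nonsing n :: 'a mat set)"
proof -
  let ?N = "Suc n"
  define g where "g = mat ?N ?N (\<lambda>(i, j). if j = 0 then c $ i / c $ 0 else of_bool (i = j))"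
  have car: "g \<in> carrier_mat ?N ?N" by (simp add: g_def)
  have "det g = prod_list (diag_mat g)"
    by (rule det_lower_triangular[OF _ car]) (auto simp: g_def)
  also have "\<dots> = 1"
    unfolding prod_list_diag_prod using c(2) by (intro prod.neutral) (auto simp: g_def)
  finally have "g \<in> nonsing ?N" using car by (simp add: nonsing_def)
  moreover have "row g 0 = unit_vec ?N 0"
    using c(2) by (intro eq_vecI) (auto simp: g_def)
  moreover have "g *\<^sub>v (c $ 0 \<cdot>\<^sub>v unit_vec ?N 0) = c"
  proof -
    have "g *\<^sub>v (c $ 0 \<cdot>\<^sub>v unit_vec ?N 0) = c $ 0 \<cdot>\<^sub>v (g *\<^sub>v unit_vec ?N 0)"
      by (rule mult_mat_vec[OF car]) simp
    also have "g *\<^sub>v unit_vec ?N 0 = col g 0" by (rule mult_mat_unit_vec[OF car]) simp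
    also have "c $ 0 \<cdot>\<^sub>v col g 0 = c" using c by (intro eq_vecI) (auto simp: g_def)
    finally show ?thesis .
  qed
  ultimately show ?thesis
    using card_sym_nonsing_congruence[of g ?N "c $ 0 \<cdot>\<^sub>v unit_vec ?N 0"] card_sym_nonsing_diag[OF c(2), of n] by simp
qed

text \<open>The upper left corner is the block with rows (0, 1) and (1, b), which is invertible for
  every b. Expansion along the first row and column leaves the determinant \<open>- det M\<close>,
  so b and the row \<open>w\<close> are free.\<close>

lemma card_sym_nonsing_hyperbolic:
  "card {A \<in> sym_nonsing (Suc (Suc n)). col A 0 = (unit_vec (Suc (Suc n)) 1 :: 'a::{field,finite} vec)} =
    CARD('a) ^ Suc n * card (sym_nonsing n :: 'a mat set)"
proof -
  let ?N = "Suc (Suc n)"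
  let ?S = "{A \<in> sym_nonsing ?N. col A 0 = (unit_vec ?N 1 :: 'a vec)}"
  let ?D = "(UNIV :: 'a set) \<times> (carrier_vec n :: 'a vec set) \<times> (sym_nonsing n :: 'a mat set)"
  define f where "f b w M i j =
     (if i = 0 then of_bool (j = 1) else if j = 0 then of_bool (i = 1)
      else if i = 1 then (if j = 1 then b else w $ (j - 2))
      else if j = 1 then w $ (i - 2) else M $$ (i - 2, j - 2))"
    for b :: 'a and w :: "'a vec" and M :: "'a mat" and i j :: nat
  define F where "F = (\<lambda>(b, w, M). mat ?N ?N (\<lambda>(i, j). f b w M i j))"
  define R where "R = (\<lambda>A :: 'a mat. (A $$ (1, 1), vec n (\<lambda>j. A $$ (1, j + 2)), mat n n (\<lambda>(i, j). A $$ (i + 2, j + 2))))"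
  have F_car: "F x \<in> carrier_mat ?N ?N" for x by (simp add: F_def split: prod.splits)
  have RF: "R (F (b, w, M)) = (b, w, M)" if "w \<in> carrier_vec n" "M \<in> carrier_mat n n" for b w M
    using that by (auto simp: R_def F_def f_def intro!: eq_vecI eq_matI)
  have det: "det (F (b, w, M)) = - det M" if M: "M \<in> carrier_mat n n" for b w M
  proof -
    let ?A = "F (b, w, M)"
    let ?B = "mat_delete ?A 1 0"
    have A: "?A \<in> carrier_mat ?N ?N" by (rule F_car)
    have B: "?B \<in> carrier_mat (Suc n) (Suc n)" using mat_delete_carrier[OF A, of 1 0] by simp
    have "det ?A = (\<Sum>i<?N. ?A $$ (i, 0) * cofactor ?A i 0)"
      using laplace_expansion_column[OF A, of 0] by simp
    also have "\<dots> = (\<Sum>i<?N. if i = 1 then cofactor ?A 1 0 else 0)"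
      by (intro sum.cong) (auto simp: F_def f_def)
    also have "\<dots> = - det ?B" by (simp add: cofactor_def)
    also have "det ?B = (\<Sum>j<Suc n. ?B $$ (0, j) * cofactor ?B 0 j)"
      using laplace_expansion_row[OF B, of 0] by simp
    also have "\<dots> = (\<Sum>j<Suc n. if j = 0 then cofactor ?B 0 0 else 0)"
      by (intro sum.cong) (auto simp: F_def f_def mat_delete_def)
    also have "\<dots> = det (mat_delete ?B 0 0)" by (simp add: cofactor_def)
    also have "mat_delete ?B 0 0 = M"
      using M by (intro eq_matI) (auto simp: F_def f_def mat_delete_def)
    finally show ?thesis .
  qed
  have FR: "F (R A) = A" if "A \<in> ?S" for A
  proof (rule eq_matI)
    have A: "A \<in> sym_nonsing ?N" "A \<in> carrier_mat ?N ?N" and c: "col A 0 = unit_vec ?N 1"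
      using that sym_nonsing_carrier by auto
    have c': "A $$ (i, 0) = of_bool (i = 1)" if "i < ?N" for i
    proof -
      have "A $$ (i, 0) = col A 0 $ i" using A(2) that by simp
      then show ?thesis unfolding c using that by simp
    qed
    fix i j assume "i < dim_row A" "j < dim_col A"
    then have ij: "i < ?N" "j < ?N" using A(2) by auto
    have sym: "A $$ (0, j) = A $$ (j, 0)" "A $$ (1, i) = A $$ (i, 1)" using sym_nonsing_index[OF A(1)] ij by auto
    have shift: "Suc (Suc (k - 2)) = k" if "k \<noteq> 0" "k \<noteq> 1" for k
      using that by simp
    consider "i = 0" | "j = 0" | "i = 1" "j \<noteq> 0" | "j = 1" "i \<noteq> 0" "i \<noteq> 1" | "i \<noteq> 0" "i \<noteq> 1" "j \<noteq> 0" "j \<noteq> 1"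
      by blast
    then show "F (R A) $$ (i, j) = A $$ (i, j)"
    proof cases
      case 5
      then show ?thesis using ij shift[of i] shift[of j] by (simp add: F_def R_def f_def)
    next
      case 4
      then show ?thesis using ij sym shift[of i] by (simp add: F_def R_def f_def)
    next
      case 3
      then show ?thesis using ij shift[of j] by (cases "j = 1") (simp_all add: F_def R_def f_def)
    qed (use ij c' sym in \<open>auto simp: F_def R_def f_def\<close>)
  qed (use that sym_nonsing_carrier[of A ?N] in \<open>auto simp: F_def R_def\<close>)
  have "bij_betw F ?D ?S"
  proof (rule bij_betw_byWitness[where f' = R])
    show "\<forall>x\<in>?D. R (F x) = x"
    proof (rule ballI)
      fix x assume "x \<in> ?D"
      then obtain b w M where x: "x = (b, w, M)" "w \<in> carrier_vec n" "M \<in> sym_nonsing n" by auto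
      show "R (F x) = x" unfolding x(1) by (rule RF[OF x(2) sym_nonsing_carrier[OF x(3)]])
    qed
    show "\<forall>A\<in>?S. F (R A) = A" using FR by blast
    show "F ` ?D \<subseteq> ?S"
    proof (rule image_subsetI)
      fix x assume "x \<in> ?D"
      then obtain b w M where x: "x = (b, w, M)" "M \<in> sym_nonsing n" by auto
      have "F x \<in> sym_nonsing ?N"
      proof (rule sym_nonsingI[OF F_car])
        show "det (F x) \<noteq> 0" using det[OF sym_nonsing_carrier[OF x(2)]] sym_nonsing_det[OF x(2)] x(1) by simp
        show "F x $$ (i, j) = F x $$ (j, i)" if "i < ?N" "j < ?N" for i j
          using that sym_nonsing_index[OF x(2), of "i - 2" "j - 2"] unfolding x(1) by (auto simp: F_def f_def)
      qed
      moreover have "col (F x) 0 = unit_vec ?N 1" unfolding x(1) by (intro eq_vecI) (auto simp: F_def f_def)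
      ultimately show "F x \<in> ?S" by simp
    qed
    show "R ` ?S \<subseteq> ?D"
    proof (rule image_subsetI)
      fix A assume A: "A \<in> ?S"
      then have A': "A \<in> sym_nonsing ?N" by simp
      let ?M = "mat n n (\<lambda>(i, j). A $$ (i + 2, j + 2))"
      have "?M \<in> sym_nonsing n"
      proof (rule sym_nonsingI)
        have "det (F (R A)) = - det ?M" unfolding R_def by (rule det) simp
        then have "det A = - det ?M" by (simp only: FR[OF A])
        then show "det ?M \<noteq> 0" using sym_nonsing_det[OF A'] by auto
        show "?M $$ (i, j) = ?M $$ (j, i)" if "i < n" "j < n" for i j
          using that sym_nonsing_index[OF A', of "i + 2" "j + 2"] by simp
      qed simp
      then show "R A \<in> ?D" by (simp add: R_def)
    qed
  qed
  then have "card ?S = card ?D" by (rule bij_betw_same_card[symmetric])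
  then show ?thesis by (simp add: card_cartesian_product card_carrier_vec)
qed

text \<open>A nonzero first column that starts with 0 is the image of e_1 under a block diagonal
  matrix with blocks 1 and h, whose row 0 is e_0 as the congruence requires.\<close>

lemma card_sym_nonsing_first_col_isotropic:
  assumes c: "(c :: 'a::{field,finite} vec) \<in> carrier_vec (Suc (Suc n))" "c $ 0 = 0" "c \<noteq> 0\<^sub>v (Suc (Suc n))"
  shows "card {A \<in> sym_nonsing (Suc (Suc n)). col A 0 = c} = CARD('a) ^ Suc n * card (sym_nonsing n :: 'a mat set)"
proof -
  let ?m = "Suc n" and ?N = "Suc (Suc n)"
  define v where "v = vec ?m (\<lambda>i. c $ Suc i)"
  have "v \<noteq> 0\<^sub>v ?m"
  proof
    assume v0: "v = 0\<^sub>v ?m"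
    have "c $ i = 0" if "i < ?N" for i
    proof (cases i)
      case (Suc k)
      then have "c $ i = v $ k" using that by (simp add: v_def)
      then show ?thesis unfolding v0 using that Suc by simp
    qed (simp add: c(2))
    then have "c = 0\<^sub>v ?N" using c(1) by (intro eq_vecI) auto
    with c(3) show False by simp
  qed
  moreover have "v \<in> carrier_vec ?m" by (simp add: v_def)
  ultimately obtain h where h: "h \<in> nonsing ?m" "col h 0 = v" using exists_nonsing_with_first_col by blast
  then have hc: "h \<in> carrier_mat ?m ?m" "det h \<noteq> 0" by (auto simp: nonsing_def)
  define g where "g = mat ?N ?N (\<lambda>(i, j). if i = 0 then of_bool (j = 0) else if j = 0 then 0 else h $$ (i - 1, j - 1))"
  have car: "g \<in> carrier_mat ?N ?N" by (simp add: g_def)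
  have "mat_delete g 0 0 = h" using hc(1) by (intro eq_matI) (auto simp: g_def mat_delete_def)
  then have "det g = det h" using det_first_col[OF car] by (simp add: g_def)
  then have "g \<in> nonsing ?N" using car hc(2) by (simp add: nonsing_def)
  moreover have "row g 0 = unit_vec ?N 0" by (intro eq_vecI) (auto simp: g_def)
  moreover have "g *\<^sub>v unit_vec ?N 1 = c"
  proof -
    have "g *\<^sub>v unit_vec ?N 1 = col g 1" by (rule mult_mat_unit_vec[OF car]) simp
    also have "\<dots> = c"
    proof (rule eq_vecI)
      fix i assume i: "i < dim_vec c"
      show "col g 1 $ i = c $ i"
      proof (cases i)
        case (Suc k)
        then have "col g 1 $ i = col h 0 $ k" using i c(1) hc(1) by (simp add: g_def)
        then show ?thesis unfolding h(2) using Suc i c(1) by (simp add: v_def)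
      qed (use c(2) in \<open>simp add: g_def\<close>)
    qed (use c(1) car in simp)
    finally show ?thesis .
  qed
  ultimately show ?thesis
    using card_sym_nonsing_congruence[of g ?N "unit_vec ?N 1"] card_sym_nonsing_hyperbolic[where 'a = 'a, of n] by simp
qed

lemma card_vec_first_zero:
  "card {c \<in> carrier_vec (Suc n). c $ 0 = (0::'a::{zero,finite})} = CARD('a) ^ n"
proof -
  have "bij_betw (\<lambda>v. vec (Suc n) (\<lambda>i. if i = 0 then 0 else v $ (i - 1)))
      (carrier_vec n :: 'a vec set) {c \<in> carrier_vec (Suc n). c $ 0 = 0}"
  proof (rule bij_betw_byWitness[where f' = "\<lambda>c. vec n (\<lambda>i. c $ Suc i)"])
    show "\<forall>v\<in>carrier_vec n. vec n (\<lambda>i. vec (Suc n) (\<lambda>i. if i = 0 then 0 else v $ (i - 1)) $ Suc i) = (v :: 'a vec)"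
      by (intro ballI eq_vecI) auto
    show "\<forall>c\<in>{c \<in> carrier_vec (Suc n). c $ 0 = 0}.
        vec (Suc n) (\<lambda>i. if i = 0 then 0 else vec n (\<lambda>i. c $ Suc i) $ (i - 1)) = (c :: 'a vec)"
      by (intro ballI eq_vecI) auto
    show "(\<lambda>v. vec (Suc n) (\<lambda>i. if i = 0 then 0 else v $ (i - 1))) ` (carrier_vec n :: 'a vec set) \<subseteq>
        {c \<in> carrier_vec (Suc n). c $ 0 = 0}"
      by (rule image_subsetI) simp
    show "(\<lambda>c. vec n (\<lambda>i. c $ Suc i)) ` {c \<in> carrier_vec (Suc n). c $ 0 = (0::'a)} \<subseteq> carrier_vec n"
      by (rule image_subsetI) simp
  qed
  then have "card {c \<in> carrier_vec (Suc n). c $ 0 = (0::'a)} = card (carrier_vec n :: 'a vec set)"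
    by (rule bij_betw_same_card[symmetric])
  then show ?thesis by (simp add: card_carrier_vec)
qed

text \<open>Sorting by the first column: a nonzero first entry splits off a scalar, and a nonzero
  column with first entry 0 splits off a hyperbolic block of size 2.\<close>

lemma card_sym_nonsing_Suc:
  "card (sym_nonsing (Suc n) :: 'a::{field,finite} mat set) =
     (CARD('a) ^ Suc n - CARD('a) ^ n) * card (sym_nonsing n :: 'a mat set) +
     (CARD('a) ^ n - 1) * (CARD('a) ^ n * card (sym_nonsing (n - 1) :: 'a mat set))"
proof -
  let ?N = "Suc n"
  let ?V0 = "{c \<in> carrier_vec ?N. c $ 0 \<noteq> (0::'a)}" and ?V1 = "{c \<in> carrier_vec ?N. c $ 0 = (0::'a)} - {0\<^sub>v ?N}"
  let ?f = "\<lambda>c. card {A \<in> sym_nonsing ?N. col A 0 = (c :: 'a vec)}"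
  have fin: "finite {c \<in> carrier_vec ?N. P c}" for P :: "'a vec \<Rightarrow> bool"
    by (rule finite_subset[OF _ card_carrier_vec(1)]) auto
  have "card (sym_nonsing ?N :: 'a mat set) = (\<Sum>c\<in>?V0 \<union> ?V1. ?f c)"
  proof (rule card_eq_sum_fibres)
    show "(\<lambda>A. col A 0) ` sym_nonsing ?N \<subseteq> ?V0 \<union> ?V1"
    proof (rule image_subsetI)
      fix A assume "A \<in> (sym_nonsing ?N :: 'a mat set)"
      then have "A \<in> nonsing ?N" by (simp add: sym_nonsing_def)
      then show "col A 0 \<in> ?V0 \<union> ?V1" using col_nonsing_neq_0[of A ?N] by auto
    qed
  qed (use fin finite_sym_nonsing in auto)
  also have "\<dots> = (\<Sum>c\<in>?V0. ?f c) + (\<Sum>c\<in>?V1. ?f c)"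
    using fin by (intro sum.union_disjoint) auto
  also have "(\<Sum>c\<in>?V0. ?f c) = card ?V0 * card (sym_nonsing n :: 'a mat set)"
    by (simp add: card_sym_nonsing_first_col_nonzero)
  also have "card ?V0 = CARD('a) ^ ?N - CARD('a) ^ n"
  proof -
    have "?V0 = carrier_vec ?N - {c \<in> carrier_vec ?N. c $ 0 = (0::'a)}" by auto
    then show ?thesis using fin by (simp add: card_Diff_subset card_carrier_vec card_vec_first_zero)
  qed
  also have "(\<Sum>c\<in>?V1. ?f c) = card ?V1 * (CARD('a) ^ n * card (sym_nonsing (n - 1) :: 'a mat set))"
  proof (cases n)
    case 0
    \<comment> \<open>For n = 0 no such column exists, so the truncated \<open>n - 1\<close> does no
      harm.\<close>
    have "?V1 = {}"
    proof -
      have "c = 0\<^sub>v ?N" if "c \<in> carrier_vec ?N" "c $ 0 = (0::'a)" for c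
        using that 0 by (intro eq_vecI) auto
      then show ?thesis by blast
    qed
    then show ?thesis by (simp only: sum.empty card.empty mult_0)
  next
    case (Suc m)
    then have "?f c = CARD('a) ^ n * card (sym_nonsing (n - 1) :: 'a mat set)" if "c \<in> ?V1" for c
      using card_sym_nonsing_first_col_isotropic[of c m] that by simp
    then have "(\<Sum>c\<in>?V1. ?f c) = (\<Sum>c\<in>?V1. CARD('a) ^ n * card (sym_nonsing (n - 1) :: 'a mat set))"
      by (rule sum.cong[OF refl])
    then show ?thesis by (simp only: sum_constant of_nat_id)
  qed
  also have "card ?V1 = CARD('a) ^ n - 1"
    using fin by (simp add: card_Diff_subset card_vec_first_zero)
  finally show ?thesis .
qed

lemma sym_nonsing_0: "sym_nonsing 0 = {1\<^sub>m 0 :: 'a::field mat}"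
  by (auto simp: sym_nonsing_def nonsing_0)

section \<open>Invertible matrices with their inverses, and block triangular matrices\<close>

text \<open>Carrying the inverse along turns \<open>P_plus\<close> into an injective image.\<close>

definition GLp :: "nat \<Rightarrow> ('a::field mat \<times> 'a mat) set" where
  "GLp n = {(A, A'). A \<in> carrier_mat n n \<and> A' \<in> carrier_mat n n \<and> A * A' = 1\<^sub>m n \<and> A' * A = 1\<^sub>m n}"

lemma GLpD:
  assumes "(A, A') \<in> GLp n"
  shows "A \<in> carrier_mat n n" "A' \<in> carrier_mat n n" "A * A' = 1\<^sub>m n" "A' * A = 1\<^sub>m n"
  using assms by (auto simp: GLp_def)

lemma GLpI:
  assumes "A \<in> carrier_mat n n" "A' \<in> carrier_mat n n" "A * A' = (1\<^sub>m n :: 'a::field mat)"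
  shows "(A, A') \<in> GLp n"
  using assms mat_mult_left_right_inverse[OF assms] by (simp add: GLp_def)

lemma GLp_inverse_unique:
  assumes "(A, A') \<in> GLp n" "(A, A'') \<in> GLp n"
  shows "A' = A''"
proof -
  note D = GLpD[OF assms(1)] GLpD[OF assms(2)]
  have "A' * A * A'' = A' * (A * A'')" by (rule assoc_mult_mat[OF D(2,1,6)])
  then have "1\<^sub>m n * A'' = A' * 1\<^sub>m n" by (simp only: D(4,7))
  then show ?thesis using left_mult_one_mat[OF D(6)] right_mult_one_mat[OF D(2)] by simp
qed

lemma bij_betw_fst_GLp: "bij_betw fst (GLp n) (nonsing n :: 'a::field mat set)"
  unfolding bij_betw_def
proof
  show "inj_on fst (GLp n :: ('a mat \<times> 'a mat) set)"
    by (rule inj_onI) (metis GLp_inverse_unique prod.collapse)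
  show "fst ` GLp n = (nonsing n :: 'a mat set)"
  proof (intro equalityI image_subsetI subsetI)
    fix x assume "x \<in> (GLp n :: ('a mat \<times> 'a mat) set)"
    then have x: "(fst x, snd x) \<in> GLp n" by simp
    show "fst x \<in> nonsing n"
      using right_inverse_det_neq_0[OF GLpD(1-3)[OF x]] GLpD(1)[OF x] by (simp add: nonsing_def)
  next
    fix A assume "A \<in> (nonsing n :: 'a mat set)"
    then have A: "A \<in> carrier_mat n n" "det A \<noteq> 0" by (auto simp: nonsing_def)
    obtain A' where "A' \<in> carrier_mat n n" "A * A' = 1\<^sub>m n" using det_neq_0_obtain_inverse[OF A] by metis
    then have "(A, A') \<in> GLp n" using A GLpI by blast
    then show "A \<in> fst ` GLp n" by force
  qed
qed

lemma finite_GLp: "finite (GLp n :: ('a::{field,finite} mat \<times> 'a mat) set)"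
  using bij_betw_finite[OF bij_betw_fst_GLp] finite_nonsing by blast

lemma card_GLp: "card (GLp n :: ('a::{field,finite} mat \<times> 'a mat) set) = card (nonsing n :: 'a mat set)"
  by (rule bij_betw_same_card[OF bij_betw_fst_GLp])

lemma sum_lessThan_add: "(\<Sum>k<s + (m::nat). f k) = (\<Sum>k<s. f k) + (\<Sum>k<m. f (s + k) :: 'b::comm_monoid_add)"
  by (induction m) (simp_all add: add.assoc)

section \<open>Block triangular matrices\<close>

definition blk :: "'a mat \<Rightarrow> nat \<Rightarrow> nat \<Rightarrow> nat \<Rightarrow> nat \<Rightarrow> 'a mat" where
  "blk A i0 j0 a b = mat a b (\<lambda>(i, j). A $$ (i0 + i, j0 + j))"

lemma blk_carrier [simp]: "blk A i0 j0 a b \<in> carrier_mat a b"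
  by (simp add: blk_def)

lemma blk_four_block:
  assumes "A \<in> carrier_mat a b" "B \<in> carrier_mat a d" "C \<in> carrier_mat c b" "D \<in> carrier_mat c d"
  shows "blk (four_block_mat A B C D) 0 0 a b = A" "blk (four_block_mat A B C D) 0 b a d = B"
    "blk (four_block_mat A B C D) a 0 c b = C" "blk (four_block_mat A B C D) a b c d = D"
  using assms by (auto intro!: eq_matI simp: blk_def)

lemma four_block_blk:
  assumes "A \<in> carrier_mat (a + c) (b + d)"
  shows "four_block_mat (blk A 0 0 a b) (blk A 0 b a d) (blk A a 0 c b) (blk A a b c d) = A"
  using assms by (intro eq_matI) (auto simp: blk_def)

definition lowtri :: "nat \<Rightarrow> nat \<Rightarrow> ('a::field mat \<times> 'a mat) set" where
  "lowtri s m = {(A, A') \<in> GLp (s + m). \<forall>i j. i < s \<longrightarrow> s \<le> j \<longrightarrow> j < s + m \<longrightarrow> A $$ (i, j) = 0}"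

definition ltmat :: "('a::field mat \<times> 'a mat) \<times> ('a mat \<times> 'a mat) \<times> 'a mat \<Rightarrow> nat \<Rightarrow> nat \<Rightarrow> 'a mat \<times> 'a mat" where
  "ltmat x s m = (case x of ((X, X'), (Y, Y'), Z) \<Rightarrow>
     (four_block_mat X (0\<^sub>m s m) Z Y, four_block_mat X' (0\<^sub>m s m) (- (Y' * Z * X')) Y'))"

lemma mat_add_uminus: "(W :: 'a::ab_group_add mat) \<in> carrier_mat a b \<Longrightarrow> W + - W = 0\<^sub>m a b"
  by (intro eq_matI) auto

lemma ltmat_lowtri:
  assumes X: "(X, X') \<in> GLp s" and Y: "(Y, Y') \<in> GLp m" and Z: "(Z :: 'a::field mat) \<in> carrier_mat m s"
  shows "ltmat ((X, X'), (Y, Y'), Z) s m \<in> lowtri s m"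
proof -
  note DX = GLpD[OF X] and DY = GLpD[OF Y]
  let ?A = "four_block_mat X (0\<^sub>m s m) Z Y" and ?A' = "four_block_mat X' (0\<^sub>m s m) (- (Y' * Z * X')) Y'"
  have ZX: "Y' * Z * X' \<in> carrier_mat m s" using DX DY Z by simp
  have ZX'c: "Z * X' \<in> carrier_mat m s" using DX Z by simp
  have assoc: "Y' * Z * X' = Y' * (Z * X')" by (rule assoc_mult_mat[OF DY(2) Z DX(2)])
  have "Y * (- (Y' * Z * X')) = - (Y * (Y' * Z * X'))" using DY ZX by simp
  also have "Y * (Y' * Z * X') = Y * Y' * (Z * X')"
    unfolding assoc by (rule assoc_mult_mat[OF DY(1,2) ZX'c, symmetric])
  also have "\<dots> = Z * X'" unfolding DY(3) by (rule left_mult_one_mat[OF ZX'c])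
  finally have Y: "Y * (- (Y' * Z * X')) = - (Z * X')" .
  have *: "Z * X' + Y * (- (Y' * Z * X')) = 0\<^sub>m m s"
    unfolding Y by (rule mat_add_uminus[OF ZX'c])
  have "(0\<^sub>m s m :: 'a mat) * - (Y' * Z * X') = 0\<^sub>m s s"
    by (rule left_mult_zero_mat) (use ZX in simp)
  moreover have "?A * ?A' = four_block_mat (X * X' + 0\<^sub>m s m * - (Y' * Z * X')) (X * 0\<^sub>m s m + 0\<^sub>m s m * Y')
      (Z * X' + Y * - (Y' * Z * X')) (Z * 0\<^sub>m s m + Y * Y')"
    using DX DY Z ZX by (intro mult_four_block_mat) auto
  ultimately have "?A * ?A' = 1\<^sub>m (s + m)"
    unfolding * using DX DY Z ZX by simp
  then have "(?A, ?A') \<in> GLp (s + m)" using DX DY Z ZX by (intro GLpI) auto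
  then show ?thesis using DX DY Z by (auto simp: ltmat_def lowtri_def)
qed

text \<open>The zero block of A kills the cross terms in the upper left corner of A A' and in the
  lower right corner of A' A, so the diagonal blocks of A' invert those of A. That A' has the form
  given by \<open>ltmat\<close> then follows from uniqueness of inverses.\<close>

lemma bij_betw_ltmat:
  "bij_betw (\<lambda>x. ltmat x s m) (GLp s \<times> GLp m \<times> carrier_mat m s) (lowtri s m :: ('a::field mat \<times> 'a mat) set)"
proof (rule bij_betw_byWitness[where f' = "\<lambda>(A, A'). ((blk A 0 0 s s, blk A' 0 0 s s), (blk A s s m m, blk A' s s m m), blk A s 0 m s)"])
  let ?R = "\<lambda>(A :: 'a mat, A'). ((blk A 0 0 s s, blk A' 0 0 s s), (blk A s s m m, blk A' s s m m), blk A s 0 m s)"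
  show "\<forall>x\<in>GLp s \<times> GLp m \<times> carrier_mat m s. ?R (ltmat x s m) = x"
  proof (rule ballI)
    fix x :: "('a mat \<times> 'a mat) \<times> ('a mat \<times> 'a mat) \<times> 'a mat"
    assume "x \<in> GLp s \<times> GLp m \<times> carrier_mat m s"
    then obtain X X' Y Y' Z where x: "x = ((X, X'), (Y, Y'), Z)" "(X, X') \<in> GLp s" "(Y, Y') \<in> GLp m" "Z \<in> carrier_mat m s"
      by auto
    note D = GLpD[OF x(2)] GLpD[OF x(3)]
    have c: "- (Y' * Z * X') \<in> carrier_mat m s" "(0\<^sub>m s m :: 'a mat) \<in> carrier_mat s m" using D x(4) by auto
    show "?R (ltmat x s m) = x"
      unfolding x(1) ltmat_def
      by (simp add: blk_four_block[OF D(1) c(2) x(4) D(5)] blk_four_block[OF D(2) c(2) c(1) D(6)])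
  qed
  have R: "(blk A 0 0 s s, blk A' 0 0 s s) \<in> GLp s \<and> (blk A s s m m, blk A' s s m m) \<in> GLp m \<and>
      ltmat (?R (A, A')) s m = (A, A')" if p: "(A, A') \<in> lowtri s m" for A A' :: "'a mat"
  proof -
    have G: "(A, A') \<in> GLp (s + m)" using p by (simp add: lowtri_def)
    note D = GLpD[OF G]
    let ?X = "blk A 0 0 s s" and ?Z = "blk A s 0 m s" and ?Y = "blk A s s m m"
    let ?X2 = "blk A' 0 0 s s" and ?Y2 = "blk A' s s m m"
    have zero: "A $$ (i, s + j) = 0" if "i < s" "j < m" for i j using p that by (simp add: lowtri_def)
    have "blk A 0 s s m = 0\<^sub>m s m" using zero by (intro eq_matI) (auto simp: blk_def)
    then have A: "A = four_block_mat ?X (0\<^sub>m s m) ?Z ?Y" using four_block_blk[OF D(1)] by simp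
    have XX2: "?X * ?X2 = 1\<^sub>m s"
    proof (rule eq_matI)
      fix i j assume "i < dim_row (1\<^sub>m s :: 'a mat)" "j < dim_col (1\<^sub>m s :: 'a mat)"
      then have ij: "i < s" "j < s" by auto
      have "(1\<^sub>m (s + m) :: 'a mat) $$ (i, j) = (\<Sum>k<s + m. A $$ (i, k) * A' $$ (k, j))"
        unfolding D(3)[symmetric] using ij by (intro index_mult_mat_sum[OF D(1,2)]) auto
      also have "\<dots> = (\<Sum>k<s. ?X $$ (i, k) * ?X2 $$ (k, j))"
        unfolding sum_lessThan_add using ij zero by (simp add: blk_def)
      also have "\<dots> = (?X * ?X2) $$ (i, j)"
        using ij by (intro index_mult_mat_sum[OF blk_carrier blk_carrier, symmetric])
      finally show "(?X * ?X2) $$ (i, j) = (1\<^sub>m s :: 'a mat) $$ (i, j)" using ij by simp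
    qed (simp_all add: blk_def)
    have Y2Y: "?Y2 * ?Y = 1\<^sub>m m"
    proof (rule eq_matI)
      fix i j assume "i < dim_row (1\<^sub>m m :: 'a mat)" "j < dim_col (1\<^sub>m m :: 'a mat)"
      then have ij: "i < m" "j < m" by auto
      have "(1\<^sub>m (s + m) :: 'a mat) $$ (s + i, s + j) = (\<Sum>k<s + m. A' $$ (s + i, k) * A $$ (k, s + j))"
        unfolding D(4)[symmetric] using ij by (intro index_mult_mat_sum[OF D(2,1)]) auto
      also have "\<dots> = (\<Sum>k<m. ?Y2 $$ (i, k) * ?Y $$ (k, j))"
        unfolding sum_lessThan_add using ij zero by (simp add: blk_def)
      also have "\<dots> = (?Y2 * ?Y) $$ (i, j)"
        using ij by (intro index_mult_mat_sum[OF blk_carrier blk_carrier, symmetric])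
      finally show "(?Y2 * ?Y) $$ (i, j) = (1\<^sub>m m :: 'a mat) $$ (i, j)" using ij by simp
    qed (simp_all add: blk_def)
    have GX: "(?X, ?X2) \<in> GLp s" using XX2 by (intro GLpI) auto
    have "?Y * ?Y2 = 1\<^sub>m m" using Y2Y mat_mult_left_right_inverse[of ?Y2 m ?Y] by simp
    then have GY: "(?Y, ?Y2) \<in> GLp m" by (intro GLpI) auto
    have "ltmat (?R (A, A')) s m \<in> GLp (s + m)"
      using ltmat_lowtri[OF GX GY, of ?Z] by (auto simp: lowtri_def)
    moreover have fst_eq: "fst (ltmat (?R (A, A')) s m) = A"
      by (simp add: ltmat_def A[symmetric])
    ultimately have "(A, snd (ltmat (?R (A, A')) s m)) \<in> GLp (s + m)"
      by (cases "ltmat (?R (A, A')) s m") simp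
    then have "snd (ltmat (?R (A, A')) s m) = A'" using G by (rule GLp_inverse_unique)
    with fst_eq have "ltmat (?R (A, A')) s m = (A, A')" by (rule prod_eqI[of _ "(A, A')", unfolded fst_conv snd_conv])
    then show ?thesis using GX GY by blast
  qed
  show "\<forall>p\<in>lowtri s m. ltmat (?R p) s m = p"
  proof (rule ballI)
    fix p :: "'a mat \<times> 'a mat" assume p: "p \<in> lowtri s m"
    show "ltmat (?R p) s m = p" using R[of "fst p" "snd p"] p by (cases p) simp
  qed
  show "?R ` lowtri s m \<subseteq> GLp s \<times> GLp m \<times> carrier_mat m s"
  proof (rule image_subsetI)
    fix p :: "'a mat \<times> 'a mat" assume p: "p \<in> lowtri s m"
    show "?R p \<in> GLp s \<times> GLp m \<times> carrier_mat m s" using R[of "fst p" "snd p"] p by (cases p) simp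
  qed
  show "(\<lambda>x. ltmat x s m) ` (GLp s \<times> GLp m \<times> carrier_mat m s) \<subseteq> (lowtri s m :: ('a mat \<times> 'a mat) set)"
  proof (rule image_subsetI)
    fix x :: "('a mat \<times> 'a mat) \<times> ('a mat \<times> 'a mat) \<times> 'a mat"
    assume "x \<in> GLp s \<times> GLp m \<times> carrier_mat m s"
    then obtain X X' Y Y' Z where x: "x = ((X, X'), (Y, Y'), Z)" "(X, X') \<in> GLp s" "(Y, Y') \<in> GLp m" "Z \<in> carrier_mat m s"
      by auto
    show "ltmat x s m \<in> lowtri s m" unfolding x(1) by (rule ltmat_lowtri[OF x(2-4)])
  qed
qed


lemma card_lowtri:
  "card (lowtri s m :: ('a::{field,finite} mat \<times> 'a mat) set) =
    card (nonsing s :: 'a mat set) * (card (nonsing m :: 'a mat set) * CARD('a) ^ (m * s))"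
  using bij_betw_same_card[OF bij_betw_ltmat[where 'a = 'a, of s m]]
  by (simp add: card_cartesian_product card_GLp card_carrier_mat)

section \<open>Alternating matrices in characteristic two\<close>

text \<open>The pairs \<open>(j, i)\<close> with \<open>i < j < n\<close> index the free entries of an alternating matrix.\<close>

definition pairs :: "nat \<Rightarrow> (nat \<times> nat) set" where
  "pairs n = (SIGMA j:{..<n}. {..<j})"

lemma finite_pairs [simp]: "finite (pairs n)"
  by (simp add: pairs_def)

lemma card_pairs: "card (pairs n) = (\<Sum>j<n. j)"
  by (simp add: pairs_def)

lemma sum_square_pairs:
  fixes g :: "nat \<Rightarrow> nat \<Rightarrow> 'b::comm_monoid_add"
  shows "(\<Sum>i<n. \<Sum>k<n. g i k) = (\<Sum>(j, i)\<in>pairs n. g i j + g j i) + (\<Sum>i<n. g i i)"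
proof -
  have "(\<Sum>i<n. \<Sum>k<n. g i k) = (\<Sum>j<n. \<Sum>i<j. g i j + g j i) + (\<Sum>i<n. g i i)"
    by (induction n) (simp_all add: sum.distrib ac_simps)
  also have "(\<Sum>j<n. \<Sum>i<j. g i j + g j i) = (\<Sum>(j, i)\<in>pairs n. g i j + g j i)"
    unfolding pairs_def by (rule sum.Sigma) auto
  finally show ?thesis .
qed

definition altm :: "nat \<Rightarrow> (nat \<times> nat \<Rightarrow> 'a::field) \<Rightarrow> 'a mat" where
  "altm n f = mat n n (\<lambda>(i, j). if i < j then f (j, i) else if j < i then f (i, j) else 0)"

lemma alternatingD:
  assumes "alternating_mat n B"
  shows "B \<in> carrier_mat n n" "i < n \<Longrightarrow> j < n \<Longrightarrow> B $$ (i, j) = B $$ (j, i)" "i < n \<Longrightarrow> B $$ (i, i) = 0"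
proof -
  show B: "B \<in> carrier_mat n n" and "i < n \<Longrightarrow> B $$ (i, i) = 0"
    using assms by (auto simp: alternating_mat_def)
  assume ij: "i < n" "j < n"
  have "B $$ (i, j) = B\<^sup>T $$ (i, j)" using assms by (simp add: alternating_mat_def)
  also have "\<dots> = B $$ (j, i)" using B ij by simp
  finally show "B $$ (i, j) = B $$ (j, i)" .
qed

lemma alternatingI:
  assumes "B \<in> carrier_mat n n" "\<And>i j. i < n \<Longrightarrow> j < n \<Longrightarrow> B $$ (i, j) = B $$ (j, i)" "\<And>i. i < n \<Longrightarrow> B $$ (i, i) = 0"
  shows "alternating_mat n B"
proof -
  have "B\<^sup>T = B" using assms(1,2) by (intro eq_matI) auto
  then show ?thesis using assms(1,3) by (simp add: alternating_mat_def)
qed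

text \<open>Each free entry is either unrestricted or forced to be 0, so that one bijection covers
  all alternating matrices and those with a vanishing corner.\<close>

lemma bij_betw_altm:
  assumes "\<And>p. p \<in> pairs n \<Longrightarrow> V p = UNIV \<or> V p = {0 :: 'a::field}"
  shows "bij_betw (altm n) (\<Pi>\<^sub>E p\<in>pairs n. V p)
    {B. alternating_mat n B \<and> (\<forall>j i. (j, i) \<in> pairs n \<longrightarrow> B $$ (i, j) \<in> V (j, i))}"
proof (rule bij_betw_byWitness[where f' = "\<lambda>B. restrict (\<lambda>(j, i). B $$ (i, j)) (pairs n)"])
  let ?S = "{B. alternating_mat n B \<and> (\<forall>j i. (j, i) \<in> pairs n \<longrightarrow> B $$ (i, j) \<in> V (j, i))}"
  have entry: "altm n f $$ (i, j) = f (j, i)" if "(j, i) \<in> pairs n" for f :: "nat \<times> nat \<Rightarrow> 'a" and i j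
    using that by (auto simp: altm_def pairs_def)
  show "\<forall>f\<in>(\<Pi>\<^sub>E p\<in>pairs n. V p). restrict (\<lambda>(j, i). altm n f $$ (i, j)) (pairs n) = f"
  proof (intro ballI ext)
    fix f p assume f: "f \<in> (\<Pi>\<^sub>E p\<in>pairs n. V p)"
    show "restrict (\<lambda>(j, i). altm n f $$ (i, j)) (pairs n) p = f p"
    proof (cases "p \<in> pairs n")
      case True
      then show ?thesis using entry[of "fst p" "snd p" f] by (simp add: case_prod_beta)
    next
      case False
      then show ?thesis using PiE_arb[OF f False] by simp
    qed
  qed
  show "\<forall>B\<in>?S. altm n (restrict (\<lambda>(j, i). B $$ (i, j)) (pairs n)) = B"
  proof (rule ballI)
    fix B assume "B \<in> ?S"
    then have "alternating_mat n B" by simp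
    note D = alternatingD[OF this]
    show "altm n (restrict (\<lambda>(j, i). B $$ (i, j)) (pairs n)) = B"
    proof (rule eq_matI)
      fix i j assume "i < dim_row B" "j < dim_col B"
      then have ij: "i < n" "j < n" using D(1) by auto
      consider "i < j" | "j < i" | "i = j" by linarith
      then show "altm n (restrict (\<lambda>(j, i). B $$ (i, j)) (pairs n)) $$ (i, j) = B $$ (i, j)"
        by cases (use ij D(2)[of i j] D(3)[of i] in \<open>auto simp: altm_def pairs_def\<close>)
    qed (use D(1) in \<open>auto simp: altm_def\<close>)
  qed
  show "altm n ` (\<Pi>\<^sub>E p\<in>pairs n. V p) \<subseteq> ?S"
  proof (rule image_subsetI)
    fix f assume f: "f \<in> (\<Pi>\<^sub>E p\<in>pairs n. V p)"
    have "alternating_mat n (altm n f)" by (rule alternatingI) (auto simp: altm_def)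
    then show "altm n f \<in> ?S" using entry[of _ _ f] PiE_mem[OF f] by simp
  qed
  show "(\<lambda>B. restrict (\<lambda>(j, i). B $$ (i, j)) (pairs n)) ` ?S \<subseteq> (\<Pi>\<^sub>E p\<in>pairs n. V p)"
    by (intro image_subsetI) (auto simp: restrict_PiE_iff)
qed

lemma bij_betw_altm_UNIV: "bij_betw (altm n) (\<Pi>\<^sub>E p\<in>pairs n. UNIV) {B. alternating_mat n (B :: 'a::field mat)}"
  using bij_betw_altm[of n "\<lambda>_. UNIV :: 'a set"] by simp

lemma card_alternating: "card {B. alternating_mat n (B :: 'a::{field,finite} mat)} = CARD('a) ^ (\<Sum>j<n. j)"
  using bij_betw_same_card[OF bij_betw_altm_UNIV[where 'a = 'a, of n]] by (simp add: card_PiE card_pairs)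

lemma finite_alternating: "finite {B. alternating_mat n (B :: 'a::{field,finite} mat)}"
  using bij_betw_finite[OF bij_betw_altm_UNIV[where 'a = 'a, of n]] by (simp add: finite_PiE)

text \<open>Stated as a product in order to avoid a difference of exponents.\<close>

lemma card_alternating_corner:
  assumes "s \<le> n"
  shows "card {B. alternating_mat n (B :: 'a::{field,finite} mat) \<and> (\<forall>i<s. \<forall>j<s. B $$ (i, j) = 0)} * CARD('a) ^ (\<Sum>j<s. j) =
    CARD('a) ^ (\<Sum>j<n. j)"
proof -
  define V where "V p = (if p \<in> pairs s then {0 :: 'a} else UNIV)" for p
  have sub: "pairs s \<subseteq> pairs n" using assms by (auto simp: pairs_def)
  have "{B. alternating_mat n B \<and> (\<forall>i<s. \<forall>j<s. B $$ (i, j) = 0)} =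
      {B. alternating_mat n B \<and> (\<forall>j i. (j, i) \<in> pairs n \<longrightarrow> B $$ (i, j) \<in> V (j, i))}"
  proof (intro Collect_cong conj_cong refl iffI allI impI)
    fix B j i assume "\<forall>i<s. \<forall>j<s. B $$ (i, j) = (0 :: 'a)" "(j, i) \<in> pairs n"
    then show "B $$ (i, j) \<in> V (j, i)" by (auto simp: V_def pairs_def)
  next
    fix B i j assume B: "alternating_mat n B" "\<forall>j i. (j, i) \<in> pairs n \<longrightarrow> B $$ (i, j) \<in> V (j, i)" and ij: "i < s" "j < s"
    have *: "B $$ (x, y) = 0" if "x < y" "y < s" for x y
    proof -
      have "(y, x) \<in> pairs s" using that by (simp add: pairs_def)
      then have "(y, x) \<in> pairs n" "V (y, x) = {0}" using sub by (auto simp: V_def)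
      then have "B $$ (x, y) \<in> V (y, x)" "V (y, x) = {0}" using B(2) by blast+
      then show ?thesis by simp
    qed
    consider "i < j" | "j < i" | "i = j" by linarith
    then show "B $$ (i, j) = 0"
    proof cases
      case 1
      then show ?thesis using * ij by blast
    next
      case 2
      then show ?thesis using *[of j i] alternatingD(2)[OF B(1), of i j] ij assms by simp
    next
      case 3
      then show ?thesis using alternatingD(3)[OF B(1), of i] ij assms by simp
    qed
  qed
  then have "card {B. alternating_mat n B \<and> (\<forall>i<s. \<forall>j<s. B $$ (i, j) = (0::'a))} = card (\<Pi>\<^sub>E p\<in>pairs n. V p)"
    using bij_betw_same_card[OF bij_betw_altm[of n V]] by (simp add: V_def)
  also have "\<dots> = (\<Prod>p\<in>pairs n. card (V p))" by (simp add: card_PiE)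
  also have "\<dots> = (\<Prod>p\<in>pairs s. card (V p)) * (\<Prod>p\<in>pairs n - pairs s. card (V p))"
    using sub by (simp add: prod.subset_diff mult.commute)
  also have "\<dots> = CARD('a) ^ card (pairs n - pairs s)" by (simp add: V_def)
  finally show ?thesis
    using sub card_mono[OF finite_pairs sub]
    by (simp add: card_Diff_subset finite_subset[OF sub] card_pairs power_add[symmetric])
qed

context char2_field
begin

lemma mat_add_self: "(M :: 'a mat) \<in> carrier_mat n m \<Longrightarrow> M + M = 0\<^sub>m n m"
  by (intro eq_matI) auto

text \<open>This form makes closure under congruence immediate: a congruence carries T plus its
  transpose to a matrix of the same kind.\<close>

lemma alternating_iff_symmetrization:
  "alternating_mat n (B :: 'a mat) \<longleftrightarrow> (\<exists>T\<in>carrier_mat n n. B = T + T\<^sup>T)"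
proof
  assume "alternating_mat n B"
  note D = alternatingD[OF this]
  define T where "T = mat n n (\<lambda>(i, j). if i < j then B $$ (i, j) else 0)"
  have "B = T + T\<^sup>T"
  proof (rule eq_matI)
    fix i j assume "i < dim_row (T + T\<^sup>T)" "j < dim_col (T + T\<^sup>T)"
    then have ij: "i < n" "j < n" by (auto simp: T_def)
    consider "i < j" | "j < i" | "i = j" by linarith
    then show "B $$ (i, j) = (T + T\<^sup>T) $$ (i, j)"
      by cases (use ij D(2)[of i j] D(3)[of i] in \<open>auto simp: T_def\<close>)
  qed (use D(1) in \<open>auto simp: T_def\<close>)
  then show "\<exists>T\<in>carrier_mat n n. B = T + T\<^sup>T" by (auto simp: T_def)
next
  assume "\<exists>T\<in>carrier_mat n n. B = T + T\<^sup>T"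
  then obtain T where "T \<in> carrier_mat n n" "B = T + T\<^sup>T" by blast
  then show "alternating_mat n B" by (intro alternatingI) (auto simp: add.commute)
qed

lemma alternating_add:
  assumes "alternating_mat n (B :: 'a mat)" "alternating_mat n C"
  shows "alternating_mat n (B + C)"
  using alternatingD[OF assms(1)] alternatingD[OF assms(2)] by (intro alternatingI) auto

lemma alternating_congruence:
  assumes B: "alternating_mat n (B :: 'a mat)" and C: "C \<in> carrier_mat n m"
  shows "alternating_mat m (C\<^sup>T * B * C)"
proof -
  obtain T where T: "T \<in> carrier_mat n n" "B = T + T\<^sup>T" using B alternating_iff_symmetrization by blast
  have Ct: "C\<^sup>T \<in> carrier_mat m n" "T\<^sup>T \<in> carrier_mat n n" using C T by auto
  have CT: "C\<^sup>T * T \<in> carrier_mat m n" using Ct T by simp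
  have "C\<^sup>T * B * C = C\<^sup>T * T * C + C\<^sup>T * T\<^sup>T * C"
    unfolding T(2) mult_add_distrib_mat[OF Ct(1) T(1) Ct(2)]
    using Ct C T by (intro add_mult_distrib_mat) auto
  also have "C\<^sup>T * T\<^sup>T * C = (C\<^sup>T * T * C)\<^sup>T"
    using transpose_mult[OF CT C] transpose_mult[OF Ct(1) T(1)] assoc_mult_mat[OF Ct(1) Ct(2) C] by simp
  finally have "C\<^sup>T * B * C = C\<^sup>T * T * C + (C\<^sup>T * T * C)\<^sup>T" .
  moreover have "C\<^sup>T * T * C \<in> carrier_mat m m" using CT C by simp
  ultimately show ?thesis using alternating_iff_symmetrization by blast
qed

text \<open>
  The trace form is a nondegenerate pairing between alternating matrices and matrices
  modulo symmetric ones, so the sum over \<open>B\<close> detects the shape of \<open>A\<close>.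
\<close>

lemma sum_lam_alternating:
  assumes A: "(A :: 'a mat) \<in> carrier_mat n n" and s: "s \<le> n" and a: "a \<noteq> 0"
  shows "(\<Sum>B | alternating_mat n B. lam r (a * (\<Sum>i<s. (A * B) $$ (i, i)))) =
    (if (\<forall>i<s. \<forall>j. s \<le> j \<longrightarrow> j < n \<longrightarrow> A $$ (i, j) = 0) \<and> (\<forall>i<s. \<forall>j<s. A $$ (i, j) = A $$ (j, i))
     then Q ^ (\<Sum>j<n. j) else 0)"
proof -
  \<comment> \<open>The coefficient of the free entry (j, i), i < j, in the partial trace as a
    linear form in B: it is A_ij for i < s <= j, the sum A_ij + A_ji for j < s, and 0 for s <= i.
    All coefficients vanish exactly when A has the required shape.\<close>
  define c where "c = (\<lambda>(j, i). (if i < s then A $$ (i, j) else 0) + (if j < s then A $$ (j, i) else 0))"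
  have lin: "(\<Sum>i<s. (A * altm n f) $$ (i, i)) = (\<Sum>p\<in>pairs n. c p * f p)" for f :: "nat \<times> nat \<Rightarrow> 'a"
  proof -
    let ?B = "altm n f"
    have B: "?B \<in> carrier_mat n n" by (simp add: altm_def)
    define g where "g i k = (if i < s then A $$ (i, k) * ?B $$ (k, i) else 0)" for i k
    have "(\<Sum>i<s. (A * ?B) $$ (i, i)) = (\<Sum>i<s. \<Sum>k<n. A $$ (i, k) * ?B $$ (k, i))"
      using s by (intro sum.cong refl index_mult_mat_sum[OF A B]) auto
    also have "\<dots> = (\<Sum>i<s. \<Sum>k<n. g i k)" by (simp add: g_def)
    also have "\<dots> = (\<Sum>i<n. \<Sum>k<n. g i k)"
      using s by (intro sum.mono_neutral_left) (auto simp: g_def)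
    also have "\<dots> = (\<Sum>(j, i)\<in>pairs n. g i j + g j i) + (\<Sum>i<n. g i i)" by (rule sum_square_pairs)
    also have "(\<Sum>i<n. g i i) = 0" by (intro sum.neutral) (auto simp: g_def altm_def)
    also have "(\<Sum>(j, i)\<in>pairs n. g i j + g j i) = (\<Sum>p\<in>pairs n. c p * f p)"
      by (intro sum.cong) (auto simp: g_def c_def altm_def pairs_def distrib_right)
    finally show ?thesis by simp
  qed
  have "(\<Sum>B | alternating_mat n B. lam r (a * (\<Sum>i<s. (A * B) $$ (i, i)))) =
      (\<Sum>f\<in>(\<Pi>\<^sub>E p\<in>pairs n. UNIV). lam r (a * (\<Sum>i<s. (A * altm n f) $$ (i, i))))"
    by (rule sum.reindex_bij_betw[OF bij_betw_altm_UNIV, symmetric])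
  also have "\<dots> = (\<Sum>f\<in>(\<Pi>\<^sub>E p\<in>pairs n. UNIV). \<Prod>p\<in>pairs n. lam r ((a * c p) * f p))"
    unfolding lin sum_distrib_left lam_sum mult.assoc ..
  also have "\<dots> = (\<Prod>p\<in>pairs n. \<Sum>x\<in>UNIV. lam r ((a * c p) * x))"
    by (rule prod_sum_PiE[symmetric]) auto
  also have "\<dots> = (\<Prod>p\<in>pairs n. if c p = 0 then Q else 0)"
    unfolding sum_lam using a by simp
  also have "\<dots> = (if \<forall>p\<in>pairs n. c p = 0 then Q ^ (\<Sum>j<n. j) else 0)"
  proof (cases "\<forall>p\<in>pairs n. c p = 0")
    case True
    then have "(\<Prod>p\<in>pairs n. if c p = 0 then Q else 0) = (\<Prod>p\<in>pairs n. Q)" by (intro prod.cong) auto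
    then show ?thesis using True by (simp add: card_pairs)
  next
    case False
    then show ?thesis by (auto simp: prod_zero_iff)
  qed
  also have "(\<forall>p\<in>pairs n. c p = 0) \<longleftrightarrow>
     (\<forall>i<s. \<forall>j. s \<le> j \<longrightarrow> j < n \<longrightarrow> A $$ (i, j) = 0) \<and> (\<forall>i<s. \<forall>j<s. A $$ (i, j) = A $$ (j, i))" (is "?L \<longleftrightarrow> ?R")
  proof
    assume L: ?L
    show ?R
    proof (intro conjI allI impI)
      fix i j assume "i < s" "s \<le> j" "j < n"
      then have "(j, i) \<in> pairs n" "c (j, i) = A $$ (i, j)" by (auto simp: pairs_def c_def)
      then show "A $$ (i, j) = 0" using L by auto
    next
      have *: "A $$ (i, j) = A $$ (j, i)" if "i < j" "j < s" for i j
      proof -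
        have "(j, i) \<in> pairs n" "c (j, i) = A $$ (i, j) + A $$ (j, i)" using that s by (auto simp: pairs_def c_def)
        then have "A $$ (i, j) + A $$ (j, i) = 0" using L by metis
        then show ?thesis by simp
      qed
      fix i j assume "i < s" "j < s"
      then show "A $$ (i, j) = A $$ (j, i)" using *[of i j] *[of j i] by (cases i j rule: linorder_cases) auto
    qed
  next
    assume R: ?R
    show ?L
    proof (rule ballI)
      fix p assume "p \<in> pairs n"
      then obtain j i where p: "p = (j, i)" "i < j" "j < n" by (auto simp: pairs_def)
      consider "s \<le> i" | "i < s" "s \<le> j" | "j < s" by linarith
      then show "c p = 0"
      proof cases
        case 3
        then have "A $$ (i, j) = A $$ (j, i)" using R p by auto
        then show ?thesis using 3 p by (simp add: c_def)
      qed (use R p in \<open>auto simp: c_def\<close>)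
    qed
  qed
  finally show ?thesis .
qed

end

section \<open>Sums over double cosets\<close>

lemma mat_trace_comm:
  assumes "(A :: 'a::comm_ring_1 mat) \<in> carrier_mat n m" "B \<in> carrier_mat m n"
  shows "mat_trace (A * B) = mat_trace (B * A)"
proof -
  have "mat_trace (A * B) = (\<Sum>i<n. \<Sum>k<m. A $$ (i, k) * B $$ (k, i))"
    using assms unfolding mat_trace_def
    by (intro sum.cong index_mult_mat_sum[OF assms]) auto
  also have "\<dots> = (\<Sum>k<m. \<Sum>i<n. B $$ (k, i) * A $$ (i, k))"
    by (subst sum.swap) (simp add: mult.commute)
  also have "\<dots> = mat_trace (B * A)"
    using assms unfolding mat_trace_def
    by (intro sum.cong index_mult_mat_sum[OF assms(2,1), symmetric]) auto
  finally show ?thesis .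
qed

text \<open>
  The fibres of \<open>(p, p') \<mapsto> p \<sigma> p'\<close> all have the same size, and by cyclicity of the trace the sum
  over \<open>P \<times> P\<close> reduces to a sum over \<open>P\<close>.
\<close>

lemma double_coset_sum:
  fixes P :: "'a::comm_ring_1 mat set" and \<phi> :: "'a \<Rightarrow> int"
  assumes fin: "finite P" and sub: "P \<subseteq> carrier_mat N N"
    and mult: "\<And>p p'. p \<in> P \<Longrightarrow> p' \<in> P \<Longrightarrow> p * p' \<in> P" and one: "1\<^sub>m N \<in> P"
    and invertible: "\<And>p. p \<in> P \<Longrightarrow> \<exists>p'\<in>carrier_mat N N. p' * p = 1\<^sub>m N \<and> p * p' = 1\<^sub>m N"
    and \<sigma>: "\<sigma> \<in> carrier_mat N N" "\<sigma> * \<sigma> = 1\<^sub>m N"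
  shows "int (card {p \<in> P. \<sigma> * p * \<sigma> \<in> P}) * (\<Sum>g\<in>{p * \<sigma> * p' | p p'. p \<in> P \<and> p' \<in> P}. \<phi> (mat_trace g)) =
    int (card P) * (\<Sum>p\<in>P. \<phi> (mat_trace (\<sigma> * p)))"
proof -
  have car: "p \<in> carrier_mat N N" if "p \<in> P" for p using that sub by blast
  note assoc = assoc_mult_mat[of _ N N _ N _ N]
  have inv: "\<exists>p'\<in>P. p' * p = 1\<^sub>m N \<and> p * p' = 1\<^sub>m N" if p: "p \<in> P" for p
  proof -
    obtain p' where p': "p' \<in> carrier_mat N N" "p' * p = 1\<^sub>m N" "p * p' = 1\<^sub>m N" using invertible[OF p] by blast
    have cancel: "p' * (p * x) = x" if "x \<in> P" for x
      using assoc_mult_mat[OF p'(1) car[OF p] car[OF that]] p'(2) car[OF that] by simp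
    \<comment> \<open>Left multiplication by p is injective on the finite set P, hence onto, and
      reaches 1; so the inverse of p lies in P.\<close>
    have "inj_on ((*) p) P" by (rule inj_on_inverseI[of _ "(*) p'"]) (rule cancel)
    then have "(*) p ` P = P" using fin mult[OF p] by (intro endo_inj_surj) auto
    then obtain x where x: "x \<in> P" "p * x = 1\<^sub>m N" using one by (metis imageE)
    have "x = p' * (p * x)" using cancel[OF x(1)] by simp
    then have "x = p'" using x(2) p'(1) by simp
    then show ?thesis using x(1) p' by blast
  qed
  let ?F = "\<lambda>g. {(a, b) \<in> P \<times> P. a * \<sigma> * b = g}"
  let ?D = "{p * \<sigma> * p' | p p'. p \<in> P \<and> p' \<in> P}"
  \<comment> \<open>If x \<sigma> y = \<sigma>, then y is the inverse of \<sigma> x \<sigma>; so x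
    determines y, and x is admissible exactly when \<sigma> x \<sigma> lies in P.\<close>
  have base: "card (?F \<sigma>) = card {p \<in> P. \<sigma> * p * \<sigma> \<in> P}"
  proof -
    have eq: "(\<sigma> * x * \<sigma>) * y = \<sigma> * (x * \<sigma> * y)" if "x \<in> P" "y \<in> P" for x y
      using car[OF that(1)] car[OF that(2)] \<sigma>(1) by (simp add: assoc)
    have c\<sigma>: "\<sigma> * x * \<sigma> \<in> carrier_mat N N" if "x \<in> P" for x using car[OF that] \<sigma>(1) by simp
    have "bij_betw fst (?F \<sigma>) {p \<in> P. \<sigma> * p * \<sigma> \<in> P}"
      unfolding bij_betw_def
    proof
      show "inj_on fst (?F \<sigma>)"
      proof (rule inj_onI)
        fix u v assume "u \<in> ?F \<sigma>" "v \<in> ?F \<sigma>" "fst u = fst v"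
        then obtain x y z where uv: "u = (x, y)" "v = (x, z)" "x \<in> P" "y \<in> P" "z \<in> P"
            "x * \<sigma> * y = \<sigma>" "x * \<sigma> * z = \<sigma>" by (cases u; cases v) auto
        have "(\<sigma> * x * \<sigma>) * y = 1\<^sub>m N" "(\<sigma> * x * \<sigma>) * z = 1\<^sub>m N"
          using eq uv \<sigma>(2) by simp_all
        moreover obtain y' where "y' \<in> P" "y * y' = 1\<^sub>m N" "y' * y = 1\<^sub>m N" using inv[OF uv(4)] by blast
        ultimately have "\<sigma> * x * \<sigma> = y'" 
          using assoc_mult_mat[OF c\<sigma>[OF uv(3)] car[OF uv(4)] car] c\<sigma>[OF uv(3)] car
          by (metis left_mult_one_mat right_mult_one_mat)
        then have "y' * z = 1\<^sub>m N" using \<open>(\<sigma> * x * \<sigma>) * z = 1\<^sub>m N\<close> by simp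
        then have "y * (y' * z) = y" using car[OF uv(4)] by simp
        moreover have "y * (y' * z) = (y * y') * z"
          by (rule assoc_mult_mat[OF car[OF uv(4)] car[OF \<open>y' \<in> P\<close>] car[OF uv(5)], symmetric])
        ultimately have "y = z" using \<open>y * y' = 1\<^sub>m N\<close> car[OF uv(5)] by simp
        then show "u = v" using uv by simp
      qed
      show "fst ` ?F \<sigma> = {p \<in> P. \<sigma> * p * \<sigma> \<in> P}"
      proof (intro equalityI image_subsetI Set.subsetI)
        fix u assume "u \<in> ?F \<sigma>"
        then obtain x y where u: "u = (x, y)" "x \<in> P" "y \<in> P" "x * \<sigma> * y = \<sigma>" by (cases u) auto
        obtain y' where y': "y' \<in> P" "y * y' = 1\<^sub>m N" using inv[OF u(3)] by blast
        have one: "(\<sigma> * x * \<sigma>) * y = 1\<^sub>m N" using eq[OF u(2,3)] u(4) \<sigma>(2) by simp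
        have "\<sigma> * x * \<sigma> = (\<sigma> * x * \<sigma>) * (y * y')" unfolding y'(2) by (rule right_mult_one_mat[OF c\<sigma>[OF u(2)], symmetric])
        also have "\<dots> = (\<sigma> * x * \<sigma>) * y * y'"
          by (rule assoc_mult_mat[OF c\<sigma>[OF u(2)] car[OF u(3)] car[OF y'(1)], symmetric])
        also have "\<dots> = y'" unfolding one using car[OF y'(1)] by simp
        finally show "fst u \<in> {p \<in> P. \<sigma> * p * \<sigma> \<in> P}" using u y'(1) by simp
      next
        fix x assume "x \<in> {p \<in> P. \<sigma> * p * \<sigma> \<in> P}"
        then have x: "x \<in> P" "\<sigma> * x * \<sigma> \<in> P" by auto
        obtain y where y: "y \<in> P" "(\<sigma> * x * \<sigma>) * y = 1\<^sub>m N" using inv[OF x(2)] by blast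
        have xy: "x * \<sigma> * y \<in> carrier_mat N N" using car[OF x(1)] car[OF y(1)] \<sigma>(1) by simp
        have "x * \<sigma> * y = (\<sigma> * \<sigma>) * (x * \<sigma> * y)" unfolding \<sigma>(2) by (rule left_mult_one_mat[OF xy, symmetric])
        also have "\<dots> = \<sigma> * (\<sigma> * (x * \<sigma> * y))" by (rule assoc_mult_mat[OF \<sigma>(1) \<sigma>(1) xy])
        also have "\<dots> = \<sigma>"
          unfolding eq[OF x(1) y(1), symmetric] y(2) by (rule right_mult_one_mat[OF \<sigma>(1)])
        finally have "(x, y) \<in> ?F \<sigma>" using x y by simp
        then show "x \<in> fst ` ?F \<sigma>" by force
      qed
    qed
    then show ?thesis by (rule bij_betw_same_card)
  qed
  have fibre: "card (?F g) = card {p \<in> P. \<sigma> * p * \<sigma> \<in> P}" if gD: "g \<in> ?D" for g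
  proof -
    obtain a b where g: "g = a * \<sigma> * b" and ab: "a \<in> P" "b \<in> P" using gD by blast
    obtain a' where a': "a' \<in> P" "a' * a = 1\<^sub>m N" "a * a' = 1\<^sub>m N" using inv[OF ab(1)] by blast
    obtain b' where b': "b' \<in> P" "b' * b = 1\<^sub>m N" "b * b' = 1\<^sub>m N" using inv[OF ab(2)] by blast
    have cl: "u * (v * x) = x" if "u \<in> P" "v \<in> P" "x \<in> carrier_mat N N" "u * v = 1\<^sub>m N" for u v x
      using assoc_mult_mat[OF car[OF that(1)] car[OF that(2)] that(3)] that(3,4) by simp
    have cr: "(x * v) * u = x" if "u \<in> P" "v \<in> P" "x \<in> carrier_mat N N" "v * u = 1\<^sub>m N" for u v x
      using assoc_mult_mat[OF that(3) car[OF that(2)] car[OF that(1)]] that(3,4) by simp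
    have expand: "(u * x) * \<sigma> * (y * v) = u * (x * \<sigma> * y) * v" if "u \<in> P" "v \<in> P" "x \<in> P" "y \<in> P" for u v x y
      using car[OF that(1)] car[OF that(2)] car[OF that(3)] car[OF that(4)] \<sigma>(1) by (simp add: assoc)
    \<comment> \<open>Translation by a on the left and b on the right carries the fibre over
      \<sigma> to the fibre over a \<sigma> b.\<close>
    have "bij_betw (\<lambda>(x, y). (a * x, y * b)) (?F \<sigma>) (?F g)"
    proof (rule bij_betw_byWitness[where f' = "\<lambda>(x, y). (a' * x, y * b')"])
      show "\<forall>u\<in>?F \<sigma>. (\<lambda>(x, y). (a' * x, y * b')) ((\<lambda>(x, y). (a * x, y * b)) u) = u"
        using cl[OF a'(1) ab(1) car a'(2)] cr[OF b'(1) ab(2) car b'(3)] by auto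
      show "\<forall>u\<in>?F g. (\<lambda>(x, y). (a * x, y * b)) ((\<lambda>(x, y). (a' * x, y * b')) u) = u"
        using cl[OF ab(1) a'(1) car a'(3)] cr[OF ab(2) b'(1) car b'(2)] by auto
      show "(\<lambda>(x, y). (a * x, y * b)) ` ?F \<sigma> \<subseteq> ?F g"
        using expand[OF ab] mult ab unfolding g by auto
      show "(\<lambda>(x, y). (a' * x, y * b')) ` ?F g \<subseteq> ?F \<sigma>"
      proof (rule image_subsetI)
        fix u assume "u \<in> ?F g"
        then obtain x y where u: "u = (x, y)" "x \<in> P" "y \<in> P" "x * \<sigma> * y = g" by (cases u) auto
        have c: "a * \<sigma> \<in> carrier_mat N N" using car[OF ab(1)] \<sigma>(1) by simp
        have "(a' * x) * \<sigma> * (y * b') = a' * g * b'" using expand[OF a'(1) b'(1) u(2,3)] u(4) by simp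
        also have "\<dots> = a' * (a * \<sigma>) * b * b'"
          unfolding g using assoc_mult_mat[OF car[OF a'(1)] c car[OF ab(2)]] by simp
        also have "a' * (a * \<sigma>) = \<sigma>" by (rule cl[OF a'(1) ab(1) \<sigma>(1) a'(2)])
        also have "\<sigma> * b * b' = \<sigma>" by (rule cr[OF b'(1) ab(2) \<sigma>(1) b'(3)])
        finally show "(\<lambda>(x, y). (a' * x, y * b')) u \<in> ?F \<sigma>" using u mult a'(1) b'(1) by simp
      qed
    qed
    then have "card (?F \<sigma>) = card (?F g)" by (rule bij_betw_same_card)
    then show ?thesis using base by simp
  qed
  have D_image: "?D = (\<lambda>(a, b). a * \<sigma> * b) ` (P \<times> P)" by auto
  then have finD: "finite ?D" using fin by simp
  have "(\<Sum>(a, b)\<in>P \<times> P. \<phi> (mat_trace (a * \<sigma> * b))) =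
      (\<Sum>g\<in>?D. \<Sum>u\<in>{u \<in> P \<times> P. (\<lambda>(a, b). a * \<sigma> * b) u = g}. (\<lambda>(a, b). \<phi> (mat_trace (a * \<sigma> * b))) u)"
    using fin finD D_image by (intro sum.group[symmetric]) auto
  also have "\<dots> = (\<Sum>g\<in>?D. int (card {p \<in> P. \<sigma> * p * \<sigma> \<in> P}) * \<phi> (mat_trace g))"
  proof (rule sum.cong[OF refl])
    fix g assume g: "g \<in> ?D"
    have "{u \<in> P \<times> P. (\<lambda>(a, b). a * \<sigma> * b) u = g} = ?F g" by auto
    moreover have "(\<Sum>u\<in>?F g. (\<lambda>(a, b). \<phi> (mat_trace (a * \<sigma> * b))) u) = (\<Sum>u\<in>?F g. \<phi> (mat_trace g))"
      by (intro sum.cong) auto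
    ultimately show "(\<Sum>u\<in>{u \<in> P \<times> P. (\<lambda>(a, b). a * \<sigma> * b) u = g}. (\<lambda>(a, b). \<phi> (mat_trace (a * \<sigma> * b))) u) =
        int (card {p \<in> P. \<sigma> * p * \<sigma> \<in> P}) * \<phi> (mat_trace g)"
      using fibre[OF g] by simp
  qed
  finally have left: "(\<Sum>(a, b)\<in>P \<times> P. \<phi> (mat_trace (a * \<sigma> * b))) =
      int (card {p \<in> P. \<sigma> * p * \<sigma> \<in> P}) * (\<Sum>g\<in>?D. \<phi> (mat_trace g))"
    by (simp add: sum_distrib_left)
  have "(\<Sum>(a, b)\<in>P \<times> P. \<phi> (mat_trace (a * \<sigma> * b))) = (\<Sum>a\<in>P. \<Sum>b\<in>P. \<phi> (mat_trace (a * \<sigma> * b)))"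
    by (rule sum.cartesian_product[symmetric])
  also have "\<dots> = (\<Sum>a\<in>P. \<Sum>p\<in>P. \<phi> (mat_trace (\<sigma> * p)))"
  proof (rule sum.cong[OF refl])
    fix a assume a: "a \<in> P"
    obtain a' where a': "a' \<in> P" "a' * a = 1\<^sub>m N" "a * a' = 1\<^sub>m N" using inv[OF a] by blast
    \<comment> \<open>The trace of a \<sigma> b is that of \<sigma> b a, and b -> b a permutes P, so
      the inner sum is independent of a.\<close>
    have tr: "mat_trace (a * \<sigma> * b) = mat_trace (\<sigma> * (b * a))" if "b \<in> P" for b
    proof -
      note c = car[OF a] car[OF that]
      have "\<sigma> * b \<in> carrier_mat N N" using c \<sigma>(1) by simp
      then have "mat_trace (a * (\<sigma> * b)) = mat_trace ((\<sigma> * b) * a)" by (rule mat_trace_comm[OF c(1)])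
      then show ?thesis using c \<sigma>(1) by (simp add: assoc)
    qed
    have "(\<Sum>b\<in>P. \<phi> (mat_trace (a * \<sigma> * b))) = (\<Sum>b\<in>P. \<phi> (mat_trace (\<sigma> * (b * a))))"
      by (rule sum.cong[OF refl]) (simp add: tr)
    also have "\<dots> = (\<Sum>p\<in>P. \<phi> (mat_trace (\<sigma> * p)))"
    proof (rule sum.reindex_bij_witness[where i = "\<lambda>p. p * a'" and j = "\<lambda>b. b * a"])
      fix b assume b: "b \<in> P"
      show "b * a * a' = b" using assoc_mult_mat[OF car[OF b] car[OF a] car[OF a'(1)]] a'(3) car[OF b] by simp
      show "b * a' * a = b" using assoc_mult_mat[OF car[OF b] car[OF a'(1)] car[OF a]] a'(2) car[OF b] by simp
      show "b * a \<in> P" "b * a' \<in> P" using mult b a a'(1) by auto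
    qed simp
    finally show "(\<Sum>b\<in>P. \<phi> (mat_trace (a * \<sigma> * b))) = (\<Sum>p\<in>P. \<phi> (mat_trace (\<sigma> * p)))" .
  qed
  also have "\<dots> = int (card P) * (\<Sum>p\<in>P. \<phi> (mat_trace (\<sigma> * p)))" by simp
  finally show ?thesis using left by simp
qed

section \<open>The parabolic subgroup\<close>

definition Pmat :: "nat \<Rightarrow> ('a::field mat \<times> 'a mat) \<times> 'a mat \<Rightarrow> 'a mat" where
  "Pmat n x = (case x of ((A, A'), B) \<Rightarrow> four_block_mat A (A * B) (0\<^sub>m n n) (A'\<^sup>T))"

lemma P_plus_eq: "P_plus n = Pmat n ` (GLp n \<times> {B. alternating_mat n (B :: 'a::field mat)})"
proof -
  have eq: "four_block_mat A (0\<^sub>m n n) (0\<^sub>m n n) (A'\<^sup>T) * four_block_mat (1\<^sub>m n) B (0\<^sub>m n n) (1\<^sub>m n) = Pmat n ((A, A'), B)"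
    if "A \<in> carrier_mat n n" "A' \<in> carrier_mat n n" "B \<in> carrier_mat n n" for A A' B :: "'a mat"
  proof -
    have "four_block_mat A (0\<^sub>m n n) (0\<^sub>m n n) (A'\<^sup>T) * four_block_mat (1\<^sub>m n) B (0\<^sub>m n n) (1\<^sub>m n) =
        four_block_mat (A * 1\<^sub>m n + 0\<^sub>m n n * 0\<^sub>m n n) (A * B + 0\<^sub>m n n * 1\<^sub>m n)
          (0\<^sub>m n n * 1\<^sub>m n + A'\<^sup>T * 0\<^sub>m n n) (0\<^sub>m n n * B + A'\<^sup>T * 1\<^sub>m n)"
      using that by (intro mult_four_block_mat) auto
    then show ?thesis using that by (simp add: Pmat_def)
  qed
  have "(P_plus n :: 'a mat set) = {Pmat n ((A, A'), B) | A A' B. (A, A') \<in> GLp n \<and> alternating_mat n B}"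
    unfolding P_plus_def
  proof (intro Collect_cong iffI)
    fix p :: "'a mat" assume "\<exists>A A' B. p = four_block_mat A (0\<^sub>m n n) (0\<^sub>m n n) (A'\<^sup>T) * four_block_mat (1\<^sub>m n) B (0\<^sub>m n n) (1\<^sub>m n) \<and>
      A \<in> carrier_mat n n \<and> A' \<in> carrier_mat n n \<and> inverts_mat A A' \<and> inverts_mat A' A \<and> alternating_mat n B"
    then obtain A A' B where p: "p = four_block_mat A (0\<^sub>m n n) (0\<^sub>m n n) (A'\<^sup>T) * four_block_mat (1\<^sub>m n) B (0\<^sub>m n n) (1\<^sub>m n)"
      "A \<in> carrier_mat n n" "A' \<in> carrier_mat n n" "inverts_mat A A'" "inverts_mat A' A" "alternating_mat n B" by blast
    have "p = Pmat n ((A, A'), B)" using p eq alternatingD(1)[OF p(6)] by simp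
    moreover have "(A, A') \<in> GLp n" using p by (simp add: GLp_def inverts_mat_def)
    ultimately show "\<exists>A A' B. p = Pmat n ((A, A'), B) \<and> (A, A') \<in> GLp n \<and> alternating_mat n B" using p(6) by blast
  next
    fix p :: "'a mat" assume "\<exists>A A' B. p = Pmat n ((A, A'), B) \<and> (A, A') \<in> GLp n \<and> alternating_mat n B"
    then obtain A A' B where p: "p = Pmat n ((A, A'), B)" "(A, A') \<in> GLp n" "alternating_mat n B" by blast
    note D = GLpD[OF p(2)]
    have "p = four_block_mat A (0\<^sub>m n n) (0\<^sub>m n n) (A'\<^sup>T) * four_block_mat (1\<^sub>m n) B (0\<^sub>m n n) (1\<^sub>m n)"
      using p(1) eq D(1,2) alternatingD(1)[OF p(3)] by simp
    moreover have "inverts_mat A A'" "inverts_mat A' A" using D by (auto simp: inverts_mat_def)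
    ultimately show "\<exists>A A' B. p = four_block_mat A (0\<^sub>m n n) (0\<^sub>m n n) (A'\<^sup>T) * four_block_mat (1\<^sub>m n) B (0\<^sub>m n n) (1\<^sub>m n) \<and>
      A \<in> carrier_mat n n \<and> A' \<in> carrier_mat n n \<and> inverts_mat A A' \<and> inverts_mat A' A \<and> alternating_mat n B"
      using D(1,2) p(3) by blast
  qed
  also have "\<dots> = Pmat n ` (GLp n \<times> {B. alternating_mat n B})" by (auto simp: image_iff)
  finally show ?thesis .
qed

lemma Pmat_carrier: "(A, A') \<in> GLp n \<Longrightarrow> Pmat n ((A, A'), B) \<in> carrier_mat (n + n) (n + n)"
  using GLpD(1,2)[of A A' n] by (auto simp: Pmat_def)

lemma Pmat_index:
  assumes "(A, A') \<in> GLp n" "alternating_mat n B" "i < n" "j < n"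
  shows "Pmat n ((A, A'), B) $$ (i, j) = A $$ (i, j)" "Pmat n ((A, A'), B) $$ (i, n + j) = (A * B) $$ (i, j)"
    "Pmat n ((A, A'), B) $$ (n + i, j) = 0" "Pmat n ((A, A'), B) $$ (n + i, n + j) = A' $$ (j, i)"
  using assms GLpD(1,2)[OF assms(1)] alternatingD(1)[OF assms(2)] by (auto simp: Pmat_def)

text \<open>The upper left block A determines its inverse A', and then A B determines B.\<close>

lemma inj_on_Pmat: "inj_on (Pmat n) (GLp n \<times> {B. alternating_mat n (B :: 'a::field mat)})"
proof (rule inj_onI)
  fix x y :: "('a mat \<times> 'a mat) \<times> 'a mat"
  assume "x \<in> GLp n \<times> {B. alternating_mat n B}" "y \<in> GLp n \<times> {B. alternating_mat n B}" and eq: "Pmat n x = Pmat n y"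
  then obtain A A' B C C' D where x: "x = ((A, A'), B)" "(A, A') \<in> GLp n" "alternating_mat n B"
    and y: "y = ((C, C'), D)" "(C, C') \<in> GLp n" "alternating_mat n D" by auto
  note G = GLpD[OF x(2)] GLpD[OF y(2)] and BD = alternatingD(1)[OF x(3)] alternatingD(1)[OF y(3)]
  have "A = C" using G Pmat_index(1)[OF x(2,3)] Pmat_index(1)[OF y(2,3)] eq x(1) y(1) by (intro eq_matI) auto
  then have "A' = C'" using GLp_inverse_unique x(2) y(2) by blast
  have "A * B = A * D"
    using G BD Pmat_index(2)[OF x(2,3)] Pmat_index(2)[OF y(2,3)] eq x(1) y(1) \<open>A = C\<close>
    by (intro eq_matI) auto
  then have "A' * (A * B) = A' * (A * D)" by simp
  then have "(A' * A) * B = (A' * A) * D"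
    using assoc_mult_mat[OF G(2,1) BD(1)] assoc_mult_mat[OF G(2,1) BD(2)] by simp
  then have "B = D" unfolding G(4) using BD by simp
  then show "x = y" using x y \<open>A = C\<close> \<open>A' = C'\<close> by simp
qed

lemma finite_P_plus: "finite (P_plus n :: 'a::{field,finite} mat set)"
  unfolding P_plus_eq by (intro finite_imageI finite_cartesian_product finite_GLp finite_alternating)

lemma card_P_plus: "card (P_plus n :: 'a::{field,finite} mat set) = card (nonsing n :: 'a mat set) * CARD('a) ^ (\<Sum>j<n. j)"
  unfolding P_plus_eq card_image[OF inj_on_Pmat] by (simp add: card_cartesian_product card_GLp card_alternating)

definition Emat :: "nat \<Rightarrow> 'a::field mat" where
  "Emat n = four_block_mat (0\<^sub>m n n) (1\<^sub>m n) (0\<^sub>m n n) (0\<^sub>m n n)"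

lemma Emat_carrier [simp]: "Emat n \<in> carrier_mat (n + n) (n + n)"
  unfolding Emat_def by simp

text \<open>In characteristic two this says that \<open>g\<close> preserves the quadratic form with matrix \<open>Emat n\<close>.\<close>

definition preserves_form :: "nat \<Rightarrow> 'a::field mat \<Rightarrow> bool" where
  "preserves_form n g \<longleftrightarrow> alternating_mat (n + n) (g\<^sup>T * Emat n * g + Emat n)"

context char2_field
begin

text \<open>The defect of g h is the defect of g transformed by congruence with h, plus the defect
  of h; both are alternating.\<close>

lemma preserves_form_mult:
  assumes g: "(g :: 'a mat) \<in> carrier_mat (n + n) (n + n)" "preserves_form n g"
    and h: "h \<in> carrier_mat (n + n) (n + n)" "preserves_form n h"
  shows "preserves_form n (g * h)"
proof -
  let ?N = "n + n" and ?E = "Emat n :: 'a mat"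
  have E: "?E \<in> carrier_mat ?N ?N" by simp
  let ?K = "g\<^sup>T * ?E * g" and ?H = "h\<^sup>T * ?E * h"
  have t: "g\<^sup>T \<in> carrier_mat ?N ?N" "h\<^sup>T \<in> carrier_mat ?N ?N" using g h by auto
  have M: "g\<^sup>T * ?E \<in> carrier_mat ?N ?N" by (rule mult_carrier_mat[OF t(1) E])
  have K: "?K \<in> carrier_mat ?N ?N" by (rule mult_carrier_mat[OF M g(1)])
  have H: "?H \<in> carrier_mat ?N ?N" by (rule mult_carrier_mat[OF mult_carrier_mat[OF t(2) E] h(1)])
  have hK: "h\<^sup>T * ?K * h \<in> carrier_mat ?N ?N" by (rule mult_carrier_mat[OF mult_carrier_mat[OF t(2) K] h(1)])
  have "alternating_mat ?N (h\<^sup>T * (?K + ?E) * h)"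
    using g(2) h(1) alternating_congruence unfolding preserves_form_def by blast
  moreover have "alternating_mat ?N (?H + ?E)" using h(2) unfolding preserves_form_def .
  ultimately have alt: "alternating_mat ?N (h\<^sup>T * (?K + ?E) * h + (?H + ?E))" by (rule alternating_add)
  have "h\<^sup>T * (?K + ?E) * h = (h\<^sup>T * ?K + h\<^sup>T * ?E) * h"
    by (simp only: mult_add_distrib_mat[OF t(2) K E])
  also have "\<dots> = h\<^sup>T * ?K * h + ?H"
    by (rule add_mult_distrib_mat[OF mult_carrier_mat[OF t(2) K] mult_carrier_mat[OF t(2) E] h(1)])
  finally have "h\<^sup>T * (?K + ?E) * h + (?H + ?E) = h\<^sup>T * ?K * h + (?H + ?H) + ?E"
    by (simp only: assoc_add_mat[OF hK H add_carrier_mat[OF E]] assoc_add_mat[OF hK add_carrier_mat[OF H] E]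
        assoc_add_mat[OF H H E])
  also have "\<dots> = h\<^sup>T * ?K * h + ?E"
    by (simp only: mat_add_self[OF H] right_add_zero_mat[OF hK])
  also have "h\<^sup>T * ?K * h = (g * h)\<^sup>T * ?E * (g * h)"
  proof -
    have "h\<^sup>T * ?K * h = h\<^sup>T * (g\<^sup>T * ?E * (g * h))"
      by (simp only: assoc_mult_mat[OF t(2) K h(1)] assoc_mult_mat[OF M g(1) h(1)])
    also have "\<dots> = h\<^sup>T * (g\<^sup>T * ?E) * (g * h)"
      by (rule assoc_mult_mat[OF t(2) M mult_carrier_mat[OF g(1) h(1)], symmetric])
    also have "h\<^sup>T * (g\<^sup>T * ?E) = (g * h)\<^sup>T * ?E"
      unfolding transpose_mult[OF g(1) h(1)] by (rule assoc_mult_mat[OF t(2,1) E, symmetric])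
    finally show ?thesis .
  qed
  finally show ?thesis using alt unfolding preserves_form_def by (simp only:)
qed

lemma form_four_block:
  assumes G: "(G1 :: 'a mat) \<in> carrier_mat n n" "G2 \<in> carrier_mat n n" "G4 \<in> carrier_mat n n"
  defines "g \<equiv> four_block_mat G1 G2 (0\<^sub>m n n) G4"
  shows "g\<^sup>T * Emat n * g + Emat n = four_block_mat (0\<^sub>m n n) (G1\<^sup>T * G4 + 1\<^sub>m n) (0\<^sub>m n n) (G2\<^sup>T * G4)"
proof -
  have t: "G1\<^sup>T \<in> carrier_mat n n" "G2\<^sup>T \<in> carrier_mat n n" "G4\<^sup>T \<in> carrier_mat n n" using G by auto
  have z: "0\<^sub>m n n \<in> carrier_mat n n" "1\<^sub>m n \<in> carrier_mat n n" by auto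
  have p: "G1\<^sup>T * G4 \<in> carrier_mat n n" "G2\<^sup>T * G4 \<in> carrier_mat n n" using t G by auto
  have "g\<^sup>T = four_block_mat (G1\<^sup>T) (0\<^sub>m n n) (G2\<^sup>T) (G4\<^sup>T)"
    unfolding g_def using transpose_four_block_mat[OF G(1,2) z(1) G(3)] by simp
  then have "g\<^sup>T * Emat n = four_block_mat (0\<^sub>m n n) (G1\<^sup>T) (0\<^sub>m n n) (G2\<^sup>T)"
    unfolding Emat_def using mult_four_block_mat[OF t(1) z(1) t(2,3) z(1) z(2) z(1) z(1)] t by simp
  then have "g\<^sup>T * Emat n * g = four_block_mat (0\<^sub>m n n) (G1\<^sup>T * G4) (0\<^sub>m n n) (G2\<^sup>T * G4)"
    unfolding g_def using mult_four_block_mat[OF z(1) t(1) z(1) t(2) G(1,2) z(1) G(3)] t G p by simp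
  then show ?thesis
    unfolding Emat_def using add_four_block_mat[OF z(1) p(1) z(1) p(2) z(1) z(2) z(1) z(1)] p by simp
qed

text \<open>P is the stabilizer, inside the group of the quadratic form, of the subspace spanned by
  the first n coordinates. With this description products and conjugates by \<sigma> only require a
  look at the lower left block.\<close>

lemma P_plus_iff:
  "g \<in> P_plus n \<longleftrightarrow> (g :: 'a mat) \<in> carrier_mat (n + n) (n + n) \<and> (\<forall>i<n. \<forall>j<n. g $$ (n + i, j) = 0) \<and> preserves_form n g"
proof
  assume "g \<in> P_plus n"
  then obtain A A' B where g: "g = Pmat n ((A, A'), B)" and G: "(A, A') \<in> GLp n" and B: "alternating_mat n B"
    unfolding P_plus_eq by auto
  note D = GLpD[OF G] and Bc = alternatingD(1)[OF B]
  have t: "A\<^sup>T \<in> carrier_mat n n" "A'\<^sup>T \<in> carrier_mat n n" "A * B \<in> carrier_mat n n" using D Bc by auto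
  have "A\<^sup>T * A'\<^sup>T = 1\<^sub>m n" using transpose_mult[OF D(2,1)] D(4) by simp
  moreover have "(A * B)\<^sup>T * A'\<^sup>T = B\<^sup>T"
  proof -
    have "(A * B)\<^sup>T * A'\<^sup>T = (A' * (A * B))\<^sup>T" using transpose_mult[OF D(2) t(3)] by simp
    also have "A' * (A * B) = B" using assoc_mult_mat[OF D(2,1) Bc] D(4) Bc by simp
    finally show ?thesis .
  qed
  moreover have "B\<^sup>T = B" using B by (simp add: alternating_mat_def)
  ultimately have form: "g\<^sup>T * Emat n * g + Emat n = four_block_mat (0\<^sub>m n n) (1\<^sub>m n + 1\<^sub>m n) (0\<^sub>m n n) B"
    using form_four_block[OF D(1) t(3,2)] by (simp add: g Pmat_def)
  have "alternating_mat (n + n) (four_block_mat (0\<^sub>m n n) (1\<^sub>m n + 1\<^sub>m n) (0\<^sub>m n n) B)"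
    using alternatingD(2,3)[OF B] Bc by (intro alternatingI) auto
  then have "preserves_form n g" unfolding preserves_form_def form .
  moreover have "\<forall>i<n. \<forall>j<n. g $$ (n + i, j) = 0" using Pmat_index(3)[OF G B] g by simp
  ultimately show "g \<in> carrier_mat (n + n) (n + n) \<and> (\<forall>i<n. \<forall>j<n. g $$ (n + i, j) = 0) \<and> preserves_form n g"
    using Pmat_carrier[OF G] g by simp
next
  assume "g \<in> carrier_mat (n + n) (n + n) \<and> (\<forall>i<n. \<forall>j<n. g $$ (n + i, j) = 0) \<and> preserves_form n g"
  then have g: "g \<in> carrier_mat (n + n) (n + n)" "\<forall>i<n. \<forall>j<n. g $$ (n + i, j) = 0" "preserves_form n g" by auto
  define G1 G2 G4 where "G1 = blk g 0 0 n n" and "G2 = blk g 0 n n n" and "G4 = blk g n n n n"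
  have G: "G1 \<in> carrier_mat n n" "G2 \<in> carrier_mat n n" "G4 \<in> carrier_mat n n"
    by (simp_all add: G1_def G2_def G4_def)
  have "blk g n 0 n n = 0\<^sub>m n n" using g(2) by (intro eq_matI) (auto simp: blk_def)
  then have g_eq: "g = four_block_mat G1 G2 (0\<^sub>m n n) G4"
    using four_block_blk[OF g(1)] by (simp add: G1_def G2_def G4_def)
  let ?X = "four_block_mat (0\<^sub>m n n) (G1\<^sup>T * G4 + 1\<^sub>m n) (0\<^sub>m n n) (G2\<^sup>T * G4)"
  have "alternating_mat (n + n) ?X"
    using g(3) form_four_block[OF G] unfolding preserves_form_def g_eq by simp
  note X = alternatingD[OF this]
  have t: "G1\<^sup>T * G4 \<in> carrier_mat n n" "G2\<^sup>T * G4 \<in> carrier_mat n n" "G4\<^sup>T \<in> carrier_mat n n" using G by auto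
  \<comment> \<open>Symmetry of \<open>?X\<close> equates its upper right block with the transpose
    of the zero block at lower left, so G4 is the inverse transpose of G1. The lower right block
    later shows that B is alternating.\<close>
  have one: "G1\<^sup>T * G4 = 1\<^sub>m n"
  proof (rule eq_matI)
    fix i j assume "i < dim_row (1\<^sub>m n :: 'a mat)" "j < dim_col (1\<^sub>m n :: 'a mat)"
    then have ij: "i < n" "j < n" by auto
    have "?X $$ (i, n + j) = (G1\<^sup>T * G4) $$ (i, j) + (1\<^sub>m n :: 'a mat) $$ (i, j)"
      using ij t by simp
    moreover have "?X $$ (n + j, i) = 0" using ij t G by simp
    moreover have "?X $$ (i, n + j) = ?X $$ (n + j, i)" using X(2)[of i "n + j"] ij by simp
    ultimately have "(G1\<^sup>T * G4) $$ (i, j) + (1\<^sub>m n :: 'a mat) $$ (i, j) = 0" by metis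
    then show "(G1\<^sup>T * G4) $$ (i, j) = (1\<^sub>m n :: 'a mat) $$ (i, j)" by (simp only: add_eq_0)
  qed (use G in simp_all)
  have "G4\<^sup>T * G1 = (G1\<^sup>T * G4)\<^sup>T" using transpose_mult[of "G1\<^sup>T" n n G4 n] G by simp
  then have G4G1: "G4\<^sup>T * G1 = 1\<^sub>m n" using one by simp
  then have "(G1, G4\<^sup>T) \<in> GLp n" using mat_mult_left_right_inverse[OF t(3) G(1)] G t by (simp add: GLp_def)
  moreover define B where "B = G4\<^sup>T * G2"
  have Bt: "B = (G2\<^sup>T * G4)\<^sup>T" using transpose_mult[of "G2\<^sup>T" n n G4 n] G by (simp add: B_def)
  have "alternating_mat n B"
  proof (rule alternatingI)
    show "B \<in> carrier_mat n n" using G t by (simp add: B_def)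
    have entry: "B $$ (i, j) = ?X $$ (n + j, n + i)" if "i < n" "j < n" for i j
      unfolding Bt using that t G by simp
    show "B $$ (i, j) = B $$ (j, i)" if "i < n" "j < n" for i j
      using entry that X(2)[of "n + j" "n + i"] by simp
    show "B $$ (i, i) = 0" if "i < n" for i using entry that X(3)[of "n + i"] by simp
  qed
  moreover have "G1 * B = G2"
  proof -
    have "G1 * B = (G1 * G4\<^sup>T) * G2" unfolding B_def by (rule assoc_mult_mat[OF G(1) t(3) G(2), symmetric])
    also have "G1 * G4\<^sup>T = 1\<^sub>m n" using mat_mult_left_right_inverse[OF t(3) G(1) G4G1] .
    finally show ?thesis using G by simp
  qed
  ultimately have "g = Pmat n ((G1, G4\<^sup>T), B)" "(G1, G4\<^sup>T) \<in> GLp n" "alternating_mat n B"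
    unfolding Pmat_def using g_eq by auto
  then show "g \<in> P_plus n" unfolding P_plus_eq by blast
qed

lemma P_plus_mult: "p \<in> P_plus n \<Longrightarrow> p' \<in> P_plus n \<Longrightarrow> p * p' \<in> (P_plus n :: 'a mat set)"
proof -
  assume p: "p \<in> P_plus n" and p': "p' \<in> (P_plus n :: 'a mat set)"
  note D = p[unfolded P_plus_iff] p'[unfolded P_plus_iff]
  have "(p * p') $$ (n + i, j) = 0" if "i < n" "j < n" for i j
  proof -
    have "(p * p') $$ (n + i, j) = (\<Sum>k<n + n. p $$ (n + i, k) * p' $$ (k, j))"
      using D that by (intro index_mult_mat_sum[of _ "n + n" "n + n" _ "n + n"]) auto
    also have "\<dots> = 0" unfolding sum_lessThan_add using D that by simp
    finally show ?thesis .
  qed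
  then show ?thesis unfolding P_plus_iff using D preserves_form_mult by auto
qed

lemma P_plus_invertible:
  assumes "p \<in> (P_plus n :: 'a mat set)"
  shows "\<exists>p'\<in>carrier_mat (n + n) (n + n). p' * p = 1\<^sub>m (n + n) \<and> p * p' = 1\<^sub>m (n + n)"
proof -
  obtain A A' B where p: "p = Pmat n ((A, A'), B)" and G: "(A, A') \<in> GLp n" and B: "alternating_mat n B"
    using assms unfolding P_plus_eq by auto
  note D = GLpD[OF G] and Bc = alternatingD(1)[OF B]
  have At: "A'\<^sup>T \<in> carrier_mat n n" using D by simp
  have "A'\<^sup>T * A\<^sup>T = 1\<^sub>m n" using transpose_mult[OF D(1,2)] D(3) by simp
  then have "det (A'\<^sup>T) \<noteq> 0" using D by (intro right_inverse_det_neq_0[of _ n "A\<^sup>T"]) auto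
  moreover have "det A \<noteq> 0" using right_inverse_det_neq_0[OF D(1,2,3)] .
  moreover have "det p = det A * det (A'\<^sup>T)"
    unfolding p Pmat_def prod.case
    by (rule det_four_block_mat_lower_left_zero) (use D Bc At in auto)
  ultimately have "det p \<noteq> 0" by simp
  moreover have pc: "p \<in> carrier_mat (n + n) (n + n)" unfolding p by (rule Pmat_carrier[OF G])
  ultimately show ?thesis using det_neq_0_obtain_inverse[OF pc] by metis
qed

lemma one_P_plus: "1\<^sub>m (n + n) \<in> (P_plus n :: 'a mat set)"
proof -
  have "(1\<^sub>m n, 1\<^sub>m n) \<in> (GLp n :: ('a mat \<times> 'a mat) set)" by (simp add: GLp_def)
  moreover have "alternating_mat n (0\<^sub>m n n :: 'a mat)" by (rule alternatingI) auto
  moreover have "Pmat n ((1\<^sub>m n, 1\<^sub>m n), 0\<^sub>m n n) = (1\<^sub>m (n + n) :: 'a mat)" by (simp add: Pmat_def)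
  ultimately show ?thesis unfolding P_plus_eq by (metis (no_types, lifting) image_eqI mem_Collect_eq mem_Sigma_iff)
qed

end

section \<open>Character sums over the double cosets\<close>

text \<open>\<open>sigma_plus n s\<close> is the permutation matrix of this involution, so
  multiplying by it only renames rows or columns.\<close>

definition sperm :: "nat \<Rightarrow> nat \<Rightarrow> nat \<Rightarrow> nat" where
  "sperm n s i = (if i < s then i + n else if n \<le> i \<and> i < n + s then i - n else i)"

lemma sperm_less: "s \<le> n \<Longrightarrow> i < n + n \<Longrightarrow> sperm n s i < n + n"
  by (auto simp: sperm_def)

lemma sperm_sperm: "s \<le> n \<Longrightarrow> sperm n s (sperm n s i) = i"
  by (auto simp: sperm_def)

lemma sigma_plus_eq:
  assumes "s \<le> n"
  shows "sigma_plus n s = mat (n + n) (n + n) (\<lambda>(i, j). of_bool (j = sperm n s i) :: 'a::field)"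
proof -
  define E :: "'a mat" where "E = four_block_mat (0\<^sub>m s s) (0\<^sub>m s (n - s)) (0\<^sub>m (n - s) s) (1\<^sub>m (n - s))"
  define F :: "'a mat" where "F = four_block_mat (1\<^sub>m s) (0\<^sub>m s (n - s)) (0\<^sub>m (n - s) s) (0\<^sub>m (n - s) (n - s))"
  have dims: "dim_row E = n" "dim_col E = n" "dim_row F = n" "dim_col F = n"
    using assms by (simp_all add: E_def F_def)
  have E: "E $$ (i, j) = of_bool (s \<le> i \<and> j = i)" and F: "F $$ (i, j) = of_bool (i < s \<and> j = i)"
    if "i < n" "j < n" for i j
    using assms that by (auto simp: E_def F_def)
  show ?thesis
    unfolding sigma_plus_def Let_def E_def[symmetric] F_def[symmetric]
  proof (rule eq_matI)
    fix i j assume "i < dim_row (mat (n + n) (n + n) (\<lambda>(i, j). of_bool (j = sperm n s i) :: 'a))"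
      "j < dim_col (mat (n + n) (n + n) (\<lambda>(i, j). of_bool (j = sperm n s i) :: 'a))"
    then have ij: "i < n + n" "j < n + n" by simp_all
    consider "i < n" "j < n" | "i < n" "n \<le> j" | "n \<le> i" "j < n" | "n \<le> i" "n \<le> j" by linarith
    then have "four_block_mat E F F E $$ (i, j) = of_bool (j = sperm n s i)"
    proof cases
      case 1
      then show ?thesis using assms by (auto simp: dims E sperm_def)
    next
      case 2
      then have "F $$ (i, j - n) = of_bool (i < s \<and> j - n = i)" using ij by (intro F) auto
      then show ?thesis using 2 ij assms by (auto simp: dims sperm_def)
    next
      case 3
      then have "F $$ (i - n, j) = of_bool (i - n < s \<and> j = i - n)" using ij by (intro F) auto
      then show ?thesis using 3 ij assms by (auto simp: dims sperm_def)
    next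
      case 4
      then have "E $$ (i - n, j - n) = of_bool (s \<le> i - n \<and> j - n = i - n)" using ij by (intro E) auto
      then show ?thesis using 4 ij assms by (auto simp: dims sperm_def)
    qed
    then show "four_block_mat E F F E $$ (i, j) = mat (n + n) (n + n) (\<lambda>(i, j). of_bool (j = sperm n s i) :: 'a) $$ (i, j)"
      using ij by simp
  qed (simp_all add: dims)
qed

lemma sigma_plus_carrier: "s \<le> n \<Longrightarrow> sigma_plus n s \<in> carrier_mat (n + n) (n + n)"
  by (simp add: sigma_plus_eq)

lemma sigma_mult_index:
  assumes "s \<le> n" "(M :: 'a::field mat) \<in> carrier_mat (n + n) k" "i < n + n" "j < k"
  shows "(sigma_plus n s * M) $$ (i, j) = M $$ (sperm n s i, j)"
proof -
  have "(sigma_plus n s * M) $$ (i, j) = (\<Sum>l<n + n. sigma_plus n s $$ (i, l) * M $$ (l, j))"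
    by (rule index_mult_mat_sum[OF sigma_plus_carrier[OF assms(1)] assms(2-4)])
  also have "\<dots> = (\<Sum>l<n + n. if l = sperm n s i then M $$ (l, j) else 0)"
    using assms(1,3) by (intro sum.cong) (auto simp: sigma_plus_eq)
  also have "\<dots> = M $$ (sperm n s i, j)" using sperm_less[OF assms(1,3)] by simp
  finally show ?thesis .
qed

lemma mult_sigma_index:
  assumes "s \<le> n" "(M :: 'a::field mat) \<in> carrier_mat k (n + n)" "i < k" "j < n + n"
  shows "(M * sigma_plus n s) $$ (i, j) = M $$ (i, sperm n s j)"
proof -
  have "(M * sigma_plus n s) $$ (i, j) = (\<Sum>l<n + n. M $$ (i, l) * sigma_plus n s $$ (l, j))"
    by (rule index_mult_mat_sum[OF assms(2) sigma_plus_carrier[OF assms(1)] assms(3,4)])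
  also have "\<dots> = (\<Sum>l<n + n. if l = sperm n s j then M $$ (i, l) else 0)"
  proof (rule sum.cong[OF refl])
    fix l assume "l \<in> {..<n + n}"
    moreover have "j = sperm n s l \<longleftrightarrow> l = sperm n s j" using sperm_sperm[OF assms(1)] by metis
    ultimately show "M $$ (i, l) * sigma_plus n s $$ (l, j) = (if l = sperm n s j then M $$ (i, l) else 0)"
      using assms(1,4) by (simp add: sigma_plus_eq)
  qed
  also have "\<dots> = M $$ (i, sperm n s j)" using sperm_less[OF assms(1,4)] by simp
  finally show ?thesis .
qed

lemma sigma_plus_involution:
  assumes "s \<le> n"
  shows "sigma_plus n s * sigma_plus n s = (1\<^sub>m (n + n) :: 'a::field mat)"
proof (rule eq_matI)
  fix i j assume "i < dim_row (1\<^sub>m (n + n) :: 'a mat)" "j < dim_col (1\<^sub>m (n + n) :: 'a mat)"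
  then have ij: "i < n + n" "j < n + n" by auto
  have "(sigma_plus n s * sigma_plus n s) $$ (i, j) = (sigma_plus n s :: 'a mat) $$ (sperm n s i, j)"
    by (rule sigma_mult_index[OF assms sigma_plus_carrier[OF assms] ij])
  also have "\<dots> = of_bool (j = i)"
    using sperm_less[OF assms ij(1)] ij(2) by (simp add: sigma_plus_eq[OF assms] sperm_sperm[OF assms])
  finally show "(sigma_plus n s * sigma_plus n s) $$ (i, j) = (1\<^sub>m (n + n) :: 'a mat) $$ (i, j)"
    using ij by simp
qed (use sigma_plus_carrier[OF assms, where 'a = 'a] in auto)

lemma ltmat_index:
  assumes "(X, X') \<in> GLp s" "(Y, Y') \<in> GLp m" "(Z :: 'a::field mat) \<in> carrier_mat m s"
    and A: "ltmat ((X, X'), (Y, Y'), Z) s m = (A, A')"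
  shows "i < s \<Longrightarrow> j < s \<Longrightarrow> A $$ (i, j) = X $$ (i, j)"
    "i < s \<Longrightarrow> j < m \<Longrightarrow> A' $$ (i, s + j) = 0"
    "i < m \<Longrightarrow> j < m \<Longrightarrow> A $$ (s + i, s + j) = Y $$ (i, j)"
    "i < m \<Longrightarrow> j < m \<Longrightarrow> A' $$ (s + i, s + j) = Y' $$ (i, j)"
  using GLpD(1,2)[OF assms(1)] GLpD(1,2)[OF assms(2)] assms(3) A by (auto simp: ltmat_def)

lemma lowtriE:
  assumes "(A, A') \<in> lowtri s m"
  obtains X X' Y Y' Z where "(X, X') \<in> GLp s" "(Y, Y') \<in> GLp m" "Z \<in> carrier_mat m s"
    "ltmat ((X, X'), (Y, Y'), Z) s m = (A, A')"
proof -
  have "(A, A') \<in> (\<lambda>x. ltmat x s m) ` (GLp s \<times> GLp m \<times> carrier_mat m s)"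
    using assms bij_betw_imp_surj_on[OF bij_betw_ltmat] by blast
  then show ?thesis using that by auto
qed

text \<open>The corner of A B is X times the corner of B, where X is the invertible upper left block
  of A.\<close>

lemma lowtri_corner:
  assumes "(A, A') \<in> lowtri s m" and B: "(B :: 'a::field mat) \<in> carrier_mat (s + m) (s + m)"
  shows "(\<forall>i<s. \<forall>j<s. (A * B) $$ (i, j) = 0) \<longleftrightarrow> (\<forall>i<s. \<forall>j<s. B $$ (i, j) = 0)"
proof -
  obtain X X' Y Y' Z where x: "(X, X') \<in> GLp s" "(Y, Y') \<in> GLp m" "Z \<in> carrier_mat m s"
    "ltmat ((X, X'), (Y, Y'), Z) s m = (A, A')" using lowtriE[OF assms(1)] .
  note DX = GLpD[OF x(1)]
  have A: "A \<in> carrier_mat (s + m) (s + m)" "\<And>i j. i < s \<Longrightarrow> j < m \<Longrightarrow> A $$ (i, s + j) = 0"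
    using assms(1) by (auto simp: lowtri_def GLp_def)
  have AB: "(A * B) $$ (i, j) = (\<Sum>k<s. X $$ (i, k) * B $$ (k, j))" if "i < s" "j < s" for i j
  proof -
    have "(A * B) $$ (i, j) = (\<Sum>k<s + m. A $$ (i, k) * B $$ (k, j))"
      using that by (intro index_mult_mat_sum[OF A(1) B]) auto
    also have "\<dots> = (\<Sum>k<s. X $$ (i, k) * B $$ (k, j))"
      unfolding sum_lessThan_add using that A(2) ltmat_index(1)[OF x] by simp
    finally show ?thesis .
  qed
  have BX: "B $$ (i, j) = (\<Sum>l<s. X' $$ (i, l) * (A * B) $$ (l, j))" if ij: "i < s" "j < s" for i j
  proof -
    have "(\<Sum>l<s. X' $$ (i, l) * (A * B) $$ (l, j)) = (\<Sum>l<s. \<Sum>k<s. X' $$ (i, l) * X $$ (l, k) * B $$ (k, j))"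
      using ij by (simp add: AB sum_distrib_left mult.assoc)
    also have "\<dots> = (\<Sum>k<s. (X' * X) $$ (i, k) * B $$ (k, j))"
      using ij index_mult_mat_sum[OF DX(2,1)] by (subst sum.swap) (simp add: sum_distrib_right del: index_mult_mat)
    also have "\<dots> = (\<Sum>k<s. if k = i then B $$ (k, j) else 0)"
      unfolding DX(4) using ij by (intro sum.cong) auto
    finally show ?thesis using ij by simp
  qed
  show ?thesis
  proof (intro iffI allI impI)
    fix i j assume "\<forall>i<s. \<forall>j<s. (A * B) $$ (i, j) = 0" "i < s" "j < s"
    then show "B $$ (i, j) = 0" by (subst BX) (simp_all del: index_mult_mat)
  next
    fix i j assume "\<forall>i<s. \<forall>j<s. B $$ (i, j) = 0" "i < s" "j < s"
    then show "(A * B) $$ (i, j) = 0" by (subst AB) (simp_all del: index_mult_mat)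
  qed
qed

lemma card_symmetric_GLp:
  "card {(X, X') \<in> GLp s. \<forall>i<s. \<forall>j<s. X $$ (i, j) = (X $$ (j, i) :: 'a::field)} = card (sym_nonsing s :: 'a mat set)"
proof -
  let ?S = "{(X, X') \<in> GLp s. \<forall>i<s. \<forall>j<s. X $$ (i, j) = (X $$ (j, i) :: 'a)}"
  have sub: "?S \<subseteq> GLp s" by (rule Set.subsetI, erule CollectE, erule case_prodE) simp
  have "inj_on fst ?S"
    by (rule inj_on_subset[OF bij_betw_imp_inj_on[OF bij_betw_fst_GLp[of s]] sub])
  then have "card (fst ` ?S) = card ?S" by (rule card_image)
  moreover have "fst ` ?S = (sym_nonsing s :: 'a mat set)"
  proof (intro equalityI image_subsetI Set.subsetI)
    fix x assume S: "x \<in> ?S"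
    obtain X X' where X: "x = (X, X')" by (cases x)
    have "(X, X') \<in> GLp s \<and> (\<forall>i<s. \<forall>j<s. X $$ (i, j) = X $$ (j, i))"
      using S unfolding X mem_Collect_eq prod.case .
    note x = X conjunct1[OF this] conjunct2[OF this]
    have "X \<in> nonsing s" using bij_betwE[OF bij_betw_fst_GLp, rule_format, OF x(2)] by (simp only: fst_conv)
    then show "fst x \<in> sym_nonsing s" unfolding x(1) using x(3) by (intro sym_nonsingI) (auto simp: nonsing_def)
  next
    fix X assume X: "X \<in> (sym_nonsing s :: 'a mat set)"
    then have "X \<in> nonsing s" by (simp add: sym_nonsing_def)
    then have "X \<in> fst ` GLp s"
      using bij_betw_imp_surj_on[OF bij_betw_fst_GLp[of s, where 'a = 'a]] by blast
    then obtain g where "g \<in> GLp s" "fst g = X" by blast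
    then obtain X' where "(X, X') \<in> GLp s" by (cases g) simp
    then have "(X, X') \<in> ?S" unfolding mem_Collect_eq prod.case using sym_nonsing_index[OF X] by (intro conjI allI impI)
    then have "fst (X, X') \<in> fst ` ?S" by (rule imageI)
    then show "X \<in> fst ` ?S" by (simp only: fst_conv)
  qed
  ultimately show ?thesis by (simp only:)
qed

context char2_field
begin

definition KGL :: "nat \<Rightarrow> 'a \<Rightarrow> int" where
  "KGL m a = (\<Sum>(Y, Y')\<in>GLp m. lam r (a * (mat_trace Y + mat_trace Y')))"

text \<open>\<sigma> exchanges the coordinates i and n + i for i < s, which keeps each product x_i
  x_(n + i) and hence the quadratic form.\<close>

lemma preserves_form_sigma:
  assumes "s \<le> n"
  shows "preserves_form n (sigma_plus n s :: 'a mat)"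
proof -
  let ?N = "n + n" and ?\<sigma> = "sigma_plus n s :: 'a mat" and ?E = "Emat n :: 'a mat"
  have \<sigma>: "?\<sigma> \<in> carrier_mat ?N ?N" by (rule sigma_plus_carrier[OF assms])
  have E: "?E \<in> carrier_mat ?N ?N" by simp
  have "?\<sigma>\<^sup>T = ?\<sigma>"
  proof (rule eq_matI)
    fix i j assume "i < dim_row ?\<sigma>" "j < dim_col ?\<sigma>"
    then have ij: "i < ?N" "j < ?N" using \<sigma> by auto
    moreover have "j = sperm n s i \<longleftrightarrow> i = sperm n s j" using sperm_sperm[OF assms] by metis
    ultimately show "?\<sigma>\<^sup>T $$ (i, j) = ?\<sigma> $$ (i, j)" by (simp add: sigma_plus_eq[OF assms])
  qed (use \<sigma> in auto)
  then have form: "?\<sigma>\<^sup>T * ?E * ?\<sigma> = ?\<sigma> * ?E * ?\<sigma>" by (simp only:)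
  have E_index: "?E $$ (i, j) = of_bool (i < n \<and> j = i + n)" if "i < ?N" "j < ?N" for i j
    using that carrier_matD[OF E] by (auto simp: Emat_def)
  define g where "g i j = (of_bool (sperm n s i < n \<and> sperm n s j = sperm n s i + n) + of_bool (i < n \<and> j = i + n) :: 'a)" for i j
  have X: "(?\<sigma> * ?E * ?\<sigma> + ?E) $$ (i, j) = g i j" if ij: "i < ?N" "j < ?N" for i j
  proof -
    have c: "?\<sigma> * ?E \<in> carrier_mat ?N ?N" by (rule mult_carrier_mat[OF \<sigma> E])
    have "(?\<sigma> * ?E * ?\<sigma> + ?E) $$ (i, j) = (?\<sigma> * ?E * ?\<sigma>) $$ (i, j) + ?E $$ (i, j)"
      using ij carrier_matD[OF E] by (intro index_add_mat(1)) simp_all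
    also have "(?\<sigma> * ?E * ?\<sigma>) $$ (i, j) = (?\<sigma> * ?E) $$ (i, sperm n s j)"
      by (rule mult_sigma_index[OF assms c ij])
    also have "\<dots> = ?E $$ (sperm n s i, sperm n s j)"
      by (rule sigma_mult_index[OF assms E ij(1) sperm_less[OF assms ij(2)]])
    finally show ?thesis
      unfolding g_def using E_index ij sperm_less[OF assms] by simp
  qed
  \<comment> \<open>What survives are the positions (i, n + i) with i < s and their mirror images, a
    symmetric pattern off the diagonal.\<close>
  have gsym: "g i j = of_bool (i < s \<and> j = i + n) + of_bool (j < s \<and> i = j + n)" if "i < ?N" "j < ?N" for i j
  proof -
    consider "i < s" | "s \<le> i" "i < n" | "n \<le> i" "i < n + s" | "n + s \<le> i" by linarith
    then show ?thesis
    proof cases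
      case 1
      then show ?thesis using assms that by (auto simp: g_def sperm_def)
    next
      case 2
      then have "sperm n s j = i + n \<longleftrightarrow> j = i + n" using assms that by (auto simp: sperm_def)
      then show ?thesis using 2 assms that by (auto simp: g_def sperm_def)
    next
      case 3
      then have "sperm n s j = i - n + n \<longleftrightarrow> j = i - n" using assms that by (auto simp: sperm_def split: if_splits)
      then show ?thesis using 3 assms that by (auto simp: g_def sperm_def)
    next
      case 4
      then show ?thesis using assms that by (auto simp: g_def sperm_def)
    qed
  qed
  show ?thesis
    unfolding preserves_form_def form
  proof (rule alternatingI)
    show "?\<sigma> * ?E * ?\<sigma> + ?E \<in> carrier_mat ?N ?N" by (rule add_carrier_mat[OF E])
    show "(?\<sigma> * ?E * ?\<sigma> + ?E) $$ (i, j) = (?\<sigma> * ?E * ?\<sigma> + ?E) $$ (j, i)" if "i < ?N" "j < ?N" for i j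
      using X gsym that by (simp add: add.commute)
    show "(?\<sigma> * ?E * ?\<sigma> + ?E) $$ (i, i) = 0" if "i < ?N" for i
      using X gsym that assms by simp
  qed
qed

text \<open>Conjugation by \<sigma> moves into the lower left block the corner of A B, the upper
  right block of A and the corresponding block of A'. All three have to vanish, and the last does so
  as soon as the second does.\<close>

lemma sigma_conj_P_plus_iff:
  fixes s m :: nat and B :: "'a mat"
  defines "n \<equiv> s + m"
  assumes G: "(A, A') \<in> GLp n" and B: "alternating_mat n B"
  shows "sigma_plus n s * Pmat n ((A, A'), B) * sigma_plus n s \<in> P_plus n \<longleftrightarrow>
    (A, A') \<in> lowtri s m \<and> (\<forall>i<s. \<forall>j<s. B $$ (i, j) = 0)"
proof -
  let ?\<sigma> = "sigma_plus n s :: 'a mat" and ?p = "Pmat n ((A, A'), B)"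
  have s: "s \<le> n" by (simp add: n_def)
  have \<sigma>: "?\<sigma> \<in> carrier_mat (n + n) (n + n)" by (rule sigma_plus_carrier[OF s])
  have p: "?p \<in> carrier_mat (n + n) (n + n)" by (rule Pmat_carrier[OF G])
  have "?p \<in> P_plus n" unfolding P_plus_eq using G B by blast
  then have "preserves_form n ?p" by (simp add: P_plus_iff)
  then have "preserves_form n (?\<sigma> * ?p)" using preserves_form_mult[OF \<sigma> preserves_form_sigma[OF s] p] by blast
  then have "preserves_form n (?\<sigma> * ?p * ?\<sigma>)"
    using preserves_form_mult[OF mult_carrier_mat[OF \<sigma> p] _ \<sigma> preserves_form_sigma[OF s]] by blast
  moreover have "?\<sigma> * ?p * ?\<sigma> \<in> carrier_mat (n + n) (n + n)"
    by (rule mult_carrier_mat[OF mult_carrier_mat[OF \<sigma> p] \<sigma>])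
  moreover have idx: "(?\<sigma> * ?p * ?\<sigma>) $$ (n + i, j) =
      (if i < s then if j < s then (A * B) $$ (i, j) else A $$ (i, j) else if j < s then A' $$ (j, i) else 0)"
    if ij: "i < n" "j < n" for i j
  proof -
    have "(?\<sigma> * ?p * ?\<sigma>) $$ (n + i, j) = (?\<sigma> * ?p) $$ (n + i, sperm n s j)"
      by (rule mult_sigma_index[OF s mult_carrier_mat[OF \<sigma> p]]) (use ij in auto)
    also have "\<dots> = ?p $$ (sperm n s (n + i), sperm n s j)"
      by (rule sigma_mult_index[OF s p _ sperm_less[OF s]]) (use ij in auto)
    also have "\<dots> = (if i < s then if j < s then (A * B) $$ (i, j) else A $$ (i, j) else if j < s then A' $$ (j, i) else 0)"
      using ij Pmat_index[OF G B ij] s by (simp add: sperm_def add.commute)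
    finally show ?thesis .
  qed
  ultimately have iff: "?\<sigma> * ?p * ?\<sigma> \<in> P_plus n \<longleftrightarrow> (\<forall>i<n. \<forall>j<n.
      (if i < s then if j < s then (A * B) $$ (i, j) else A $$ (i, j) else if j < s then A' $$ (j, i) else 0) = 0)"
    unfolding P_plus_iff by simp
  have Bc: "B \<in> carrier_mat (s + m) (s + m)" using alternatingD(1)[OF B] by (simp add: n_def)
  show ?thesis
  proof
    assume "?\<sigma> * ?p * ?\<sigma> \<in> P_plus n"
    then have zero: "(if i < s then if j < s then (A * B) $$ (i, j) else A $$ (i, j) else if j < s then A' $$ (j, i) else 0) = 0"
      if "i < n" "j < n" for i j using iff that by blast
    have "A $$ (i, j) = 0" if "i < s" "s \<le> j" "j < n" for i j using zero[of i j] that s by simp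
    then have low: "(A, A') \<in> lowtri s m" using G by (auto simp: lowtri_def n_def)
    moreover have "(A * B) $$ (i, j) = 0" if "i < s" "j < s" for i j using zero[of i j] that s by simp
    ultimately show "(A, A') \<in> lowtri s m \<and> (\<forall>i<s. \<forall>j<s. B $$ (i, j) = 0)"
      using lowtri_corner[OF low Bc] by blast
  next
    assume R: "(A, A') \<in> lowtri s m \<and> (\<forall>i<s. \<forall>j<s. B $$ (i, j) = 0)"
    then have low: "(A, A') \<in> lowtri s m" and AB: "\<forall>i<s. \<forall>j<s. (A * B) $$ (i, j) = 0"
      using lowtri_corner[OF _ Bc] by blast+
    obtain X X' Y Y' Z where x: "(X, X') \<in> GLp s" "(Y, Y') \<in> GLp m" "Z \<in> carrier_mat m s"
      "ltmat ((X, X'), (Y, Y'), Z) s m = (A, A')" using lowtriE[OF low] .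
    have "A' $$ (j, i) = 0" if "j < s" "s \<le> i" "i < n" for i j
      using ltmat_index(2)[OF x, of j "i - s"] that by (simp add: n_def)
    moreover have "A $$ (i, j) = 0" if "i < s" "s \<le> j" "j < n" for i j
      using low that by (simp add: lowtri_def n_def)
    ultimately show "?\<sigma> * ?p * ?\<sigma> \<in> P_plus n" unfolding iff using AB by simp
  qed
qed

lemma card_stabilizer:
  fixes s m :: nat
  defines "n \<equiv> s + m"
  shows "card {p \<in> (P_plus n :: 'a mat set). sigma_plus n s * p * sigma_plus n s \<in> P_plus n} * CARD('a) ^ (\<Sum>j<s. j) =
    card (nonsing s :: 'a mat set) * (card (nonsing m :: 'a mat set) * CARD('a) ^ (m * s)) * CARD('a) ^ (\<Sum>j<n. j)"
proof -
  let ?B = "{B. alternating_mat n (B :: 'a mat) \<and> (\<forall>i<s. \<forall>j<s. B $$ (i, j) = 0)}"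
  let ?L = "lowtri s m :: ('a mat \<times> 'a mat) set"
  have L: "x \<in> ?L \<Longrightarrow> x \<in> GLp n" for x by (auto simp: lowtri_def n_def)
  have "{p \<in> P_plus n. sigma_plus n s * p * sigma_plus n s \<in> P_plus n} = Pmat n ` (?L \<times> ?B)"
  proof (intro equalityI Set.subsetI)
    fix p assume "p \<in> {p \<in> (P_plus n :: 'a mat set). sigma_plus n s * p * sigma_plus n s \<in> P_plus n}"
    then obtain A A' B where p: "p = Pmat n ((A, A'), B)" "(A, A') \<in> GLp n" "alternating_mat n B"
      "sigma_plus n s * p * sigma_plus n s \<in> P_plus n" unfolding P_plus_eq by auto
    then have "(A, A') \<in> ?L \<and> (\<forall>i<s. \<forall>j<s. B $$ (i, j) = 0)"
      using sigma_conj_P_plus_iff[of A A' s m B] unfolding n_def by blast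
    then show "p \<in> Pmat n ` (?L \<times> ?B)" using p by blast
  next
    fix p assume "p \<in> Pmat n ` (?L \<times> ?B)"
    then obtain A A' B where p: "p = Pmat n ((A, A'), B)" "(A, A') \<in> ?L" "alternating_mat n B" "\<forall>i<s. \<forall>j<s. B $$ (i, j) = 0"
      by auto
    have G: "(A, A') \<in> GLp n" using L p(2) by blast
    have "p \<in> P_plus n" unfolding P_plus_eq p(1) using G p(3) by blast
    moreover have "sigma_plus n s * p * sigma_plus n s \<in> P_plus n"
      using sigma_conj_P_plus_iff[of A A' s m B] G p unfolding n_def by blast
    ultimately show "p \<in> {p \<in> P_plus n. sigma_plus n s * p * sigma_plus n s \<in> P_plus n}" by simp
  qed
  moreover have "inj_on (Pmat n) (?L \<times> ?B)"
    by (rule inj_on_subset[OF inj_on_Pmat]) (use L in blast)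
  ultimately have "card {p \<in> (P_plus n :: 'a mat set). sigma_plus n s * p * sigma_plus n s \<in> P_plus n} = card ?L * card ?B"
    by (simp only: card_image card_cartesian_product)
  moreover have "card ?B * CARD('a) ^ (\<Sum>j<s. j) = CARD('a) ^ (\<Sum>j<n. j)"
    by (rule card_alternating_corner) (simp add: n_def)
  ultimately show ?thesis by (simp only: card_lowtri mult.assoc)
qed

text \<open>For i < s the rows i and n + i are exchanged, so the diagonal meets the zero block and
  the diagonal of A B. The other rows contribute diagonal entries of A and of its inverse.\<close>

lemma trace_sigma_Pmat:
  fixes s m :: nat
  defines "n \<equiv> s + m"
  assumes G: "(A, A') \<in> GLp n" and B: "alternating_mat n (B :: 'a mat)"
  shows "mat_trace (sigma_plus n s * Pmat n ((A, A'), B)) =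
    (\<Sum>i<m. A $$ (s + i, s + i) + A' $$ (s + i, s + i)) + (\<Sum>i<s. (A * B) $$ (i, i))"
proof -
  let ?p = "Pmat n ((A, A'), B)" and ?\<sigma> = "sigma_plus n s :: 'a mat"
  have s: "s \<le> n" by (simp add: n_def)
  have p: "?p \<in> carrier_mat (n + n) (n + n)" by (rule Pmat_carrier[OF G])
  have idx: "?p $$ (i, j) = A $$ (i, j)" "?p $$ (i, n + j) = (A * B) $$ (i, j)" "?p $$ (n + i, j) = 0"
    "?p $$ (n + i, n + j) = A' $$ (j, i)" if "i < n" "j < n" for i j
    using Pmat_index[OF G B that] by auto
  have "mat_trace (?\<sigma> * ?p) = (\<Sum>i<n + n. (?\<sigma> * ?p) $$ (i, i))"
    using sigma_plus_carrier[OF s, where 'a = 'a] by (simp add: mat_trace_def)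
  also have "\<dots> = (\<Sum>i<n + n. ?p $$ (sperm n s i, i))"
    by (intro sum.cong refl sigma_mult_index[OF s p]) auto
  also have "\<dots> = (\<Sum>i<n. ?p $$ (sperm n s i, i)) + (\<Sum>i<n. ?p $$ (sperm n s (n + i), n + i))"
    by (rule sum_lessThan_add)
  also have "(\<Sum>i<n. ?p $$ (sperm n s i, i)) = (\<Sum>i<n. if i < s then 0 else A $$ (i, i))"
    using idx s by (intro sum.cong) (auto simp: sperm_def add.commute)
  also have "\<dots> = (\<Sum>i<m. A $$ (s + i, s + i))"
    unfolding n_def sum_lessThan_add by simp
  also have "(\<Sum>i<n. ?p $$ (sperm n s (n + i), n + i)) = (\<Sum>i<n. if i < s then (A * B) $$ (i, i) else A' $$ (i, i))"
    using idx s by (intro sum.cong) (auto simp: sperm_def)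
  also have "\<dots> = (\<Sum>i<s. (A * B) $$ (i, i)) + (\<Sum>i<m. A' $$ (s + i, s + i))"
    unfolding n_def sum_lessThan_add by simp
  finally show ?thesis by (simp add: sum.distrib ac_simps)
qed

lemma sum_lam_sigma_P_plus:
  fixes s m :: nat
  defines "n \<equiv> s + m"
  assumes a: "a \<noteq> 0"
  shows "(\<Sum>p\<in>P_plus n. lam r (a * mat_trace (sigma_plus n s * p))) =
    Q ^ (\<Sum>j<n. j) * (int (card (sym_nonsing s :: 'a mat set)) * (KGL m a * Q ^ (m * s)))"
proof -
  let ?Alt = "{B. alternating_mat n (B :: 'a mat)}"
  define u where "u = (\<lambda>(A :: 'a mat, A' :: 'a mat). \<Sum>i<m. A $$ (s + i, s + i) + A' $$ (s + i, s + i))"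
  define c where "c = (\<lambda>(A :: 'a mat, A' :: 'a mat). (\<forall>i<s. \<forall>j. s \<le> j \<longrightarrow> j < n \<longrightarrow> A $$ (i, j) = 0) \<and>
    (\<forall>i<s. \<forall>j<s. A $$ (i, j) = A $$ (j, i)))"
  let ?XS = "{(X, X') \<in> GLp s. \<forall>i<s. \<forall>j<s. X $$ (i, j) = (X $$ (j, i) :: 'a)}"
  have "(\<Sum>p\<in>P_plus n. lam r (a * mat_trace (sigma_plus n s * p))) =
      (\<Sum>x\<in>GLp n \<times> ?Alt. lam r (a * mat_trace (sigma_plus n s * Pmat n x)))"
    unfolding P_plus_eq by (subst sum.reindex[OF inj_on_Pmat]) simp
  also have "\<dots> = (\<Sum>G\<in>GLp n. \<Sum>B\<in>?Alt. lam r (a * mat_trace (sigma_plus n s * Pmat n (G, B))))"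
    by (subst sum.cartesian_product) (simp add: case_prod_beta)
  \<comment> \<open>For a fixed GL part the sum over B is the one evaluated by
    \<open>sum_lam_alternating\<close>, so only block triangular A with symmetric corner
    remain.\<close>
  also have "\<dots> = (\<Sum>G\<in>GLp n. lam r (a * u G) * (if c G then Q ^ (\<Sum>j<n. j) else 0))"
  proof (rule sum.cong[OF refl])
    fix G :: "'a mat \<times> 'a mat" assume GG: "G \<in> GLp n"
    obtain A A' where G: "G = (A, A')" by (cases G)
    have AG: "(A, A') \<in> GLp n" using GG G by simp
    have "(\<Sum>B\<in>?Alt. lam r (a * mat_trace (sigma_plus n s * Pmat n (G, B)))) =
        (\<Sum>B\<in>?Alt. lam r (a * u G) * lam r (a * (\<Sum>i<s. (A * B) $$ (i, i))))"
    proof (rule sum.cong[OF refl])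
      fix B assume "B \<in> ?Alt"
      then have "mat_trace (sigma_plus n s * Pmat n (G, B)) = u G + (\<Sum>i<s. (A * B) $$ (i, i))"
        using trace_sigma_Pmat[of A A' s m B] AG unfolding n_def G u_def by simp
      then show "lam r (a * mat_trace (sigma_plus n s * Pmat n (G, B))) = lam r (a * u G) * lam r (a * (\<Sum>i<s. (A * B) $$ (i, i)))"
        by (simp only: distrib_left lam_add)
    qed
    also have "\<dots> = lam r (a * u G) * (\<Sum>B\<in>?Alt. lam r (a * (\<Sum>i<s. (A * B) $$ (i, i))))"
      by (rule sum_distrib_left[symmetric])
    also have "(\<Sum>B\<in>?Alt. lam r (a * (\<Sum>i<s. (A * B) $$ (i, i)))) = (if c G then Q ^ (\<Sum>j<n. j) else 0)"
      unfolding c_def G prod.case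
      by (rule sum_lam_alternating[OF GLpD(1)[OF AG] _ a]) (simp add: n_def)
    finally show "(\<Sum>B\<in>?Alt. lam r (a * mat_trace (sigma_plus n s * Pmat n (G, B)))) =
        lam r (a * u G) * (if c G then Q ^ (\<Sum>j<n. j) else 0)" .
  qed
  also have "\<dots> = (\<Sum>G\<in>GLp n. if c G then Q ^ (\<Sum>j<n. j) * lam r (a * u G) else 0)"
    by (intro sum.cong) auto
  also have "\<dots> = (\<Sum>G\<in>{G \<in> GLp n. c G}. Q ^ (\<Sum>j<n. j) * lam r (a * u G))"
    by (rule sum.inter_filter[OF finite_GLp, symmetric])
  also have "\<dots> = Q ^ (\<Sum>j<n. j) * (\<Sum>G\<in>{G \<in> GLp n. c G}. lam r (a * u G))"
    by (rule sum_distrib_left[symmetric])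
  also have "{G \<in> GLp n. c G} = (\<lambda>x. ltmat x s m) ` (?XS \<times> GLp m \<times> carrier_mat m s)"
  proof (intro equalityI Set.subsetI)
    fix G assume "G \<in> {G \<in> GLp n. c G}"
    then obtain A A' where G: "G = (A, A')" "(A, A') \<in> lowtri s m" "\<forall>i<s. \<forall>j<s. A $$ (i, j) = A $$ (j, i)"
      by (cases G) (auto simp: c_def lowtri_def n_def)
    obtain X X' Y Y' Z where x: "(X, X') \<in> GLp s" "(Y, Y') \<in> GLp m" "Z \<in> carrier_mat m s"
      "ltmat ((X, X'), (Y, Y'), Z) s m = (A, A')" using lowtriE[OF G(2)] .
    have "(X, X') \<in> ?XS" using x(1) G(3) ltmat_index(1)[OF x] by simp
    then have "((X, X'), (Y, Y'), Z) \<in> ?XS \<times> GLp m \<times> carrier_mat m s" using x by blast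
    then show "G \<in> (\<lambda>x. ltmat x s m) ` (?XS \<times> GLp m \<times> carrier_mat m s)"
      unfolding G(1) x(4)[symmetric] by (rule imageI)
  next
    fix G assume "G \<in> (\<lambda>x. ltmat x s m) ` (?XS \<times> GLp m \<times> carrier_mat m s)"
    then obtain X X' Y Y' Z where x: "(X, X') \<in> GLp s" "(Y, Y') \<in> GLp m" "Z \<in> carrier_mat m s"
      "G = ltmat ((X, X'), (Y, Y'), Z) s m" "\<forall>i<s. \<forall>j<s. X $$ (i, j) = X $$ (j, i)" by auto
    obtain A A' where A: "ltmat ((X, X'), (Y, Y'), Z) s m = (A, A')" by (cases "ltmat ((X, X'), (Y, Y'), Z) s m")
    have low: "(A, A') \<in> lowtri s m" using ltmat_lowtri[OF x(1-3)] A by simp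
    have "\<forall>i<s. \<forall>j<s. A $$ (i, j) = A $$ (j, i)" using ltmat_index(1)[OF x(1-3) A] x(5) by simp
    then show "G \<in> {G \<in> GLp n. c G}" using low x(4) A by (simp add: lowtri_def c_def n_def)
  qed
  also have "(\<Sum>G\<in>(\<lambda>x. ltmat x s m) ` (?XS \<times> GLp m \<times> carrier_mat m s). lam r (a * u G)) =
      (\<Sum>x\<in>?XS \<times> GLp m \<times> carrier_mat m s. lam r (a * u (ltmat x s m)))"
  proof (rule sum.reindex_cong[OF _ refl refl])
    show "inj_on (\<lambda>x. ltmat x s m) (?XS \<times> GLp m \<times> carrier_mat m s)"
      by (rule inj_on_subset[OF bij_betw_imp_inj_on[OF bij_betw_ltmat]]) auto
  qed
  also have "\<dots> = (\<Sum>x\<in>?XS \<times> (GLp m :: ('a mat \<times> 'a mat) set) \<times> (carrier_mat m s :: 'a mat set). (\<lambda>(_, (Y, Y'), _). lam r (a * (mat_trace Y + mat_trace Y'))) x)"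
  proof (rule sum.cong[OF refl])
    fix x assume "x \<in> ?XS \<times> (GLp m :: ('a mat \<times> 'a mat) set) \<times> (carrier_mat m s :: 'a mat set)"
    then obtain X X' Y Y' Z where x: "(X, X') \<in> GLp s" "(Y, Y') \<in> GLp m" "Z \<in> carrier_mat m s"
      "x = ((X, X'), (Y, Y'), Z)" by auto
    obtain A A' where A: "ltmat ((X, X'), (Y, Y'), Z) s m = (A, A')" by (cases "ltmat ((X, X'), (Y, Y'), Z) s m")
    \<comment> \<open>The trace sees only the block Y and its inverse; the symmetric corner X and
      the block Z merely contribute the number of their choices.\<close>
    have "u (ltmat x s m) = mat_trace Y + mat_trace Y'"
      unfolding x(4) A u_def prod.case mat_trace_def
      using ltmat_index(3,4)[OF x(1-3) A] GLpD(1,2)[OF x(2)] by (simp add: sum.distrib)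
    then show "lam r (a * u (ltmat x s m)) = (\<lambda>(_, (Y, Y'), _). lam r (a * (mat_trace Y + mat_trace Y'))) x"
      unfolding x(4) by simp
  qed
  also have "\<dots> = (\<Sum>X\<in>?XS. \<Sum>Y\<in>(GLp m :: ('a mat \<times> 'a mat) set). \<Sum>Z\<in>(carrier_mat m s :: 'a mat set). lam r (a * (mat_trace (fst Y) + mat_trace (snd Y))))"
    by (simp only: sum.cartesian_product' split_beta' fst_conv snd_conv)
  also have "\<dots> = int (card ?XS) * (KGL m a * Q ^ (m * s))"
    unfolding KGL_def by (simp add: card_carrier_mat card_field case_prod_beta power_mult sum_distrib_left[symmetric] mult.commute)
  finally show ?thesis unfolding card_symmetric_GLp .
qed

lemma DC_sums:
  fixes s m :: nat
  defines "n \<equiv> s + m"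
  defines "M \<equiv> int (card {p \<in> (P_plus n :: 'a mat set). sigma_plus n s * p * sigma_plus n s \<in> P_plus n})"
  shows "M * int (card (DC m n :: 'a mat set)) = (int (card (P_plus n :: 'a mat set)))\<^sup>2"
    and "a \<noteq> 0 \<Longrightarrow> M * (\<Sum>g\<in>DC m n. lam r (a * mat_trace g)) =
      int (card (P_plus n :: 'a mat set)) *
      (Q ^ (\<Sum>j<n. j) * (int (card (sym_nonsing s :: 'a mat set)) * (KGL m a * Q ^ (m * s))))"
proof -
  have s: "s \<le> n" "n - m = s" by (simp_all add: n_def)
  have DC: "DC m n = {p * sigma_plus n s * p' | p p'. p \<in> P_plus n \<and> p' \<in> (P_plus n :: 'a mat set)}"
    by (simp add: DC_def s(2))
  have sub: "P_plus n \<subseteq> (carrier_mat (n + n) (n + n) :: 'a mat set)" by (auto simp: P_plus_iff)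
  note sum = double_coset_sum[OF finite_P_plus sub P_plus_mult one_P_plus P_plus_invertible
      sigma_plus_carrier[OF s(1)] sigma_plus_involution[OF s(1)], folded DC M_def]
  show "M * int (card (DC m n :: 'a mat set)) = (int (card (P_plus n :: 'a mat set)))\<^sup>2"
    using sum[of "\<lambda>_. 1"] by (simp add: power2_eq_square)
  show "M * (\<Sum>g\<in>DC m n. lam r (a * mat_trace g)) = int (card (P_plus n :: 'a mat set)) *
      (Q ^ (\<Sum>j<n. j) * (int (card (sym_nonsing s :: 'a mat set)) * (KGL m a * Q ^ (m * s))))" if "a \<noteq> 0"
    using sum[of "\<lambda>x. lam r (a * x)"] sum_lam_sigma_P_plus[OF that, of s m] unfolding n_def by simp
qed

section \<open>Kloosterman sums over GL(1, q) and GL(2, q)\<close>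

lemma KGL_1: "KGL 1 a = Kl r ((a :: 'a)\<^sup>2)" if "a \<noteq> 0"
proof -
  define F where "F c = (mat 1 1 (\<lambda>_. c), mat 1 1 (\<lambda>_. inverse c))" for c :: 'a
  have "bij_betw F (UNIV - {0}) (GLp 1)"
  proof (rule bij_betw_byWitness[where f' = "\<lambda>(A, _). A $$ (0, 0)"])
    show "\<forall>c\<in>UNIV - {0}. (\<lambda>(A, _). A $$ (0, 0)) (F c) = c" by (simp add: F_def)
    have one: "A $$ (0, 0) * A' $$ (0, 0) = 1" if "(A, A') \<in> GLp 1" for A A' :: "'a mat"
    proof -
      have "(A * A') $$ (0, 0) = (\<Sum>k<1. A $$ (0, k) * A' $$ (k, 0))"
        using GLpD(1,2)[OF that] by (intro index_mult_mat_sum) auto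
      then show ?thesis using GLpD(3)[OF that] by simp
    qed
    show F_GL: "F ` (UNIV - {0}) \<subseteq> GLp 1"
    proof (rule image_subsetI)
      fix c :: 'a assume "c \<in> UNIV - {0}"
      then have "mat 1 1 (\<lambda>_. c) * mat 1 1 (\<lambda>_. inverse c) = 1\<^sub>m 1"
        by (intro eq_matI) (auto simp: scalar_prod_def)
      then show "F c \<in> GLp 1" unfolding F_def by (intro GLpI) auto
    qed
    show "\<forall>x\<in>GLp 1. F ((\<lambda>(A, _). A $$ (0, 0)) x) = x"
    proof (rule ballI)
      fix x :: "'a mat \<times> 'a mat" assume x: "x \<in> GLp 1"
      obtain A A' where A: "x = (A, A')" "(A, A') \<in> GLp 1" using x by (cases x) auto
      have nz: "A $$ (0, 0) \<noteq> 0" using one[OF A(2)] by auto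
      have "mat 1 1 (\<lambda>_. A $$ (0, 0)) = A" using GLpD(1)[OF A(2)] by (intro eq_matI) auto
      then have "(A, snd (F (A $$ (0, 0)))) \<in> GLp 1" using F_GL nz unfolding F_def by fastforce
      then have "snd (F (A $$ (0, 0))) = A'" using A(2) by (rule GLp_inverse_unique)
      then show "F ((\<lambda>(A, _). A $$ (0, 0)) x) = x"
        using \<open>mat 1 1 (\<lambda>_. A $$ (0, 0)) = A\<close> by (simp add: A(1) F_def)
    qed
    show "(\<lambda>(A, _). A $$ (0, 0)) ` GLp 1 \<subseteq> UNIV - {0 :: 'a}" using one by force
  qed
  then have "KGL 1 a = (\<Sum>c\<in>UNIV - {0}. (\<lambda>(Y, Y'). lam r (a * (mat_trace Y + mat_trace Y'))) (F c))"
    unfolding KGL_def by (rule sum.reindex_bij_betw[symmetric])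
  also have "\<dots> = (\<Sum>c\<in>UNIV - {0}. lam r (a * c + a * inverse c))"
    by (simp add: F_def mat_trace_def distrib_left)
  also have "\<dots> = Kl r (a * a)" by (rule Kl_eq_sum_scaled[OF that, symmetric])
  finally show ?thesis by (simp add: power2_eq_square)
qed

text \<open>For y nonzero, z -> e + y z runs through the whole field; y = 0 gives the value at e, q
  times.\<close>

lemma sum_hyperbola: "(\<Sum>y\<in>UNIV. \<Sum>z\<in>UNIV. f (e + y * z)) = Q * f e + (Q - 1) * (\<Sum>d\<in>(UNIV :: 'a set). f d :: int)"
proof -
  have "(\<Sum>z\<in>UNIV. f (e + y * z)) = (\<Sum>d\<in>UNIV. f d)" if "y \<noteq> 0" for y
    by (rule sum.reindex_bij_witness[where i = "\<lambda>d. (d + e) / y" and j = "\<lambda>z. e + y * z"])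
      (use that in \<open>simp_all add: add.commute[of _ e] add.assoc[symmetric]\<close>)
  then have "(\<Sum>y\<in>UNIV - {0}. \<Sum>z\<in>UNIV. f (e + y * z)) = (\<Sum>y\<in>UNIV - {0::'a}. \<Sum>d\<in>UNIV. f d)"
    by (rule sum.cong[OF refl]) simp
  then have "(\<Sum>y\<in>UNIV - {0}. \<Sum>z\<in>UNIV. f (e + y * z)) = (Q - 1) * (\<Sum>d\<in>UNIV. f d)"
    by (simp add: card_Diff_subset card_field of_nat_diff)
  then show ?thesis by (simp add: sum_nonzero card_field)
qed

text \<open>With d = x w + y z the inverse matrix has trace (x + w) / d, so the summand depends on
  x, w and d only. By \<open>sum_hyperbola\<close> in y and z, the choice d = x w gets weight q and
  yields K^2, while the free sum over d gets weight q - 1 and yields q^2, all of it from d =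
  1.\<close>

lemma KGL_2: "KGL 2 a = Q * (Kl r ((a :: 'a)\<^sup>2))\<^sup>2 + Q\<^sup>2 * (Q - 1)" if a: "a \<noteq> 0"
proof -
  define M :: "'a \<Rightarrow> 'a \<Rightarrow> 'a \<Rightarrow> 'a \<Rightarrow> 'a mat" where
    "M x y z w = mat 2 2 (\<lambda>(i, j). if i = 0 then if j = 0 then x else y else if j = 0 then z else w)" for x y z w
  define F where "F = (\<lambda>(x, w, y, z). (M x y z w, M (w / (x * w + y * z)) (y / (x * w + y * z)) (z / (x * w + y * z)) (x / (x * w + y * z))))"
  let ?S = "{(x, w, y, z). x * w + y * z \<noteq> (0 :: 'a)}"
  have M_car: "M x y z w \<in> carrier_mat 2 2" for x y z w by (simp add: M_def)
  have idx2: "i < 2 \<Longrightarrow> i = 0 \<or> i = (1::nat)" for i by auto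
  have M_mult: "M x y z w * M x' y' z' w' = M (x * x' + y * z') (x * y' + y * w') (z * x' + w * z') (z * y' + w * w')"
    for x y z w x' y' z' w'
  proof (rule eq_matI)
    fix i j assume "i < dim_row (M (x * x' + y * z') (x * y' + y * w') (z * x' + w * z') (z * y' + w * w'))"
      "j < dim_col (M (x * x' + y * z') (x * y' + y * w') (z * x' + w * z') (z * y' + w * w'))"
    then have ij: "i < 2" "j < 2" by (simp_all add: M_def)
    have "(M x y z w * M x' y' z' w') $$ (i, j) = (\<Sum>k<2. M x y z w $$ (i, k) * M x' y' z' w' $$ (k, j))"
      by (rule index_mult_mat_sum[OF M_car M_car ij])
    then show "(M x y z w * M x' y' z' w') $$ (i, j) =
        M (x * x' + y * z') (x * y' + y * w') (z * x' + w * z') (z * y' + w * w') $$ (i, j)"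
      using idx2[OF ij(1)] idx2[OF ij(2)] by (auto simp: M_def numeral_2_eq_2)
  qed (simp_all add: M_def)
  have M_one: "1\<^sub>m 2 = M 1 0 0 1" by (intro eq_matI) (auto simp: M_def)
  have M_entries: "A = M (A $$ (0, 0)) (A $$ (0, 1)) (A $$ (1, 0)) (A $$ (1, 1))" if "A \<in> carrier_mat 2 2" for A
  proof (rule eq_matI)
    fix i j assume "i < dim_row (M (A $$ (0, 0)) (A $$ (0, 1)) (A $$ (1, 0)) (A $$ (1, 1)))"
      "j < dim_col (M (A $$ (0, 0)) (A $$ (0, 1)) (A $$ (1, 0)) (A $$ (1, 1)))"
    then have "i < 2" "j < 2" by (auto simp: M_def)
    then show "A $$ (i, j) = M (A $$ (0, 0)) (A $$ (0, 1)) (A $$ (1, 0)) (A $$ (1, 1)) $$ (i, j)"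
      using idx2[of i] idx2[of j] by (auto simp: M_def)
  qed (use that in \<open>auto simp: M_def\<close>)
  have F_GL: "F (x, w, y, z) \<in> GLp 2" if d: "x * w + y * z \<noteq> 0" for x w y z
  proof -
    define e where "e = x * w + y * z"
    have e: "e / e = 1" using d by (simp add: e_def)
    have "x * (w / e) + y * (z / e) = e / e"
      by (simp only: e_def add_divide_distrib times_divide_eq_right)
    moreover have "z * (y / e) + w * (x / e) = e / e"
      unfolding e_def[unfolded mult.commute[of x] mult.commute[of y] add.commute[of "w * x"]]
      by (simp only: add_divide_distrib times_divide_eq_right)
    moreover have "x * (y / e) + y * (x / e) = 0" "z * (w / e) + w * (z / e) = 0"
      by (simp_all add: mult.commute)
    ultimately have "M x y z w * M (w / e) (y / e) (z / e) (x / e) = 1\<^sub>m 2"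
      by (simp only: M_mult M_one e)
    then show ?thesis unfolding F_def prod.case e_def[symmetric] by (intro GLpI M_car)
  qed
  have bij: "bij_betw F ?S (GLp 2)"
    unfolding bij_betw_def
  proof
    show "inj_on F ?S"
    proof (rule inj_onI)
      fix u v assume "F u = F v"
      then have eq: "fst (F u) = fst (F v)" by simp
      obtain x w y z where u: "u = (x, w, y, z)" by (cases u)
      obtain x' w' y' z' where v: "v = (x', w', y', z')" by (cases v)
      have "M x y z w $$ (i, j) = M x' y' z' w' $$ (i, j)" for i j using eq by (simp add: F_def u v)
      from this[of 0 0] this[of 0 1] this[of 1 0] this[of 1 1] show "u = v" by (simp add: u v M_def)
    qed
    show "F ` ?S = GLp 2"
    proof (intro equalityI Set.subsetI)
      fix x assume "x \<in> F ` ?S"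
      then show "x \<in> GLp 2" using F_GL by auto
    next
      fix p :: "'a mat \<times> 'a mat" assume "p \<in> GLp 2"
      then obtain A A' where p: "p = (A, A')" "(A, A') \<in> GLp 2" by (cases p) auto
      obtain x y z w where A: "A = M x y z w" using M_entries[OF GLpD(1)[OF p(2)]] by blast
      obtain x' y' z' w' where A': "A' = M x' y' z' w'" using M_entries[OF GLpD(2)[OF p(2)]] by blast
      have mm: "M (x * x' + y * z') (x * y' + y * w') (z * x' + w * z') (z * y' + w * w') = M 1 0 0 1"
        using GLpD(3)[OF p(2)] unfolding A A' M_mult M_one .
      have "M (x * x' + y * z') (x * y' + y * w') (z * x' + w * z') (z * y' + w * w') $$ (i, j) = M 1 0 0 1 $$ (i, j)" for i j
        using mm by simp
      from this[of 0 0] this[of 0 1] this[of 1 0] this[of 1 1]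
      have e: "x * x' + y * z' = 1" "x * y' + y * w' = 0" "z * x' + w * z' = 0" "z * y' + w * w' = 1"
        by (simp_all add: M_def)
      have "(x * w + y * z) * (x' * w' + y' * z') =
          (x * x' + y * z') * (z * y' + w * w') + (x * y' + y * w') * (z * x' + w * z')"
      proof -
        have "(x * x' + y * z') * (z * y' + w * w') + (x * y' + y * w') * (z * x' + w * z') =
          (x * w + y * z) * (x' * w' + y' * z') + (x * x' * z * y' + x * x' * z * y') + (y * z' * w * w' + y * z' * w * w')"
          by (simp only: ring_distribs ac_simps)
        then show ?thesis by simp
      qed
      then have d: "x * w + y * z \<noteq> 0" unfolding e by auto
      have "(A, snd (F (x, w, y, z))) \<in> GLp 2" using F_GL[OF d] by (simp add: F_def A)
      then have "snd (F (x, w, y, z)) = A'" using p(2) by (rule GLp_inverse_unique)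
      then have "F (x, w, y, z) = p" by (simp add: F_def A p(1))
      then show "p \<in> F ` ?S" using d by force
    qed
  qed
  have tr: "mat_trace (M x y z w) = x + w" for x y z w by (simp add: mat_trace_def M_def numeral_2_eq_2)
  \<comment> \<open>The value 0 at d = 0 admits the singular matrices, so that the sum can run over
    all four entries independently.\<close>
  let ?g = "\<lambda>x w d. if d = 0 then 0 else lam r (a * ((x + w) * (1 + inverse d)))"
  let ?U = "UNIV :: 'a set"
  have "KGL 2 a = (\<Sum>u\<in>?S. (\<lambda>(Y, Y'). lam r (a * (mat_trace Y + mat_trace Y'))) (F u))"
    unfolding KGL_def by (rule sum.reindex_bij_betw[OF bij, symmetric])
  also have "\<dots> = (\<Sum>u\<in>?S. (\<lambda>(x, w, y, z). ?g x w (x * w + y * z)) u)"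
  proof (rule sum.cong[OF refl])
    fix u assume "u \<in> ?S"
    then obtain x w y z where u: "u = (x, w, y, z)" "x * w + y * z \<noteq> 0" by auto
    have "x + w + (w / (x * w + y * z) + x / (x * w + y * z)) = (x + w) * (1 + inverse (x * w + y * z))"
      by (simp add: divide_inverse ring_distribs ac_simps)
    then show "(\<lambda>(Y, Y'). lam r (a * (mat_trace Y + mat_trace Y'))) (F u) = (\<lambda>(x, w, y, z). ?g x w (x * w + y * z)) u"
      using u(2) by (simp add: u(1) F_def tr)
  qed
  also have "\<dots> = (\<Sum>u\<in>UNIV. (\<lambda>(x, w, y, z). ?g x w (x * w + y * z)) u)"
    by (rule sum.mono_neutral_left) auto
  also have "\<dots> = (\<Sum>x\<in>?U. \<Sum>w\<in>?U. \<Sum>y\<in>?U. \<Sum>z\<in>?U. ?g x w (x * w + y * z))"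
    unfolding UNIV_Times_UNIV[symmetric] by (simp only: sum.cartesian_product)
  also have "\<dots> = (\<Sum>x\<in>?U. \<Sum>w\<in>?U. Q * ?g x w (x * w) + (Q - 1) * (\<Sum>d\<in>?U. ?g x w d))"
    by (rule sum.cong[OF refl], rule sum.cong[OF refl], rule sum_hyperbola)
  also have "\<dots> = Q * (\<Sum>x\<in>?U. \<Sum>w\<in>?U. ?g x w (x * w)) + (Q - 1) * (\<Sum>x\<in>?U. \<Sum>w\<in>?U. \<Sum>d\<in>?U. ?g x w d)"
    by (simp only: sum.distrib sum_distrib_left)
  also have "(\<Sum>x\<in>?U. \<Sum>w\<in>?U. ?g x w (x * w)) = (Kl r (a\<^sup>2))\<^sup>2"
  proof -
    have K: "Kl r (a\<^sup>2) = (\<Sum>x\<in>?U - {0}. lam r (a * (x + inverse x)))"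
      using Kl_eq_sum_scaled[OF a, of a] by (simp add: power2_eq_square distrib_left)
    have "(\<Sum>x\<in>?U. \<Sum>w\<in>?U. ?g x w (x * w)) = (\<Sum>x\<in>?U - {0}. \<Sum>w\<in>?U - {0}. lam r (a * (x + inverse x)) * lam r (a * (w + inverse w)))"
    proof -
      have "(\<Sum>x\<in>?U. \<Sum>w\<in>?U. ?g x w (x * w)) = (\<Sum>x\<in>?U - {0}. \<Sum>w\<in>?U. ?g x w (x * w))"
        by (rule sum.mono_neutral_right) auto
      also have "\<dots> = (\<Sum>x\<in>?U - {0}. \<Sum>w\<in>?U - {0}. lam r (a * (x + inverse x)) * lam r (a * (w + inverse w)))"
      proof (rule sum.cong[OF refl])
        fix x assume x: "x \<in> ?U - {0}"
        have "(\<Sum>w\<in>?U. ?g x w (x * w)) = (\<Sum>w\<in>?U - {0}. ?g x w (x * w))"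
          by (rule sum.mono_neutral_right) auto
        also have "\<dots> = (\<Sum>w\<in>?U - {0}. lam r (a * (x + inverse x)) * lam r (a * (w + inverse w)))"
        proof (rule sum.cong[OF refl])
          fix w assume w: "w \<in> ?U - {0}"
          have "(x + w) * (1 + inverse (x * w)) = (x + inverse x) + (w + inverse w)"
            using x w by (simp add: field_simps)
          then show "?g x w (x * w) = lam r (a * (x + inverse x)) * lam r (a * (w + inverse w))"
            using x w by (simp add: lam_add[symmetric] distrib_left[symmetric])
        qed
        finally show "(\<Sum>w\<in>?U. ?g x w (x * w)) = (\<Sum>w\<in>?U - {0}. lam r (a * (x + inverse x)) * lam r (a * (w + inverse w)))" .
      qed
      finally show ?thesis .
    qed
    then show ?thesis unfolding K unfolding power2_eq_square sum_product .
  qed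
  also have "(\<Sum>x\<in>?U. \<Sum>w\<in>?U. \<Sum>d\<in>?U. ?g x w d) = Q\<^sup>2"
  proof -
    have "(\<Sum>x\<in>?U. \<Sum>w\<in>?U. \<Sum>d\<in>?U. ?g x w d) = (\<Sum>x\<in>?U. \<Sum>d\<in>?U. \<Sum>w\<in>?U. ?g x w d)"
      by (rule sum.cong[OF refl], rule sum.swap)
    also have "\<dots> = (\<Sum>d\<in>?U. \<Sum>x\<in>?U. \<Sum>w\<in>?U. ?g x w d)" by (rule sum.swap)
    also have "\<dots> = (\<Sum>d\<in>?U. if d = 1 then Q\<^sup>2 else 0)"
    proof (rule sum.cong[OF refl])
      fix d :: 'a
      show "(\<Sum>x\<in>?U. \<Sum>w\<in>?U. ?g x w d) = (if d = 1 then Q\<^sup>2 else 0)"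
      proof (cases "d = 0")
        case False
        define b where "b = a * (1 + inverse d)"
        have b: "b = 0 \<longleftrightarrow> d = 1" using a by (auto simp: b_def)
        have "(\<Sum>x\<in>?U. \<Sum>w\<in>?U. ?g x w d) = (\<Sum>x\<in>?U. \<Sum>w\<in>?U. lam r (b * x) * lam r (b * w))"
        proof (rule sum.cong[OF refl], rule sum.cong[OF refl])
          fix x w
          have "a * ((x + w) * (1 + inverse d)) = b * x + b * w" by (simp only: b_def ring_distribs ac_simps)
          then show "?g x w d = lam r (b * x) * lam r (b * w)" using False by (simp only: lam_add if_False)
        qed
        also have "\<dots> = (\<Sum>x\<in>?U. lam r (b * x)) * (\<Sum>w\<in>?U. lam r (b * w))" by (rule sum_product[symmetric])
        finally show ?thesis unfolding sum_lam using b by (simp add: power2_eq_square)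
      qed simp
    qed
    finally show ?thesis by simp
  qed
  finally show ?thesis by (simp only: mult.commute)
qed

end

section \<open>Closed forms for the double cosets\<close>

lemma sum_lessThan_square: "(\<Sum>j<s. j) + (\<Sum>j<s. j) + s = s * s" for s :: nat
  by (induction s) simp_all

lemma eq_divide_multI: "d \<noteq> 0 \<Longrightarrow> d * x = b * y \<Longrightarrow> x = b / d * (y :: real)"
  by (simp add: field_simps)

lemma div_4_eqI: "a = 4 * b \<Longrightarrow> a div 4 = (b :: int)"
  by simp

definition num_nonsing :: "'a::field itself \<Rightarrow> nat \<Rightarrow> real" where
  "num_nonsing _ n = real (card (nonsing n :: 'a mat set))"

definition num_sym :: "'a::field itself \<Rightarrow> nat \<Rightarrow> real" where
  "num_sym _ n = real (card (sym_nonsing n :: 'a mat set))"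

context char2_field
begin

abbreviation q :: real where "q \<equiv> 2 ^ r"
abbreviation odd_prod :: "nat \<Rightarrow> real" where "odd_prod k \<equiv> \<Prod>j=1..k. q ^ (2 * j - 1) - 1"
abbreviation even_prod :: "nat \<Rightarrow> real" where "even_prod k \<equiv> \<Prod>j=1..k. q ^ (2 * j) - 1"

lemma real_card: "real CARD('a) = q"
  by (simp add: card_field)

lemma q_ge_2: "q \<ge> 2"
  using power_increasing[OF r_pos, of "2::real"] by simp

lemma power_q_gt_1: "n > 0 \<Longrightarrow> q ^ n > 1"
  by (rule one_less_power) (use q_ge_2 in linarith)+

section \<open>The order of GL(n, q) and the number of invertible symmetric matrices\<close>

lemma num_nonsing_Suc: "num_nonsing ty (Suc n) = (q ^ Suc n - 1) * q ^ n * num_nonsing ty n"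
proof -
  have "(CARD('a) ^ Suc n) \<ge> 1" by simp
  then show ?thesis
    unfolding num_nonsing_def card_nonsing_Suc of_nat_mult of_nat_power real_card
    by (subst of_nat_diff) (simp_all only: of_nat_power real_card of_nat_1 mult.assoc)
qed

lemma num_nonsing_0: "num_nonsing ty 0 = 1"
  by (simp add: num_nonsing_def nonsing_0)

lemma num_nonsing_1: "num_nonsing ty 1 = q - 1"
  using num_nonsing_Suc[of 0] by (simp add: num_nonsing_0)

lemma num_nonsing_2: "num_nonsing ty 2 = (q\<^sup>2 - 1) * q * (q - 1)"
  using num_nonsing_Suc[of 1] unfolding num_nonsing_1 by (simp only: numeral_2_eq_2 One_nat_def power_Suc power_0 mult_1_right mult.assoc)

lemma num_nonsing_pos: "num_nonsing ty n > 0"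
proof (induction n)
  case (Suc n)
  then show ?case unfolding num_nonsing_Suc using power_q_gt_1[of "Suc n"] by (intro mult_pos_pos) simp_all
qed (simp add: num_nonsing_0)

lemma num_sym_Suc: "num_sym ty (Suc n) = (q - 1) * q ^ n * num_sym ty n + (q ^ n - 1) * q ^ n * num_sym ty (n - 1)"
proof -
  have 1: "CARD('a) ^ n \<le> CARD('a) ^ Suc n" "CARD('a) ^ n \<ge> 1" by simp_all
  have "num_sym ty (Suc n) = (q ^ Suc n - q ^ n) * num_sym ty n + (q ^ n - 1) * (q ^ n * num_sym ty (n - 1))"
    unfolding num_sym_def card_sym_nonsing_Suc of_nat_add of_nat_mult of_nat_diff[OF 1(1)] of_nat_diff[OF 1(2)]
      of_nat_power real_card by simp
  then show ?thesis by (simp add: algebra_simps)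
qed

lemma num_sym_0: "num_sym ty 0 = 1"
  by (simp add: num_sym_def sym_nonsing_0)

text \<open>The three-term recursion \<open>num_sym_Suc\<close> collapses to a single factor per
  step: q^n - 1 on reaching an odd size n, and q^n on reaching an even size n. The two cases feed
  each other, hence the joint induction.\<close>

lemma num_sym_Suc_eq: "num_sym ty (Suc (2 * k)) = (q ^ (2 * k + 1) - 1) * num_sym ty (2 * k) \<and>
    num_sym ty (2 * k + 2) = q ^ (2 * k + 2) * num_sym ty (2 * k + 1)"
proof (induction k)
  case 0
  have 1: "num_sym ty 1 = q - 1" using num_sym_Suc[of 0] by (simp add: num_sym_0)
  have "num_sym ty (Suc 1) = (q - 1) * q * (q - 1) + (q - 1) * q * 1" using num_sym_Suc[of 1] unfolding 1 by (simp add: num_sym_0)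
  also have "\<dots> = q\<^sup>2 * (q - 1)" by (simp add: power2_eq_square algebra_simps)
  finally show ?case using 1 by (simp add: num_sym_0 numeral_2_eq_2)
next
  case (Suc k)
  define p where "p = q ^ (2 * k + 2)"
  have IH: "num_sym ty (2 * k + 2) = p * num_sym ty (2 * k + 1)" using Suc by (simp add: p_def)
  have 1: "num_sym ty (2 * k + 3) = (q * p - 1) * num_sym ty (2 * k + 2)"
  proof -
    have "num_sym ty (2 * k + 3) = (q - 1) * p * num_sym ty (2 * k + 2) + (p - 1) * (p * num_sym ty (2 * k + 1))"
      using num_sym_Suc[of "2 * k + 2"] by (simp add: p_def numeral_3_eq_3)
    then show ?thesis unfolding IH[symmetric] by (simp add: algebra_simps)
  qed
  have p3: "q ^ (2 * k + 3) = q * p" by (simp add: p_def numeral_3_eq_3)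
  have 2: "num_sym ty (2 * k + 4) = q * q * p * num_sym ty (2 * k + 3)"
  proof -
    have "num_sym ty (Suc (2 * k + 3)) = (q - 1) * q ^ (2 * k + 3) * num_sym ty (2 * k + 3) + (q ^ (2 * k + 3) - 1) * q ^ (2 * k + 3) * num_sym ty (2 * k + 3 - 1)"
      by (rule num_sym_Suc)
    then have "num_sym ty (2 * k + 4) = (q - 1) * (q * p) * num_sym ty (2 * k + 3) + (q * p - 1) * (q * p) * num_sym ty (2 * k + 2)"
      unfolding p3 by (simp add: eval_nat_numeral)
    also have "(q * p - 1) * (q * p) * num_sym ty (2 * k + 2) = q * p * num_sym ty (2 * k + 3)" unfolding 1 by simp
    finally show ?thesis by (simp add: algebra_simps)
  qed
  have e: "Suc (2 * Suc k) = 2 * k + 3" "2 * Suc k = 2 * k + 2" "2 * k + 2 + 1 = 2 * k + 3" "2 * k + 2 + 2 = 2 * k + 4" "Suc (2 * k + 2) = 2 * k + 3"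
    by simp_all
  have "q ^ (2 * k + 4) = q * q * p" by (simp add: p_def power_add power4_eq_xxxx power2_eq_square)
  then show ?case unfolding e p3 by (simp only: 1 2)
qed

lemma num_sym_even: "num_sym ty (2 * k) = q ^ (k * k + k) * odd_prod k"
proof (induction k)
  case 0
  then show ?case by (simp add: num_sym_0)
next
  case (Suc k)
  have "num_sym ty (2 * Suc k) = q ^ (2 * k + 2) * ((q ^ (2 * k + 1) - 1) * num_sym ty (2 * k))"
    using num_sym_Suc_eq[of k] by simp
  also have "\<dots> = (q ^ (2 * k + 2) * q ^ (k * k + k)) * (odd_prod k * (q ^ (2 * k + 1) - 1))"
    unfolding Suc by (simp only: mult_ac)
  also have "q ^ (2 * k + 2) * q ^ (k * k + k) = q ^ (Suc k * Suc k + Suc k)"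
    unfolding power_add[symmetric] by (rule arg_cong[where f = "power q"]) simp
  finally show ?case by simp
qed

lemma num_sym_odd: "num_sym ty (2 * k + 1) = q ^ (k * k + k) * odd_prod (Suc k)"
proof -
  have "num_sym ty (2 * k + 1) = (q ^ (2 * k + 1) - 1) * num_sym ty (2 * k)" using num_sym_Suc_eq[of k] by simp
  then show ?thesis unfolding num_sym_even by simp
qed

lemma odd_prod_pos: "odd_prod k > 0"
  by (rule prod_pos) (simp add: power_q_gt_1 del: power_mult)

text \<open>The exponent of q in the order of GL(2k, q) is 2 k^2 - k; the factor q^k on the left
  keeps subtraction out of the exponents.\<close>

lemma num_nonsing_even: "q ^ k * num_nonsing ty (2 * k) = q ^ (2 * (k * k)) * odd_prod k * even_prod k"
proof (induction k)
  case 0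
  then show ?case by (simp add: num_nonsing_0)
next
  case (Suc k)
  have "q ^ Suc k * num_nonsing ty (2 * Suc k) =
      q * (q ^ k * ((q ^ (2 * k + 2) - 1) * q ^ (2 * k + 1) * ((q ^ (2 * k + 1) - 1) * q ^ (2 * k) * num_nonsing ty (2 * k))))"
    using num_nonsing_Suc[of "2 * k + 1"] num_nonsing_Suc[of "2 * k"] by (simp add: mult_ac)
  also have "\<dots> = (q * q ^ (2 * k + 1) * q ^ (2 * k)) * (q ^ (2 * k + 1) - 1) * (q ^ (2 * k + 2) - 1) * (q ^ k * num_nonsing ty (2 * k))"
    by (simp only: mult_ac)
  also have "\<dots> = (q * q ^ (2 * k + 1) * q ^ (2 * k) * q ^ (2 * (k * k))) * (odd_prod k * (q ^ (2 * k + 1) - 1)) * (even_prod k * (q ^ (2 * k + 2) - 1))"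
    unfolding Suc by (simp only: mult_ac)
  also have "q * q ^ (2 * k + 1) * q ^ (2 * k) * q ^ (2 * (k * k)) = q ^ (2 * (Suc k * Suc k))"
    unfolding power_Suc[symmetric] power_add[symmetric] by (rule arg_cong[where f = "power q"]) simp
  finally show ?case by simp
qed

lemma num_nonsing_odd: "num_nonsing ty (2 * k + 1) = (q ^ (2 * k + 1) - 1) * q ^ (2 * k) * num_nonsing ty (2 * k)"
  using num_nonsing_Suc[of "2 * k"] by simp

section \<open>Sizes and character sums of the double cosets\<close>

lemma DC_real:
  fixes s m :: nat
  defines "n \<equiv> s + m"
  shows "num_nonsing ty s * num_nonsing ty m * q ^ (m * s) * real (card (DC m n :: 'a mat set)) =
      (num_nonsing ty n)\<^sup>2 * q ^ (\<Sum>j<n. j) * q ^ (\<Sum>j<s. j)"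
    and "a \<noteq> 0 \<Longrightarrow> num_nonsing ty s * num_nonsing ty m * real_of_int (\<Sum>g\<in>DC m n. lam r (a * mat_trace g)) =
      num_nonsing ty n * q ^ (\<Sum>j<n. j) * q ^ (\<Sum>j<s. j) * num_sym ty s * real_of_int (KGL m a)"
proof -
  let ?c = "\<lambda>k. q ^ (\<Sum>j<k. j)"
  \<comment> \<open>\<open>M\<close> is eliminated between \<open>card_stabilizer\<close> and
    \<open>DC_sums\<close>; the common powers of q are then cancelled.\<close>
  define M where "M = card {p \<in> (P_plus n :: 'a mat set). sigma_plus n s * p * sigma_plus n s \<in> P_plus n}"
  have P: "real (card (P_plus n :: 'a mat set)) = num_nonsing ty n * ?c n"
    by (simp add: num_nonsing_def card_P_plus real_card)
  have M: "real M * ?c s = num_nonsing ty s * (num_nonsing ty m * q ^ (m * s)) * ?c n"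
    using arg_cong[OF card_stabilizer[of s m], of real]
    unfolding num_nonsing_def M_def n_def of_nat_mult of_nat_power real_card .
  have "real M * real (card (DC m n :: 'a mat set)) = (num_nonsing ty n * ?c n)\<^sup>2"
    using arg_cong[OF DC_sums(1)[of s m], of real_of_int] unfolding M_def n_def P[symmetric, unfolded n_def]
    by simp
  then have "?c n * (num_nonsing ty s * num_nonsing ty m * q ^ (m * s) * real (card (DC m n :: 'a mat set))) =
      ?c n * ((num_nonsing ty n)\<^sup>2 * ?c n * ?c s)"
  proof -
    assume MN: "real M * real (card (DC m n :: 'a mat set)) = (num_nonsing ty n * ?c n)\<^sup>2"
    have "?c n * (num_nonsing ty s * num_nonsing ty m * q ^ (m * s) * real (card (DC m n :: 'a mat set))) =
        (real M * ?c s) * real (card (DC m n :: 'a mat set))" unfolding M by (simp only: mult_ac)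
    also have "\<dots> = (num_nonsing ty n * ?c n)\<^sup>2 * ?c s" unfolding MN[symmetric] by (simp only: mult_ac)
    finally show ?thesis by (simp only: power2_eq_square mult_ac)
  qed
  then show "num_nonsing ty s * num_nonsing ty m * q ^ (m * s) * real (card (DC m n :: 'a mat set)) = (num_nonsing ty n)\<^sup>2 * ?c n * ?c s"
    by simp
  assume a: "a \<noteq> 0"
  let ?E = "real_of_int (\<Sum>g\<in>DC m n. lam r (a * mat_trace g))"
  have "real M * ?E = num_nonsing ty n * ?c n * (?c n * (num_sym ty s * (real_of_int (KGL m a) * q ^ (m * s))))"
    unfolding num_sym_def using arg_cong[OF DC_sums(2)[OF a, of s m], of real_of_int] unfolding M_def n_def P[symmetric, unfolded n_def]
    by simp
  then have "(real M * ?E) * ?c s = num_nonsing ty n * ?c n * (?c n * (num_sym ty s * (real_of_int (KGL m a) * q ^ (m * s)))) * ?c s"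
    by (rule arg_cong)
  moreover have "(real M * ?E) * ?c s = (real M * ?c s) * ?E" by (simp only: mult_ac)
  ultimately have "(q ^ (m * s) * ?c n) * (num_nonsing ty s * num_nonsing ty m * ?E) = (q ^ (m * s) * ?c n) * (num_nonsing ty n * ?c n * ?c s * num_sym ty s * real_of_int (KGL m a))"
    unfolding M by (simp only: mult_ac)
  then show "num_nonsing ty s * num_nonsing ty m * ?E = num_nonsing ty n * ?c n * ?c s * num_sym ty s * real_of_int (KGL m a)"
    by simp
qed

lemma powi_eqI: "i = int e \<Longrightarrow> x powi i = (x :: real) ^ e"
  by simp

lemma DC_1_card_sum:
  fixes s :: nat and a :: 'a
  defines "n \<equiv> Suc s"
  shows "real (card (DC 1 n :: 'a mat set)) = gauss_binom n 1 q * (num_nonsing ty n * q ^ (s * s))"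
    and "a \<noteq> 0 \<Longrightarrow> real_of_int (\<Sum>g\<in>DC 1 n. lam r (a * mat_trace g)) =
      gauss_binom n 1 q * q ^ (s * s + s) * num_sym ty s * real_of_int (Kl r a)"
proof -
  let ?C = "q ^ (\<Sum>j<s. j)" and ?N = "real (card (DC 1 n :: 'a mat set))"
  have gl: "num_nonsing ty n = (q ^ n - 1) * q ^ s * num_nonsing ty s" using num_nonsing_Suc[of s] by (simp add: n_def)
  have gb: "gauss_binom n 1 q = (q ^ n - 1) / (q - 1)" by (simp add: gauss_binom_def)
  \<comment> \<open>The two triangular exponents, for n = s + 1 and for s, add up to s^2.\<close>
  have C: "q ^ (\<Sum>j<n. j) * ?C = q ^ (s * s)"
    unfolding sum_lessThan_square[of s, symmetric] power_add by (simp add: n_def power_add)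
  have nz: "num_nonsing ty s \<noteq> 0" "q - 1 \<noteq> 0" "q ^ s \<noteq> 0" using num_nonsing_pos[of s] q_ge_2 by (simp_all add: less_imp_neq)
  have "num_nonsing ty s * (q - 1) * q ^ s * ?N = (num_nonsing ty n)\<^sup>2 * (q ^ (\<Sum>j<n. j) * ?C)"
    using DC_real(1)[of s 1] num_nonsing_1 by (simp add: n_def)
  then have "(num_nonsing ty s * q ^ s) * ((q - 1) * ?N) = (num_nonsing ty s * q ^ s) * ((q ^ n - 1) * (num_nonsing ty n * q ^ (s * s)))"
    unfolding C power2_eq_square gl by (simp only: mult_ac)
  then have "(q - 1) * ?N = (q ^ n - 1) * (num_nonsing ty n * q ^ (s * s))" using nz by simp
  then show "?N = gauss_binom n 1 q * (num_nonsing ty n * q ^ (s * s))"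
    unfolding gb using nz(2) by (simp add: field_simps)
  assume a: "a \<noteq> 0"
  let ?E = "real_of_int (\<Sum>g\<in>DC 1 n. lam r (a * mat_trace g))"
  have "num_nonsing ty s * (q - 1) * ?E = num_nonsing ty n * (q ^ (\<Sum>j<n. j) * ?C) * num_sym ty s * real_of_int (Kl r a)"
    using DC_real(2)[OF a, of s 1] num_nonsing_1 by (simp add: n_def KGL_1[OF a, unfolded One_nat_def] Kl_square)
  then have "num_nonsing ty s * ((q - 1) * ?E) = num_nonsing ty s * ((q ^ n - 1) * (q ^ (s * s + s) * num_sym ty s * real_of_int (Kl r a)))"
    unfolding C gl power_add by (simp only: mult_ac)
  then have "(q - 1) * ?E = (q ^ n - 1) * (q ^ (s * s + s) * num_sym ty s * real_of_int (Kl r a))" using nz by simp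
  then show "?E = gauss_binom n 1 q * q ^ (s * s + s) * num_sym ty s * real_of_int (Kl r a)"
    unfolding gb using nz(2) by (simp add: field_simps)
qed

lemma DC_2_card_sum:
  fixes s :: nat and a :: 'a
  defines "n \<equiv> Suc (Suc s)"
  shows "real (card (DC 2 n :: 'a mat set)) = gauss_binom n 2 q * (num_nonsing ty n * q ^ (s * s + s + 1))"
    and "a \<noteq> 0 \<Longrightarrow> real_of_int (\<Sum>g\<in>DC 2 n. lam r (a * mat_trace g)) =
      gauss_binom n 2 q * q ^ (s * s + 3 * s + 2) * num_sym ty s * (real_of_int (Kl2 r a) + q\<^sup>2)"
proof -
  let ?C = "q ^ (\<Sum>j<s. j)" and ?N = "real (card (DC 2 n :: 'a mat set))"
  let ?b = "(q ^ n - 1) * (q ^ Suc s - 1)" and ?d = "(q\<^sup>2 - 1) * (q - 1)"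
  have gl: "num_nonsing ty n = ?b * (q ^ Suc s * q ^ s) * num_nonsing ty s"
    using num_nonsing_Suc[of s] num_nonsing_Suc[of "Suc s"] by (simp add: n_def mult_ac)
  have gb: "gauss_binom n 2 q = ?b / ?d" by (simp add: gauss_binom_def n_def numeral_2_eq_2)
  have C: "q ^ (\<Sum>j<n. j) * ?C = q ^ (s * s + s + 1)"
    unfolding sum_lessThan_square[of s, symmetric] power_add by (simp add: n_def power_add)
  have n2: "n = s + 2" by (simp add: n_def)
  have nz: "num_nonsing ty s \<noteq> 0" "?d \<noteq> 0" "q \<noteq> 0"
  proof -
    have "q\<^sup>2 - 1 \<noteq> 0" "q - 1 \<noteq> 0" using power_q_gt_1[of 2] q_ge_2 by linarith+
    then show "?d \<noteq> 0" by simp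
  qed (use num_nonsing_pos[of s] in simp_all)
  have qs: "q ^ Suc s * q ^ s = q * q ^ (2 * s)" by (simp add: mult_2 power_add)
  have "num_nonsing ty s * (?d * q) * q ^ (2 * s) * ?N = (num_nonsing ty n)\<^sup>2 * (q ^ (\<Sum>j<n. j) * ?C)"
    using DC_real(1)[of s 2] num_nonsing_2 unfolding n2 by (simp only: mult_ac)
  then have "num_nonsing ty s * (?d * q) * q ^ (2 * s) * ?N = ?b * (q ^ Suc s * q ^ s) * num_nonsing ty s * (num_nonsing ty n * q ^ (s * s + s + 1))"
    unfolding C power2_eq_square[of "num_nonsing ty n"] gl[symmetric] by (simp only: mult_ac)
  then have "(num_nonsing ty s * q * q ^ (2 * s)) * (?d * ?N) = (num_nonsing ty s * q * q ^ (2 * s)) * (?b * (num_nonsing ty n * q ^ (s * s + s + 1)))"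
    unfolding qs by (simp only: mult_ac)
  then have "?d * ?N = ?b * (num_nonsing ty n * q ^ (s * s + s + 1))" using nz by simp
  then show "?N = gauss_binom n 2 q * (num_nonsing ty n * q ^ (s * s + s + 1))"
    unfolding gb by (rule eq_divide_multI[OF nz(2)])
  assume a: "a \<noteq> 0"
  let ?E = "real_of_int (\<Sum>g\<in>DC 2 n. lam r (a * mat_trace g))" and ?K = "real_of_int (Kl2 r a) + q\<^sup>2"
  \<comment> \<open>Carlitz's identity K^2 = K_2 + q turns q K^2 + q^2 (q - 1) into q (K_2 + q^2).
    This is the origin of the shift by q^2.\<close>
  have "KGL 2 a = Q * (Kl2 r a + Q\<^sup>2)"
    unfolding KGL_2[OF a] Kl_square Kl2_eq[OF a] by (simp add: power2_eq_square algebra_simps)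
  then have K: "real_of_int (KGL 2 a) = q * ?K" by simp
  have "num_nonsing ty s * (?d * q) * ?E = num_nonsing ty n * (q ^ (\<Sum>j<n. j) * ?C) * num_sym ty s * (q * ?K)"
    using DC_real(2)[OF a, of s 2] num_nonsing_2 unfolding n2 K by (simp only: mult_ac)
  then have "(num_nonsing ty s * q) * (?d * ?E) = (num_nonsing ty s * q) * (?b * ((q ^ Suc s * q ^ s * q ^ (s * s + s + 1)) * num_sym ty s * ?K))"
    unfolding C gl by (simp only: mult_ac)
  moreover have "q ^ Suc s * q ^ s * q ^ (s * s + s + 1) = q ^ (s * s + 3 * s + 2)"
    unfolding power_add[symmetric] by (rule arg_cong[where f = "power q"]) simp
  ultimately have "?d * ?E = ?b * (q ^ (s * s + 3 * s + 2) * num_sym ty s * ?K)" using nz by simp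
  then have "?E = ?b / ?d * (q ^ (s * s + 3 * s + 2) * num_sym ty s * ?K)"
    by (rule eq_divide_multI[OF nz(2)])
  then show "?E = gauss_binom n 2 q * q ^ (s * s + 3 * s + 2) * num_sym ty s * ?K"
    unfolding gb by (simp only: mult.assoc)
qed

section \<open>The constants A and B as matrix counts\<close>

lemma gauss_binom_q_neq_0: "k \<le> n \<Longrightarrow> gauss_binom n k q \<noteq> 0"
proof -
  assume "k \<le> n"
  have "(q ^ (n - j) - 1) / (q ^ (k - j) - 1) \<noteq> 0" if "j < k" for j
    using power_q_gt_1[of "n - j"] power_q_gt_1[of "k - j"] that \<open>k \<le> n\<close> by simp
  then show ?thesis unfolding gauss_binom_def by simp
qed

lemma num_sym_neq_0: "num_sym ty s \<noteq> 0"
proof (cases "even s")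
  case True
  then obtain k where "s = 2 * k" by (rule evenE)
  have "num_sym ty s > 0" unfolding \<open>s = 2 * k\<close> num_sym_even by (rule mult_pos_pos[OF _ odd_prod_pos]) simp
  then show ?thesis by simp
next
  case False
  then obtain k where "s = 2 * k + 1" by (rule oddE)
  have "num_sym ty s > 0" unfolding \<open>s = 2 * k + 1\<close> num_sym_odd by (rule mult_pos_pos[OF _ odd_prod_pos]) simp
  then show ?thesis by simp
qed

text \<open>The right side is the factor of K in \<open>DC_1_card_sum\<close>. The exponent in
  \<open>A1\<close> is s^2 + s with s = n - 1, increased by the k^2 + k hidden in
  \<open>num_sym\<close>.\<close>

lemma A1_Plus: "A1 Plus (2 * k + 2) q = gauss_binom (2 * k + 2) 1 q * q ^ ((2 * k + 1) * (2 * k + 1) + (2 * k + 1)) * num_sym ty (2 * k + 1)"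
proof -
  have e: "(5 * int (2 * k + 2) ^ 2 - 6 * int (2 * k + 2)) div 4 = int (((2 * k + 1) * (2 * k + 1) + (2 * k + 1)) + (k * k + k))"
    by (rule div_4_eqI) (simp add: power2_eq_square algebra_simps)
  have "(2 * k + 2) div 2 = Suc k" by simp
  then show ?thesis unfolding A1.simps powi_eqI[OF e] num_sym_odd power_add by (simp only: mult_ac)
qed

lemma A1_Minus: "A1 Minus (2 * k + 1) q = gauss_binom (2 * k + 1) 1 q * q ^ (2 * k * (2 * k) + 2 * k) * num_sym ty (2 * k)"
proof -
  have e: "(5 * int (2 * k + 1) ^ 2 - 4 * int (2 * k + 1) - 1) div 4 = int ((2 * k * (2 * k) + 2 * k) + (k * k + k))"
    by (rule div_4_eqI) (simp add: power2_eq_square algebra_simps)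
  have "(2 * k + 1 - 1) div 2 = k" by simp
  then show ?thesis unfolding A1.simps powi_eqI[OF e] num_sym_even power_add by (simp only: mult_ac)
qed

text \<open>The exponent now is s^2 + 3 s + 2 with s = n - 2, from \<open>DC_2_card_sum\<close>,
  again increased by k^2 + k from \<open>num_sym\<close>.\<close>

lemma A2_Plus: "A2 Plus (2 * k + 2) q = gauss_binom (2 * k + 2) 2 q * q ^ (2 * k * (2 * k) + 3 * (2 * k) + 2) * num_sym ty (2 * k)"
proof -
  have e: "(5 * int (2 * k + 2) ^ 2 - 6 * int (2 * k + 2)) div 4 = int ((2 * k * (2 * k) + 3 * (2 * k) + 2) + (k * k + k))"
    by (rule div_4_eqI) (simp add: power2_eq_square algebra_simps)
  have "(2 * k + 2 - 2) div 2 = k" by simp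
  then show ?thesis unfolding A2.simps powi_eqI[OF e] num_sym_even power_add by (simp only: mult_ac)
qed

lemma A2_Minus: "A2 Minus (2 * k + 3) q = gauss_binom (2 * k + 3) 2 q * q ^ ((2 * k + 1) * (2 * k + 1) + 3 * (2 * k + 1) + 2) * num_sym ty (2 * k + 1)"
proof -
  have e: "(5 * int (2 * k + 3) ^ 2 - 8 * int (2 * k + 3) + 3) div 4 = int (((2 * k + 1) * (2 * k + 1) + 3 * (2 * k + 1) + 2) + (k * k + k))"
    by (rule div_4_eqI) (simp add: power2_eq_square algebra_simps)
  have "(2 * k + 3 - 1) div 2 = Suc k" by simp
  then show ?thesis unfolding A2.simps powi_eqI[OF e] num_sym_odd power_add by (simp only: mult_ac)
qed

text \<open>B is the size of the double coset divided by A. By \<open>DC_1_card_sum\<close> this is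
  the order of GL(n, q) over q^s times the number of symmetric matrices of size s = n - 1. The proof
  multiplies both sides by q^(k + 1) to match \<open>num_nonsing_even\<close>.\<close>

lemma num_nonsing_B1_Plus: "num_nonsing ty (2 * k + 2) = q ^ (2 * k + 1) * num_sym ty (2 * k + 1) * B1 Plus (2 * k + 2) q"
proof -
  have e: "(int (2 * k + 2) - 2) ^ 2 div 4 = int (k * k)"
    by (rule div_4_eqI) (simp add: power2_eq_square algebra_simps)
  have d: "(2 * k + 2) div 2 = Suc k" by simp
  have "q ^ Suc k * num_nonsing ty (2 * k + 2) = q ^ (2 * (Suc k * Suc k)) * odd_prod (Suc k) * even_prod (Suc k)"
    using num_nonsing_even[of "Suc k"] by simp
  also have "q ^ (2 * (Suc k * Suc k)) = q ^ Suc k * (q ^ (2 * k + 1) * q ^ (k * k + k) * q ^ (k * k))"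
    unfolding power_add[symmetric] by (rule arg_cong[where f = "power q"]) simp
  also have "\<dots> * odd_prod (Suc k) * even_prod (Suc k) = q ^ Suc k * (q ^ (2 * k + 1) * num_sym ty (2 * k + 1) * B1 Plus (2 * k + 2) q)"
    unfolding B1.simps powi_eqI[OF e] num_sym_odd d by (simp only: mult_ac)
  finally show ?thesis using q_ge_2 by simp
qed

text \<open>The exponent k^2 - 2 k is -1 at k = 1, the case of \<open>B1 Minus 3\<close> and
  \<open>B2 Plus 4\<close>, so it has to be an integer power.\<close>

lemma powi_square_diff: "q powi (int k * int k - 2 * int k) * q ^ (2 * k) = q ^ (k * k)"
proof -
  have "q powi (int k * int k - 2 * int k) * q powi (int (2 * k)) = q powi (int (k * k))"
    using q_ge_2 by (subst power_int_add[symmetric]) simp_all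
  then show ?thesis unfolding power_int_of_nat .
qed

lemma num_nonsing_B1_Minus: "num_nonsing ty (2 * k + 1) = q ^ (2 * k) * num_sym ty (2 * k) * B1 Minus (2 * k + 1) q"
proof -
  have e: "(int (2 * k + 1) ^ 2 - 6 * int (2 * k + 1) + 5) div 4 = int k * int k - 2 * int k"
    by (rule div_4_eqI) (simp add: power2_eq_square algebra_simps)
  have d: "(2 * k + 1 - 1) div 2 = k" by simp
  have "q ^ k * num_nonsing ty (2 * k + 1) = (q ^ (2 * k + 1) - 1) * q ^ (2 * k) * (q ^ (2 * (k * k)) * odd_prod k * even_prod k)"
    unfolding num_nonsing_odd num_nonsing_even[symmetric] by (simp only: mult_ac)
  also have "q ^ (2 * (k * k)) = q ^ (k * k) * (q powi (int k * int k - 2 * int k) * q ^ (2 * k))"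
    unfolding powi_square_diff power_add[symmetric] by (simp add: mult_2)
  also have "(q ^ (2 * k + 1) - 1) * q ^ (2 * k) * (q ^ (k * k) * (q powi (int k * int k - 2 * int k) * q ^ (2 * k)) * odd_prod k * even_prod k)
      = (q ^ (k * k) * q ^ (2 * k)) * (q ^ (2 * k) * (odd_prod k * (q powi (int k * int k - 2 * int k) * (q ^ (2 * k + 1) - 1) * even_prod k)))"
    by (simp only: mult_ac)
  also have "q ^ (k * k) * q ^ (2 * k) = q ^ k * q ^ (k * k + k)"
    unfolding power_add[symmetric] by (rule arg_cong[where f = "power q"]) simp
  also have "\<dots> * (q ^ (2 * k) * (odd_prod k * (q powi (int k * int k - 2 * int k) * (q ^ (2 * k + 1) - 1) * even_prod k)))
      = q ^ k * (q ^ (2 * k) * num_sym ty (2 * k) * B1 Minus (2 * k + 1) q)"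
    unfolding B1.simps e num_sym_even d by (simp only: mult_ac)
  finally show ?thesis using q_ge_2 by simp
qed

text \<open>By \<open>DC_2_card_sum\<close>, size divided by A is the order of GL(n, q) over q^(2 s
  + 1) times the number of symmetric matrices of size s = n - 2.\<close>

lemma num_nonsing_B2_Plus: "num_nonsing ty (2 * k + 2) = q ^ (2 * (2 * k) + 1) * num_sym ty (2 * k) * B2 Plus (2 * k + 2) q"
proof -
  have e: "(int (2 * k + 2) ^ 2 - 8 * int (2 * k + 2) + 12) div 4 = int k * int k - 2 * int k"
    by (rule div_4_eqI) (simp add: power2_eq_square algebra_simps)
  have d: "(2 * k + 2 - 2) div 2 = k" "2 * k + 2 - 1 = 2 * k + 1" by simp_all
  have "num_nonsing ty (2 * k + 2) = (q ^ (2 * k + 2) - 1) * q ^ (2 * k + 1) * num_nonsing ty (2 * k + 1)"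
    using num_nonsing_Suc[of "2 * k + 1"] by simp
  then have "q ^ k * num_nonsing ty (2 * k + 2) =
      (q ^ (2 * k + 2) - 1) * q ^ (2 * k + 1) * (q ^ (2 * k + 1) - 1) * q ^ (2 * k) * (q ^ (2 * (k * k)) * odd_prod k * even_prod k)"
    unfolding num_nonsing_odd num_nonsing_even[symmetric] by (simp only: mult_ac)
  also have "q ^ (2 * (k * k)) = q ^ (k * k) * (q powi (int k * int k - 2 * int k) * q ^ (2 * k))"
    unfolding powi_square_diff power_add[symmetric] by (simp add: mult_2)
  also have "(q ^ (2 * k + 2) - 1) * q ^ (2 * k + 1) * (q ^ (2 * k + 1) - 1) * q ^ (2 * k) *
        (q ^ (k * k) * (q powi (int k * int k - 2 * int k) * q ^ (2 * k)) * odd_prod k * even_prod k)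
      = (q ^ (2 * k + 1) * q ^ (2 * k) * q ^ (k * k) * q ^ (2 * k)) * (odd_prod k * (q powi (int k * int k - 2 * int k) *
        (q ^ (2 * k + 1) - 1) * (q ^ (2 * k + 2) - 1) * even_prod k))"
    by (simp only: mult_ac)
  also have "q ^ (2 * k + 1) * q ^ (2 * k) * q ^ (k * k) * q ^ (2 * k) = q ^ k * (q ^ (2 * (2 * k) + 1) * q ^ (k * k + k))"
    unfolding power_add[symmetric] by (rule arg_cong[where f = "power q"]) simp
  also have "\<dots> * (odd_prod k * (q powi (int k * int k - 2 * int k) * (q ^ (2 * k + 1) - 1) * (q ^ (2 * k + 2) - 1) * even_prod k))
      = q ^ k * (q ^ (2 * (2 * k) + 1) * num_sym ty (2 * k) * B2 Plus (2 * k + 2) q)"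
    unfolding B2.simps e num_sym_even d by (simp only: mult_ac)
  finally show ?thesis using q_ge_2 by simp
qed

lemma num_nonsing_B2_Minus: "num_nonsing ty (2 * k + 3) = q ^ (2 * (2 * k + 1) + 1) * num_sym ty (2 * k + 1) * B2 Minus (2 * k + 3) q"
proof -
  have e: "(int (2 * k + 3) - 3) ^ 2 div 4 = int (k * k)"
    by (rule div_4_eqI) (simp add: power2_eq_square algebra_simps)
  have d: "(2 * k + 3 - 1) div 2 = Suc k" by simp
  have e1: "num_nonsing ty (2 * k + 3) = (q ^ (2 * k + 3) - 1) * q ^ (2 * k + 2) * num_nonsing ty (2 * k + 2)"
    using num_nonsing_Suc[of "2 * k + 2"] by (simp add: numeral_3_eq_3)
  have e2: "q ^ Suc k * num_nonsing ty (2 * k + 2) = q ^ (2 * (Suc k * Suc k)) * odd_prod (Suc k) * even_prod (Suc k)"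
    using num_nonsing_even[of "Suc k"] by simp
  have "q ^ Suc k * num_nonsing ty (2 * k + 3) = (q ^ (2 * k + 3) - 1) * q ^ (2 * k + 2) *
      (q ^ (2 * (Suc k * Suc k)) * odd_prod (Suc k) * even_prod (Suc k))"
    unfolding e1 e2[symmetric] by (simp only: mult_ac)
  also have "\<dots> = (q ^ (2 * k + 2) * q ^ (2 * (Suc k * Suc k))) * ((q ^ (2 * k + 3) - 1) * odd_prod (Suc k) * even_prod (Suc k))"
    by (simp only: mult_ac)
  also have "q ^ (2 * k + 2) * q ^ (2 * (Suc k * Suc k)) = q ^ Suc k * (q ^ (2 * (2 * k + 1) + 1) * q ^ (k * k + k) * q ^ (k * k))"
    unfolding power_add[symmetric] by (rule arg_cong[where f = "power q"]) simp
  also have "\<dots> * ((q ^ (2 * k + 3) - 1) * odd_prod (Suc k) * even_prod (Suc k))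
      = q ^ Suc k * (q ^ (2 * (2 * k + 1) + 1) * num_sym ty (2 * k + 1) * B2 Minus (2 * k + 3) q)"
    unfolding B2.simps powi_eqI[OF e] num_sym_odd d by (simp only: mult_ac)
  finally show ?thesis using q_ge_2 by simp
qed

lemma DC_1_values:
  fixes a :: 'a
  assumes "(s = Plus \<and> even n \<and> n \<ge> 2) \<or> (s = Minus \<and> odd n)"
  shows "A1 s n q \<noteq> 0"
    and "real (card (DC 1 n :: 'a mat set)) = A1 s n q * B1 s n q"
    and "a \<noteq> 0 \<Longrightarrow> real_of_int (\<Sum>g\<in>DC 1 n. lam r (a * mat_trace g)) = A1 s n q * real_of_int (Kl r a)"
proof -
  obtain m where n: "n = Suc m" using assms by (cases n) auto
  have "A1 s n q = gauss_binom n 1 q * q ^ (m * m + m) * num_sym ty m \<and> num_nonsing ty n = q ^ m * num_sym ty m * B1 s n q"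
    using assms
  proof
    assume *: "s = Plus \<and> even n \<and> n \<ge> 2"
    then obtain j where "n = 2 * j" by auto
    then obtain k where "n = 2 * k + 2" using * by (cases j) auto
    then have k: "n = 2 * k + 2" "m = 2 * k + 1" using n by simp_all
    show ?thesis unfolding k using A1_Plus num_nonsing_B1_Plus * by simp
  next
    assume *: "s = Minus \<and> odd n"
    then obtain k where "n = 2 * k + 1" by (auto elim: oddE)
    then have k: "n = 2 * k + 1" "m = 2 * k" using n by simp_all
    show ?thesis unfolding k using A1_Minus num_nonsing_B1_Minus * by simp
  qed
  then have A: "A1 s n q = gauss_binom n 1 q * q ^ (m * m + m) * num_sym ty m" and B: "num_nonsing ty n = q ^ m * num_sym ty m * B1 s n q"
    by blast+
  show "A1 s n q \<noteq> 0"
    unfolding A using gauss_binom_q_neq_0[of 1 n] n num_sym_neq_0[of m] q_ge_2 by simp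
  have "real (card (DC 1 n :: 'a mat set)) = gauss_binom n 1 q * (num_nonsing ty n * q ^ (m * m))"
    unfolding n by (rule DC_1_card_sum)
  then show "real (card (DC 1 n :: 'a mat set)) = A1 s n q * B1 s n q"
    unfolding A B power_add by (simp only: mult_ac)
  show "real_of_int (\<Sum>g\<in>DC 1 n. lam r (a * mat_trace g)) = A1 s n q * real_of_int (Kl r a)" if "a \<noteq> 0"
    unfolding A unfolding n by (rule DC_1_card_sum(2)[OF that])
qed

lemma DC_2_values:
  fixes a :: 'a
  assumes "(s = Plus \<and> even n \<and> n \<ge> 2) \<or> (s = Minus \<and> odd n \<and> n \<ge> 3)"
  shows "A2 s n q \<noteq> 0"
    and "real (card (DC 2 n :: 'a mat set)) = A2 s n q * B2 s n q"
    and "a \<noteq> 0 \<Longrightarrow> real_of_int (\<Sum>g\<in>DC 2 n. lam r (a * mat_trace g)) = A2 s n q * (real_of_int (Kl2 r a) + q\<^sup>2)"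
proof -
  have "2 \<le> n" using assms by auto
  then obtain m where n: "n = Suc (Suc m)" by (auto dest: le_Suc_ex)
  have "A2 s n q = gauss_binom n 2 q * q ^ (m * m + 3 * m + 2) * num_sym ty m \<and> num_nonsing ty n = q ^ (2 * m + 1) * num_sym ty m * B2 s n q"
    using assms
  proof
    assume *: "s = Plus \<and> even n \<and> n \<ge> 2"
    then obtain k where "m = 2 * k" using n by auto
    then have k: "n = 2 * k + 2" "m = 2 * k" using n by simp_all
    show ?thesis unfolding k using A2_Plus num_nonsing_B2_Plus * by simp
  next
    assume *: "s = Minus \<and> odd n \<and> n \<ge> 3"
    then obtain k where "m = 2 * k + 1" using n by (auto elim: oddE)
    then have k: "n = 2 * k + 3" "m = 2 * k + 1" using n by simp_all
    show ?thesis unfolding k using A2_Minus num_nonsing_B2_Minus * by simp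
  qed
  then have A: "A2 s n q = gauss_binom n 2 q * q ^ (m * m + 3 * m + 2) * num_sym ty m" and B: "num_nonsing ty n = q ^ (2 * m + 1) * num_sym ty m * B2 s n q"
    by blast+
  show "A2 s n q \<noteq> 0"
    unfolding A using gauss_binom_q_neq_0[of 2 n] n num_sym_neq_0[of m] q_ge_2 by simp
  have "real (card (DC 2 n :: 'a mat set)) = gauss_binom n 2 q * (num_nonsing ty n * q ^ (m * m + m + 1))"
    unfolding n by (rule DC_2_card_sum)
  also have "\<dots> = gauss_binom n 2 q * (q ^ (2 * m + 1) * q ^ (m * m + m + 1)) * num_sym ty m * B2 s n q"
    unfolding B by (simp only: mult_ac)
  also have "q ^ (2 * m + 1) * q ^ (m * m + m + 1) = q ^ (m * m + 3 * m + 2)"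
    unfolding power_add[symmetric] by (rule arg_cong[where f = "power q"]) simp
  finally show "real (card (DC 2 n :: 'a mat set)) = A2 s n q * B2 s n q"
    unfolding A .
  show "real_of_int (\<Sum>g\<in>DC 2 n. lam r (a * mat_trace g)) = A2 s n q * (real_of_int (Kl2 r a) + q\<^sup>2)" if "a \<noteq> 0"
    unfolding A unfolding n by (rule DC_2_card_sum(2)[OF that])
qed

end

section \<open>Weight distributions and recursions\<close>

lemma sum_list_distinct:
  assumes "distinct gs"
  shows "(\<Sum>i<length gs. f (gs ! i)) = (\<Sum>g\<in>set gs. f g)"
  by (rule sum.reindex_bij_betw[OF bij_betw_nth[OF assms refl refl]])

lemma real_weight_count:
  fixes gs :: "'a::{field,finite} mat list"
  shows "real (weight_count gs j) = (\<Sum>\<nu>\<in>zero_sum_families j. \<Prod>b\<in>UNIV.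
    binom (real (card {i\<in>{..<length gs}. mat_trace (gs ! i) = b})) (int (\<nu> b)))"
  unfolding weight_count_eq card_zero_sum_subsets[OF finite_lessThan] binom_of_nat by simp

lemma finite_int_bounded: "finite {\<tau>::int. \<bar>real_of_int \<tau>\<bar> < c \<and> P \<tau>}"
proof (rule finite_subset)
  show "{\<tau>. \<bar>real_of_int \<tau>\<bar> < c \<and> P \<tau>} \<subseteq> {- \<lceil>c\<rceil>..\<lceil>c\<rceil>}"
  proof
    fix \<tau> assume "\<tau> \<in> {\<tau>. \<bar>real_of_int \<tau>\<bar> < c \<and> P \<tau>}"
    then have "\<bar>real_of_int \<tau>\<bar> < c" by simp
    then have "\<bar>real_of_int \<tau>\<bar> \<le> real_of_int \<lceil>c\<rceil>" using le_of_int_ceiling[of c] by linarith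
    then have "\<bar>\<tau>\<bar> \<le> \<lceil>c\<rceil>" by linarith
    then show "\<tau> \<in> {- \<lceil>c\<rceil>..\<lceil>c\<rceil>}" by auto
  qed
qed simp

context char2_field
begin

text \<open>Fourier inversion: the fibres of the trace are read off from the character sums through
  \<open>card_fibre_eq\<close>.\<close>

lemma card_trace_fibre:
  fixes gs :: "'a mat list"
  assumes gs: "distinct gs"
    and N: "real (card (set gs)) = A * B"
    and k: "\<And>a. a \<noteq> 0 \<Longrightarrow> real_of_int (\<Sum>g\<in>set gs. lam r (a * mat_trace g)) = A * k a"
  shows "real (card {i\<in>{..<length gs}. mat_trace (gs ! i) = b}) =
    A * (B + (\<Sum>a\<in>UNIV - {0}. real_of_int (lam r (a * b)) * k a)) / q"
proof -
  let ?n = "card {i\<in>{..<length gs}. mat_trace (gs ! i) = b}"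
  have "real_of_int (Q * int ?n) = real_of_int (int (card {..<length gs}) +
      (\<Sum>a\<in>UNIV - {0}. lam r (a * b) * (\<Sum>i<length gs. lam r (a * mat_trace (gs ! i)))))"
    by (rule arg_cong[OF card_fibre_eq]) simp
  then have "q * real ?n = real (length gs) +
      (\<Sum>a\<in>UNIV - {0}. real_of_int (lam r (a * b)) * real_of_int (\<Sum>g\<in>set gs. lam r (a * mat_trace g)))"
    by (simp add: sum_list_distinct[OF gs, where f = "\<lambda>g. lam r (_ * mat_trace g)"])
  also have "(\<Sum>a\<in>UNIV - {0}. real_of_int (lam r (a * b)) * real_of_int (\<Sum>g\<in>set gs. lam r (a * mat_trace g))) =
      (\<Sum>a\<in>UNIV - {0}. A * (real_of_int (lam r (a * b)) * k a))"
    by (rule sum.cong[OF refl]) (simp add: k del: of_int_sum)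
  finally have "q * real ?n = A * (B + (\<Sum>a\<in>UNIV - {0}. real_of_int (lam r (a * b)) * k a))"
    using N distinct_card[OF gs] by (simp add: sum_distrib_left distrib_left)
  then show ?thesis by (simp add: field_simps)
qed

lemma moment_recursion_list:
  fixes gs :: "'a mat list" and k :: "'a \<Rightarrow> real"
  assumes gs: "distinct gs" and h: "h \<ge> 1" and A: "A \<noteq> 0"
    and k: "\<And>a. a \<noteq> 0 \<Longrightarrow>
      real (card (set gs)) - real_of_int (\<Sum>g\<in>set gs. lam r (a * mat_trace g)) = A * (B - k a)"
  shows "(\<Sum>a\<in>UNIV - {0}. k a ^ h) =
      (\<Sum>l<h. (-1) ^ (h + l + 1) * real (h choose l) * B ^ (h - l) * (\<Sum>a\<in>UNIV - {0}. k a ^ l))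
    + q * A powi (- int h) * (\<Sum>j=0..min (card (set gs)) h. (-1) ^ (h + j) * real (weight_count gs j) *
      (\<Sum>t=j..h. fact t * real (Stirling h t) * 2 ^ (h - t)
         * binom (real (card (set gs)) - real j) (int (card (set gs)) - int t)))"
proof -
  have "real (card {..<length gs}) - real_of_int (\<Sum>i<length gs. lam r (a * mat_trace (gs ! i))) = A * (B - k a)"
    if "a \<noteq> 0" for a
    using k[OF that] unfolding sum_list_distinct[OF gs, where f = "\<lambda>g. lam r (a * mat_trace g)"]
    by (simp add: distinct_card[OF gs])
  note rec = power_moment_recursion[OF finite_lessThan h A this]
  show ?thesis
    using rec unfolding weight_count_eq distinct_card[OF gs] card_lessThan .
qed

lemma card_trace_fibre_DC_1:
  fixes gs :: "'a mat list"
  assumes "(s = Plus \<and> even n \<and> n \<ge> 2) \<or> (s = Minus \<and> odd n)" and gs: "distinct gs" "set gs = DC 1 n"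
  shows "real (card {i\<in>{..<length gs}. mat_trace (gs ! i) = b}) =
    A1 s n q * (B1 s n q + (if b = 0 then 0 else q * real_of_int (lam r (inverse b))) + 1) / q"
proof -
  note v = DC_1_values[OF assms(1), folded gs(2)]
  have "(\<Sum>a\<in>UNIV - {0}. real_of_int (lam r (a * b)) * real_of_int (Kl r a)) =
      (if b = 0 then 0 else q * real_of_int (lam r (inverse b))) + 1"
    using arg_cong[OF sum_lam_Kl[of b], of real_of_int] by (simp split: if_splits)
  moreover have "real (card {i\<in>{..<length gs}. mat_trace (gs ! i) = b}) =
      A1 s n q * (B1 s n q + (\<Sum>a\<in>UNIV - {0}. real_of_int (lam r (a * b)) * real_of_int (Kl r a))) / q"
    by (rule card_trace_fibre[OF gs(1) v(2)]) (rule v(3))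
  ultimately show ?thesis by (simp only: add.assoc)
qed

lemma card_trace_fibre_DC_2:
  fixes gs :: "'a mat list"
  assumes "(s = Plus \<and> even n \<and> n \<ge> 2) \<or> (s = Minus \<and> odd n \<and> n \<ge> 3)" and gs: "distinct gs" "set gs = DC 2 n"
  shows "real (card {i\<in>{..<length gs}. mat_trace (gs ! i) = b}) =
    A2 s n q * (B2 s n q + (if b = 0 then q ^ 3 else q * real_of_int (Kl r (inverse b))) - q\<^sup>2 - 1) / q"
proof -
  note v = DC_2_values[OF assms(1), folded gs(2)]
  have "(\<Sum>a\<in>UNIV - {0}. real_of_int (lam r (a * b)) * real_of_int (Kl2 r a)) =
      (if b = 0 then 0 else q * real_of_int (Kl r (inverse b))) - 1"
    using arg_cong[OF sum_lam_Kl2[of b], of real_of_int] by (simp split: if_splits)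
  moreover have "(\<Sum>a\<in>UNIV - {0}. real_of_int (lam r (a * b))) = (if b = 0 then q else 0) - 1"
    using arg_cong[OF sum_lam_nonzero[of b], of real_of_int] by (simp add: mult.commute split: if_splits)
  moreover have "(\<Sum>a\<in>UNIV - {0}. real_of_int (lam r (a * b)) * (real_of_int (Kl2 r a) + q\<^sup>2)) =
      (\<Sum>a\<in>UNIV - {0}. real_of_int (lam r (a * b)) * real_of_int (Kl2 r a)) +
      (\<Sum>a\<in>UNIV - {0}. real_of_int (lam r (a * b))) * q\<^sup>2"
    by (simp only: distrib_left sum.distrib sum_distrib_right)
  ultimately have "(\<Sum>a\<in>UNIV - {0}. real_of_int (lam r (a * b)) * (real_of_int (Kl2 r a) + q\<^sup>2)) =
      ((if b = 0 then 0 else q * real_of_int (Kl r (inverse b))) - 1) + ((if b = 0 then q else 0) - 1) * q\<^sup>2"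
    by (simp only:)
  \<comment> \<open>The constant q^2 transforms to q^2 (q - 1) at b = 0 and to -q^2 elsewhere; hence
    q^3 - q^2 - 1 in the weight formula.\<close>
  also have "\<dots> = (if b = 0 then q ^ 3 else q * real_of_int (Kl r (inverse b))) - q\<^sup>2 - 1"
    by (simp add: power3_eq_cube power2_eq_square left_diff_distrib)
  finally have "(\<Sum>a\<in>UNIV - {0}. real_of_int (lam r (a * b)) * (real_of_int (Kl2 r a) + q\<^sup>2)) =
      (if b = 0 then q ^ 3 else q * real_of_int (Kl r (inverse b))) - q\<^sup>2 - 1" .
  moreover have "real (card {i\<in>{..<length gs}. mat_trace (gs ! i) = b}) =
      A2 s n q * (B2 s n q + (\<Sum>a\<in>UNIV - {0}. real_of_int (lam r (a * b)) * (real_of_int (Kl2 r a) + q\<^sup>2))) / q"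
    by (rule card_trace_fibre[OF gs(1) v(2)]) (rule v(3))
  ultimately show ?thesis by (simp only: add_diff_eq)
qed

lemma prod_nonzero: "(\<Prod>b\<in>UNIV. f b) = f 0 * (\<Prod>b\<in>{b::'a. b \<noteq> 0}. f b)"
proof -
  have "UNIV = insert 0 {b::'a. b \<noteq> 0}" by auto
  then have "(\<Prod>b\<in>UNIV. f b) = (\<Prod>b\<in>insert 0 {b::'a. b \<noteq> 0}. f b)" by (simp only:)
  also have "\<dots> = f 0 * (\<Prod>b\<in>{b::'a. b \<noteq> 0}. f b)" by (rule prod.insert) auto
  finally show ?thesis .
qed

lemma prod_trace_split:
  "(\<Prod>b\<in>UNIV. f b) = f 0 * (\<Prod>b\<in>{b::'a. b \<noteq> 0 \<and> abs_tr r (inverse b) = 0}. f b) *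
    (\<Prod>b\<in>{b. b \<noteq> 0 \<and> abs_tr r (inverse b) = 1}. f b)"
proof -
  have "{b::'a. b \<noteq> 0} = {b. b \<noteq> 0 \<and> abs_tr r (inverse b) = 0} \<union> {b. b \<noteq> 0 \<and> abs_tr r (inverse b) = 1}"
    using abs_tr_cases by auto
  moreover have "(\<Prod>b\<in>\<dots>. f b) = (\<Prod>b\<in>{b::'a. b \<noteq> 0 \<and> abs_tr r (inverse b) = 0}. f b) *
    (\<Prod>b\<in>{b. b \<noteq> 0 \<and> abs_tr r (inverse b) = 1}. f b)"
    by (rule prod.union_disjoint) auto
  ultimately show ?thesis unfolding prod_nonzero[of f] by (simp only: mult.assoc)
qed

lemma weight_count_DC_1:
  fixes gs :: "'a mat list"
  assumes "(s = Plus \<and> even n \<and> n \<ge> 2) \<or> (s = Minus \<and> odd n)" and gs: "distinct gs" "set gs = DC 1 n"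
  shows "real (weight_count gs j) =
    (\<Sum>\<nu>\<in>zero_sum_families j.
      binom (A1 s n q * (B1 s n q + 1) / q) (int (\<nu> (0::'a))) *
      (\<Prod>\<beta>\<in>{\<beta>. \<beta> \<noteq> 0 \<and> abs_tr r (inverse \<beta>) = 0}. binom (A1 s n q * (B1 s n q + q + 1) / q) (int (\<nu> \<beta>))) *
      (\<Prod>\<beta>\<in>{\<beta>. \<beta> \<noteq> 0 \<and> abs_tr r (inverse \<beta>) = 1}. binom (A1 s n q * (B1 s n q - q + 1) / q) (int (\<nu> \<beta>))))"
  unfolding real_weight_count card_trace_fibre_DC_1[OF assms] prod_trace_split
  by (intro sum.cong refl arg_cong2[where f = "(*)"] prod.cong) (simp_all add: lam_def)

lemma weight_count_DC_2:
  fixes gs :: "'a mat list"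
  assumes "(s = Plus \<and> even n \<and> n \<ge> 2) \<or> (s = Minus \<and> odd n \<and> n \<ge> 3)" and r: "r \<ge> 2"
    and gs: "distinct gs" "set gs = DC 2 n"
  shows "real (weight_count gs j) =
    (\<Sum>\<nu>\<in>zero_sum_families j.
      binom (A2 s n q * (B2 s n q + q ^ 3 - q ^ 2 - 1) / q) (int (\<nu> (0::'a))) *
      (\<Prod>\<tau>\<in>{\<tau>::int. \<bar>real_of_int \<tau>\<bar> < 2 * sqrt q \<and> [\<tau> = -1] (mod 4)}.
        \<Prod>\<beta>\<in>{\<beta>. \<beta> \<noteq> 0 \<and> Kl r (inverse \<beta>) = \<tau>}.
          binom (A2 s n q * (B2 s n q + q * real_of_int \<tau> - q ^ 2 - 1) / q) (int (\<nu> \<beta>))))"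
proof -
  let ?T = "{\<tau>::int. \<bar>real_of_int \<tau>\<bar> < 2 * sqrt q \<and> [\<tau> = -1] (mod 4)}"
  let ?f = "\<lambda>\<tau>. A2 s n q * (B2 s n q + q * real_of_int \<tau> - q ^ 2 - 1) / q"
  \<comment> \<open>Here the bound and the congruence enter: every value K(1/\<beta>) is among the
    listed \<tau>, so grouping the product by \<tau> loses no \<beta>.\<close>
  have "(\<lambda>\<beta>::'a. Kl r (inverse \<beta>)) ` {\<beta>. \<beta> \<noteq> 0} \<subseteq> ?T"
  proof (rule image_subsetI)
    fix \<beta> :: 'a assume "\<beta> \<in> {\<beta>. \<beta> \<noteq> 0}"
    then have b: "inverse \<beta> \<noteq> 0" by simp
    let ?K = "Kl r (inverse \<beta>)"
    have "real_of_int (?K\<^sup>2) < real_of_int (4 * Q)"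
      using Kl_bound[OF r b] unfolding of_int_less_iff .
    then have "\<bar>real_of_int ?K\<bar>\<^sup>2 < (2 * sqrt q)\<^sup>2" by (simp add: power_mult_distrib)
    then have "\<bar>real_of_int ?K\<bar> < 2 * sqrt q" by (rule power2_less_imp_less) simp
    then show "?K \<in> ?T" using Kl_cong_4[OF r b] by simp
  qed
  then have split: "(\<Prod>\<tau>\<in>?T. \<Prod>\<beta>\<in>{\<beta>. \<beta> \<noteq> 0 \<and> Kl r (inverse \<beta>) = \<tau>}. binom (?f \<tau>) (int (\<nu> \<beta>))) =
      (\<Prod>\<beta>\<in>{\<beta>::'a. \<beta> \<noteq> 0}. binom (?f (Kl r (inverse \<beta>))) (int (\<nu> \<beta>)))" for \<nu> :: "'a \<Rightarrow> nat"
    using prod.group[of "{\<beta>::'a. \<beta> \<noteq> 0}" ?T "\<lambda>\<beta>. Kl r (inverse \<beta>)" "\<lambda>\<beta>. binom (?f (Kl r (inverse \<beta>))) (int (\<nu> \<beta>))"]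
      finite_int_bounded by simp
  show ?thesis
    unfolding split real_weight_count card_trace_fibre_DC_2[OF assms(1) gs] prod_nonzero
    by (intro sum.cong refl arg_cong2[where f = "(*)"] prod.cong) simp_all
qed

section \<open>Recursions for the moments of Kloosterman sums\<close>

lemma MK_recursion_DC_1:
  fixes gs :: "'a mat list"
  assumes "(s = Plus \<and> even n \<and> n \<ge> 2) \<or> (s = Minus \<and> odd n)" and gs: "distinct gs" "set gs = DC 1 n" and h: "h \<ge> 1"
  defines "N \<equiv> card (DC 1 n :: 'a mat set)"
  shows "real_of_int (MK TYPE('a) r h) =
    (\<Sum>l<h. (-1) ^ (h + l + 1) * real (h choose l) * B1 s n q ^ (h - l) * real_of_int (MK TYPE('a) r l))
    + q * A1 s n q powi (- int h) * (\<Sum>j=0..min N h. (-1) ^ (h + j) * real (weight_count gs j) *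
      (\<Sum>t=j..h. fact t * real (Stirling h t) * 2 ^ (h - t) * binom (real N - real j) (int N - int t)))"
proof -
  note v = DC_1_values[OF assms(1), folded gs(2)]
  have "real (card (set gs)) - real_of_int (\<Sum>g\<in>set gs. lam r (a * mat_trace g)) = A1 s n q * (B1 s n q - real_of_int (Kl r a))"
    if "a \<noteq> 0" for a
    unfolding v(2) v(3)[OF that] by (simp only: right_diff_distrib)
  note rec = moment_recursion_list[OF gs(1) h v(1) this]
  show ?thesis
    using rec unfolding MK_def N_def gs(2) of_int_sum of_int_power by blast
qed

lemma MK2_recursion_DC_2:
  fixes gs :: "'a mat list"
  assumes "(s = Plus \<and> even n \<and> n \<ge> 2) \<or> (s = Minus \<and> odd n \<and> n \<ge> 3)" and gs: "distinct gs" "set gs = DC 2 n" and h: "h \<ge> 1"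
  defines "N \<equiv> card (DC 2 n :: 'a mat set)"
  shows "real_of_int (MK2 TYPE('a) r h) =
    (\<Sum>l<h. (-1) ^ (h + l + 1) * real (h choose l) * (B2 s n q - q ^ 2) ^ (h - l) * real_of_int (MK2 TYPE('a) r l))
    + q * A2 s n q powi (- int h) * (\<Sum>j=0..min N h. (-1) ^ (h + j) * real (weight_count gs j) *
      (\<Sum>t=j..h. fact t * real (Stirling h t) * 2 ^ (h - t) * binom (real N - real j) (int N - int t)))"
proof -
  note v = DC_2_values[OF assms(1), folded gs(2)]
  have "real (card (set gs)) - real_of_int (\<Sum>g\<in>set gs. lam r (a * mat_trace g)) = A2 s n q * (B2 s n q - q ^ 2 - real_of_int (Kl2 r a))"
    if "a \<noteq> 0" for a
    unfolding v(2) v(3)[OF that] by (simp add: algebra_simps)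
  note rec = moment_recursion_list[OF gs(1) h v(1) this]
  show ?thesis
    using rec unfolding MK2_def N_def gs(2) of_int_sum of_int_power by blast
qed

text \<open>Carlitz's identity turns A (B - q^2 - K_2) into A (B - q^2 + q - K^2), so the code that
  gives the moments of K_2 gives the even moments of K as well.\<close>

lemma MK_even_recursion_DC_2:
  fixes gs :: "'a mat list"
  assumes "(s = Plus \<and> even n \<and> n \<ge> 2) \<or> (s = Minus \<and> odd n \<and> n \<ge> 3)" and gs: "distinct gs" "set gs = DC 2 n" and h: "h \<ge> 1"
  defines "N \<equiv> card (DC 2 n :: 'a mat set)"
  shows "real_of_int (MK TYPE('a) r (2 * h)) =
    (\<Sum>l<h. (-1) ^ (h + l + 1) * real (h choose l) * (B2 s n q - q ^ 2 + q) ^ (h - l) * real_of_int (MK TYPE('a) r (2 * l)))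
    + q * A2 s n q powi (- int h) * (\<Sum>j=0..min N h. (-1) ^ (h + j) * real (weight_count gs j) *
      (\<Sum>t=j..h. fact t * real (Stirling h t) * 2 ^ (h - t) * binom (real N - real j) (int N - int t)))"
proof -
  note v = DC_2_values[OF assms(1), folded gs(2)]
  have "real (card (set gs)) - real_of_int (\<Sum>g\<in>set gs. lam r (a * mat_trace g)) = A2 s n q * (B2 s n q - q ^ 2 + q - real_of_int ((Kl r a)\<^sup>2))"
    if "a \<noteq> 0" for a
    unfolding v(2) v(3)[OF that] Kl2_eq[OF that] by (simp add: algebra_simps)
  note rec = moment_recursion_list[OF gs(1) h v(1) this]
  show ?thesis
    using rec unfolding MK_def N_def gs(2) of_int_sum of_int_power power_mult by blast
qed

end

theorem theorem1:
  fixes r :: nat and q :: real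
  assumes "r \<ge> 1"
    and "CARD('a::{field,finite}) = 2 ^ r"
    and "q = 2 ^ r"
  shows
    "(\<forall>(s::sign) (n::nat) (gs :: 'a mat list).
        ((s = Plus \<and> even n \<and> n \<ge> 2) \<or>
         (s = Minus \<and> odd n \<and> n \<ge> 3) \<or>
         (s = Minus \<and> n = 1 \<and> q \<ge> 8)) \<and>
        distinct gs \<and> set gs = DC 1 n \<longrightarrow>
        (let N = card (DC 1 n :: 'a mat set); A = A1 s n q; B = B1 s n q; C = weight_count gs in
          (\<forall>h::nat. h \<ge> 1 \<longrightarrow>
             real_of_int (MK TYPE('a) r h) =
               (\<Sum>l<h. (-1) ^ (h + l + 1) * real (h choose l) * B ^ (h - l)
                  * real_of_int (MK TYPE('a) r l))
             + q * A powi (- int h) *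
               (\<Sum>j=0..min N h. (-1) ^ (h + j) * real (C j) *
                  (\<Sum>t=j..h. fact t * real (Stirling h t) * 2 ^ (h - t)
                     * binom (real N - real j) (int N - int t)))) \<and>
          real N = A * B \<and>
          (\<forall>j\<le>N. real (C j) =
             (\<Sum>\<nu>\<in>zero_sum_families j.
                binom (A * (B + 1) / q) (int (\<nu> (0::'a))) *
                (\<Prod>\<beta>\<in>{\<beta>. \<beta> \<noteq> 0 \<and> abs_tr r (inverse \<beta>) = 0}.
                   binom (A * (B + q + 1) / q) (int (\<nu> \<beta>))) *
                (\<Prod>\<beta>\<in>{\<beta>. \<beta> \<noteq> 0 \<and> abs_tr r (inverse \<beta>) = 1}.
                   binom (A * (B - q + 1) / q) (int (\<nu> \<beta>)))))))
     \<and>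
     (\<forall>(s::sign) (n::nat) (gs :: 'a mat list).
        ((s = Plus \<and> even n \<and> n \<ge> 2) \<or> (s = Minus \<and> odd n \<and> n \<ge> 3)) \<and> q \<ge> 4 \<and>
        distinct gs \<and> set gs = DC 2 n \<longrightarrow>
        (let N = card (DC 2 n :: 'a mat set); A = A2 s n q; B = B2 s n q; C = weight_count gs in
          (\<forall>h::nat. h \<ge> 1 \<longrightarrow>
             real_of_int (MK2 TYPE('a) r h) =
               (\<Sum>l<h. (-1) ^ (h + l + 1) * real (h choose l) * (B - q^2) ^ (h - l)
                  * real_of_int (MK2 TYPE('a) r l))
             + q * A powi (- int h) *
               (\<Sum>j=0..min N h. (-1) ^ (h + j) * real (C j) *
                  (\<Sum>t=j..h. fact t * real (Stirling h t) * 2 ^ (h - t)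
                     * binom (real N - real j) (int N - int t)))) \<and>
          (\<forall>h::nat. h \<ge> 1 \<longrightarrow>
             real_of_int (MK TYPE('a) r (2 * h)) =
               (\<Sum>l<h. (-1) ^ (h + l + 1) * real (h choose l) * (B - q^2 + q) ^ (h - l)
                  * real_of_int (MK TYPE('a) r (2 * l)))
             + q * A powi (- int h) *
               (\<Sum>j=0..min N h. (-1) ^ (h + j) * real (C j) *
                  (\<Sum>t=j..h. fact t * real (Stirling h t) * 2 ^ (h - t)
                     * binom (real N - real j) (int N - int t)))) \<and>
          real N = A * B \<and>
          (\<forall>j\<le>N. real (C j) =
             (\<Sum>\<nu>\<in>zero_sum_families j.
                binom (A * (B + q^3 - q^2 - 1) / q) (int (\<nu> (0::'a))) *
                (\<Prod>\<tau>\<in>{\<tau>::int. \<bar>real_of_int \<tau>\<bar> < 2 * sqrt q \<and> [\<tau> = -1] (mod 4)}.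
                   \<Prod>\<beta>\<in>{\<beta>. \<beta> \<noteq> 0 \<and> Kl r (inverse \<beta>) = \<tau>}.
                     binom (A * (B + q * real_of_int \<tau> - q^2 - 1) / q) (int (\<nu> \<beta>)))))))"
proof -
  interpret char2_field r "TYPE('a)"
    using assms(1,2) by unfold_locales
  \<comment> \<open>q >= 4 excludes r = 1, as the congruence modulo 4 and the strict bound on K
    demand.\<close>
  have r: "r \<ge> 2" if "(2::real) ^ r \<ge> 4"
  proof (rule ccontr)
    assume "\<not> r \<ge> 2"
    then have "r = 1" using assms(1) by simp
    then show False using that by simp
  qed
  show ?thesis
    unfolding Let_def assms(3)
  proof (intro conjI allI impI, goal_cases)
    case (1 s n gs h)
    then show ?case by (intro MK_recursion_DC_1) auto
  next
    case (2 s n gs)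
    then show ?case by (intro DC_1_values) auto
  next
    case (3 s n gs j)
    then show ?case by (intro weight_count_DC_1) auto
  next
    case (4 s n gs h)
    then show ?case by (intro MK2_recursion_DC_2) simp_all
  next
    case (5 s n gs h)
    then show ?case by (intro MK_even_recursion_DC_2) simp_all
  next
    case (6 s n gs)
    then show ?case by (intro DC_2_values) simp_all
  next
    case (7 s n gs j)
    then show ?case by (intro weight_count_DC_2 r) simp_all
  qed
qed

end
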